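(* (i) The infimum of $\sigma_{xxpp}\,\sigma_{ppxx}$ over all real-valued, normalized, spherically symmetric four-partite wave functions $\psi(x_1,\dots,x_4)=\Psi\bigl(\sqrt{x_1^2+\dots+x_4^2}\bigr)$ equals $\frac{1}{30}$. (ii) The infimum of $\sigma_{xxxppp}\,\sigma_{pppxxx}$ over all real-valued, normalized, spherically symmetric six-partite wave functions $\psi(x_1,\dots,x_6)=\Psi\bigl(\sqrt{x_1^2+\dots+x_6^2}\bigr)$ equals $\frac{35}{4096}$.
   Context: Units are such that $\hat p_j=-i\,\partial/\partial x_j$ and $\hat x_j$ is multiplication by $x_j$. For an even number $N=2n$ of parties and a normalized wave function $\psi\in L^2(\mathbf{R}^N)$, $\int_{\mathbf{R}^N}\psi^2\,d\mathbf{x}=1$, $\sigma_{x\ldots xp\ldots p}$ denotes the standard deviation of the operator $\hat x_1\cdots\hat x_n\hat p_{n+1}\cdots\hat p_{2n}$ and $\sigma_{p\ldots px\ldots x}$ that of $\hat p_1\cdots\hat p_n\hat x_{n+1}\cdots\hat x_{2n}$ ($n$ letters of each kind; $n=2$ in (i), $n=3$ in (ii)). The standard deviation of $\hat X$ is $\sqrt{\langle\hat X^2\rangle-\langle\hat X\rangle^2}$ with $\langle\hat X^2\rangle=\|\hat X\psi\|^2$. Only sufficiently regular wave functions for which both standard deviations are finite (i.e. $x_1\cdots x_n\,\partial_{n+1}\cdots\partial_{2n}\psi$ and $x_{n+1}\cdots x_{2n}\,\partial_1\cdots\partial_n\psi$ are square-integrable) are considered. *)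

theory Defs
  imports "HOL-Analysis.Analysis"
begin

definition partial_deriv :: "'n::finite \<Rightarrow> (real^'n \<Rightarrow> real) \<Rightarrow> real^'n \<Rightarrow> real" where
  "partial_deriv j f x = deriv (\<lambda>t. f (x + t *\<^sub>R axis j 1)) 0"

definition partial_derivs :: "'n::finite list \<Rightarrow> (real^'n \<Rightarrow> real) \<Rightarrow> real^'n \<Rightarrow> real" where
  "partial_derivs js f = foldr partial_deriv js f"

(* Total differentiability of all iterated partial derivatives (including f itself, the
   empty list) is the same as being infinitely often continuously differentiable. *)
definition test_function :: "(real^'n::finite \<Rightarrow> real) \<Rightarrow> bool" where
  "test_function \<phi> \<longleftrightarrow>
     (\<forall>js. partial_derivs js \<phi> differentiable_on UNIV) \<and> compact (closure {x. \<phi> x \<noteq> 0})"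

definition locally_integrable :: "(real^'n::finite \<Rightarrow> complex) \<Rightarrow> bool" where
  "locally_integrable f \<longleftrightarrow> (\<forall>K. compact K \<longrightarrow> set_integrable lborel K f)"

definition has_weak_partial_derivs ::
    "(real^'n::finite \<Rightarrow> complex) \<Rightarrow> (real^'n \<Rightarrow> complex) \<Rightarrow> 'n list \<Rightarrow> bool" where
  "has_weak_partial_derivs \<psi> g js \<longleftrightarrow>
     locally_integrable \<psi> \<and> locally_integrable g \<and>
     (\<forall>\<phi>. test_function \<phi> \<longrightarrow>
        (LINT x|lborel. partial_derivs js \<phi> x *\<^sub>R \<psi> x)
          = (-1) ^ length js * (LINT x|lborel. \<phi> x *\<^sub>R g x))"

definition square_integrable :: "(real^'n::finite \<Rightarrow> complex) \<Rightarrow> bool" where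
  "square_integrable f \<longleftrightarrow>
     f \<in> borel_measurable lborel \<and> integrable lborel (\<lambda>x. (cmod (f x))\<^sup>2)"

definition wave_function :: "(real^'n::finite \<Rightarrow> complex) \<Rightarrow> bool" where
  "wave_function \<psi> \<longleftrightarrow> square_integrable \<psi> \<and> (LINT x|lborel. (cmod (\<psi> x))\<^sup>2) = 1"

definition real_spherically_symmetric :: "(real^'n::finite \<Rightarrow> complex) \<Rightarrow> bool" where
  "real_spherically_symmetric \<psi> \<longleftrightarrow>
     (\<exists>\<Psi> :: real \<Rightarrow> real. \<forall>x. \<psi> x = complex_of_real (\<Psi> (norm x)))"

(* has_op_value xs ps \<psi> \<eta>: applying to \<psi> the product of the position operators with indices
   in xs and the momentum operators with indices in ps (xs and ps disjoint) gives the
   square-integrable function \<eta>. A relation rather than a function, because weak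
   derivatives are determined only almost everywhere. *)
definition has_op_value ::
    "'n::finite list \<Rightarrow> 'n list \<Rightarrow> (real^'n \<Rightarrow> complex) \<Rightarrow> (real^'n \<Rightarrow> complex) \<Rightarrow> bool" where
  "has_op_value xs ps \<psi> \<eta> \<longleftrightarrow>
     (\<exists>g. has_weak_partial_derivs \<psi> g ps \<and>
          \<eta> = (\<lambda>x. (- \<i>) ^ length ps * complex_of_real (\<Prod>j\<leftarrow>xs. x $ j) * g x)) \<and>
     square_integrable \<eta>"

(* The operator is symmetric, so its expectation value is real; Re only adjusts the type. *)
definition has_std_dev ::
    "'n::finite list \<Rightarrow> 'n list \<Rightarrow> (real^'n \<Rightarrow> complex) \<Rightarrow> real \<Rightarrow> bool" where
  "has_std_dev xs ps \<psi> \<sigma> \<longleftrightarrow>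
     (\<exists>\<eta>. has_op_value xs ps \<psi> \<eta> \<and>
          \<sigma> = sqrt ((LINT x|lborel. (cmod (\<eta> x))\<^sup>2)
                     - (Re (LINT x|lborel. cnj (\<psi> x) * \<eta> x))\<^sup>2))"

definition uncertainty_products :: "'n::finite list \<Rightarrow> 'n list \<Rightarrow> real set" where
  "uncertainty_products as bs =
     {\<sigma> * \<tau> | \<psi> \<sigma> \<tau>. wave_function \<psi> \<and> real_spherically_symmetric \<psi> \<and>
                has_std_dev as bs \<psi> \<sigma> \<and> has_std_dev bs as \<psi> \<tau>}"

(* Inf on the reals is meaningful only for nonempty sets bounded below. *)
definition has_infimum :: "real set \<Rightarrow> real \<Rightarrow> bool" where
  "has_infimum S c \<longleftrightarrow> S \<noteq> {} \<and> bdd_below S \<and> Inf S = c"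

(* In the index type 4 the numeral 4 denotes the element 0 (arithmetic modulo 4), so 1, 2, 3, 4
   are its four distinct elements; likewise 1, ..., 6 in the index type 6. *)

end

(* Write psi(x) = f(s) with s = |x|^2 / 2 and let n be the number of letters of each kind.  For
   smooth f, applying n derivatives in distinct coordinates gives
   x_1 ... x_n d_(n+1) ... d_(2n) psi = x_1 ... x_2n f^(n)(s), so both operators produce the same
   function up to a phase, with expectation 0 by oddness in one coordinate, and the product of the
   deviations is its squared norm.  The law of s under (prod_(i in T) x_i^2) dx is a multiple of
   s^(n + |T| - 1) ds, which turns the problem into minimizing
   int s^(3n-1) f^(n)(s)^2 ds against int s^(n-1) f(s)^2 ds, a weighted Hardy-Rellich quotient with
   infimum prod_(j<n) (n/2 + j)^2, approached but not attained by f = s^(-n/2).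

   Lower bound: f has only weak derivatives, so we dualize.  Testing with
   x_1^2 ... x_n^2 x_(n+1) ... x_2n h(s), w = s^(3n-1) h, bounds (int f w^(n) ds)^2 by
   the energy times int w^2 / s^(3n-1) ds, and n-fold Hardy bounds the latter by
   int (w^(n))^2 / s^(n-1) ds.  Since the functions w^(n), w smooth with compact support in the
   open half-line, are dense in L^2(s^(1-n) ds), w^(n) can be taken close to s^(n-1) f.

   Upper bound: f = (1 + s)^(-n/2 - epsilon); here the energy quotient is bounded via the pointwise
   inequality s <= 1 + s, and epsilon tends to 0. *)
theory Submission imports Defs "HOL-Probability.Probability" begin

section \<open>Smooth functions and test functions on the half-line\<close>

text \<open>The lower bound never forms a derivative of the profile \<open>f\<close> on the
  half-line: weak differentiability in space does not directly provide one, and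
  \<open>\<eta>\<close> is known only through pairings with test functions. For the same reason the
  vanishing of the expectation cannot be read off from a formula for \<open>\<eta>\<close> and needs
  an approximation argument of its own. Each deviation is bounded below separately by the square
  root of the constant, so the two operator values are never compared. The exponents fit: n Hardy
  steps raise the weight exponent from n - 1 to 3n - 1, the radial exponent of the energy, and the
  step starting at n - 1 + 2j contributes n/2 + j. The radial law with power s^k carries the
  constant (2 pi)^n / k!; comparing k = n - 1 with k = 3n - 1 gives the factorials in
  \<open>sharp_constant\<close>. The density of n-th derivatives of test functions is delicate,
  because their moments of order below n vanish. It holds because these moments are unbounded
  functionals on the weighted space: mass can be spread out towards infinity at negligible
  cost.\<close>

primrec times_differentiable :: "nat \<Rightarrow> (real \<Rightarrow> real) \<Rightarrow> bool" where
  "times_differentiable 0 f \<longleftrightarrow> True"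
| "times_differentiable (Suc k) f \<longleftrightarrow>
     (\<forall>x. f field_differentiable at x) \<and> times_differentiable k (deriv f)"

definition smooth :: "(real \<Rightarrow> real) \<Rightarrow> bool" where
  "smooth f \<longleftrightarrow> (\<forall>k. times_differentiable k f)"

lemma times_differentiable_SucI:
  assumes "\<And>x. (f has_real_derivative f' x) (at x)" "times_differentiable k f'"
  shows "times_differentiable (Suc k) f"
proof -
  have "deriv f = f'" using assms(1) by (auto intro: DERIV_imp_deriv)
  then show ?thesis using assms by (auto simp: field_differentiable_def)
qed

lemma times_differentiable_SucE:
  assumes "times_differentiable (Suc k) f"
  shows "(f has_real_derivative deriv f x) (at x)" "times_differentiable k (deriv f)"
  using assms by (auto simp: DERIV_deriv_iff_field_differentiable)

lemma times_differentiable_Suc_imp: "times_differentiable (Suc k) f \<Longrightarrow> times_differentiable k f"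
  by (induction k arbitrary: f) auto

lemma times_differentiable_const: "times_differentiable k (\<lambda>_. c)"
proof (induction k arbitrary: c)
  case (Suc k)
  show ?case by (rule times_differentiable_SucI[OF DERIV_const Suc.IH])
qed auto

lemma times_differentiable_affine: "times_differentiable k (\<lambda>x. c * x + d)"
proof (cases k)
  case (Suc j)
  show ?thesis unfolding Suc
    by (rule times_differentiable_SucI[where f' = "\<lambda>_. c"])
      (auto intro!: derivative_eq_intros times_differentiable_const)
qed auto

lemma times_differentiable_add:
  "times_differentiable k f \<Longrightarrow> times_differentiable k g \<Longrightarrow> times_differentiable k (\<lambda>x. f x + g x)"
proof (induction k arbitrary: f g)
  case (Suc k)
  show ?case
    by (rule times_differentiable_SucI[where f' = "\<lambda>x. deriv f x + deriv g x"])
      (use Suc.IH[OF Suc.prems[THEN times_differentiable_SucE(2)]]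
         Suc.prems[THEN times_differentiable_SucE(1)] in \<open>auto intro!: DERIV_add\<close>)
qed auto

lemma times_differentiable_mult:
  "times_differentiable k f \<Longrightarrow> times_differentiable k g \<Longrightarrow> times_differentiable k (\<lambda>x. f x * g x)"
proof (induction k arbitrary: f g)
  case (Suc k)
  note d = Suc.prems[THEN times_differentiable_SucE(1)]
    and t = Suc.prems[THEN times_differentiable_SucE(2)]
    and p = Suc.prems[THEN times_differentiable_Suc_imp]
  show ?case
    by (rule times_differentiable_SucI[where f' = "\<lambda>x. deriv f x * g x + f x * deriv g x"])
      (use d in \<open>auto intro!: derivative_eq_intros times_differentiable_add Suc.IH t p\<close>)
qed auto

lemma times_differentiable_compose_affine:
  "times_differentiable k f \<Longrightarrow> times_differentiable k (\<lambda>x. f (c * x + d))"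
proof (induction k arbitrary: f)
  case (Suc k)
  note d = Suc.prems[THEN times_differentiable_SucE(1)]
    and t = Suc.prems[THEN times_differentiable_SucE(2)]
  show ?case
  proof (rule times_differentiable_SucI[where f' = "\<lambda>x. c * deriv f (c * x + d)"])
    show "((\<lambda>x. f (c * x + d)) has_real_derivative c * deriv f (c * x + d)) (at x)" for x
      by (rule DERIV_chain2[OF d, THEN DERIV_cong]) (auto intro!: derivative_eq_intros)
  qed (intro times_differentiable_mult times_differentiable_const Suc.IH t)
qed auto

lemma smooth_DERIV: "smooth f \<Longrightarrow> (f has_real_derivative deriv f x) (at x)"
  unfolding smooth_def by (blast intro: times_differentiable_SucE(1))

lemma smooth_deriv: "smooth f \<Longrightarrow> smooth (deriv f)"
  unfolding smooth_def by (blast intro: times_differentiable_SucE(2))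

lemma smooth_deriv_funpow: "smooth f \<Longrightarrow> smooth ((deriv ^^ k) f)"
  by (induction k) (auto intro: smooth_deriv)

lemma smooth_antideriv:
  assumes "\<And>x. (F has_real_derivative f x) (at x)" "smooth f"
  shows "smooth F"
proof -
  have "times_differentiable k F" for k
  proof (cases k)
    case (Suc j)
    show ?thesis unfolding Suc
      by (rule times_differentiable_SucI[OF assms(1)]) (use assms(2) in \<open>simp add: smooth_def\<close>)
  qed auto
  then show ?thesis by (simp add: smooth_def)
qed

lemma smooth_continuous: "smooth f \<Longrightarrow> continuous_on A f"
  by (meson DERIV_continuous_on smooth_DERIV has_field_derivative_at_within)

lemma smooth_measurable: "smooth f \<Longrightarrow> f \<in> borel_measurable borel"
  by (intro borel_measurable_continuous_onI smooth_continuous)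

lemma smooth_const: "smooth (\<lambda>_. c)"
  and smooth_affine: "smooth (\<lambda>x. c * x + d)"
  and smooth_add: "smooth f \<Longrightarrow> smooth g \<Longrightarrow> smooth (\<lambda>x. f x + g x)"
  and smooth_mult: "smooth f \<Longrightarrow> smooth g \<Longrightarrow> smooth (\<lambda>x. f x * g x)"
  and smooth_compose_affine: "smooth f \<Longrightarrow> smooth (\<lambda>x. f (c * x + d))"
  by (simp_all add: smooth_def times_differentiable_const times_differentiable_affine
      times_differentiable_add times_differentiable_mult times_differentiable_compose_affine)

lemma smooth_power: "smooth (\<lambda>x. x ^ m)"
proof (induction m)
  case (Suc m)
  then show ?case using smooth_mult[OF smooth_affine[of 1 0]] by simp
qed (simp add: smooth_const)

text \<open>Lets the polynomials supplied by Stone--Weierstrass be cut off to test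
  functions.\<close>

lemma smooth_real_polynomial_function: "real_polynomial_function p \<Longrightarrow> smooth p"
proof (induction rule: real_polynomial_function.induct)
  case (linear f)
  then interpret bounded_linear f .
  have "f = (\<lambda>x. f 1 * x + 0)"
  proof
    show "f x = f 1 * x + 0" for x
      by (metis scaleR real_scaleR_def mult.commute mult.left_neutral add.right_neutral)
  qed
  then show ?case using smooth_affine by metis
qed (auto intro: smooth_const smooth_add smooth_mult)

text \<open>The functions \<open>x \<mapsto> x\<^sup>-\<^sup>m exp (-1/x)\<close> on the positive half-line, extended by zero, have
  derivatives in their own linear span.\<close>

definition flat :: "nat \<Rightarrow> real \<Rightarrow> real" where
  "flat m x = (if x > 0 then (1 / x) ^ m * exp (- (1 / x)) else 0)"

lemma flat_tendsto_0: "(flat m \<longlongrightarrow> 0) (at 0)"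
proof -
  have "((\<lambda>y::real. y ^ m / exp y) \<longlongrightarrow> 0) at_top" by (rule tendsto_power_div_exp_0)
  then have "((\<lambda>x::real. inverse x ^ m / exp (inverse x)) \<longlongrightarrow> 0) (at_right 0)"
    by (rule filterlim_compose[OF _ filterlim_inverse_at_top_right])
  then have "(flat m \<longlongrightarrow> 0) (at_right 0)"
    by (rule Lim_transform_eventually)
      (auto simp: eventually_at_right_field flat_def exp_minus field_simps intro!: exI[of _ 1])
  moreover have "(flat m \<longlongrightarrow> 0) (at_left 0)"
    by (rule Lim_transform_eventually[OF tendsto_const])
      (auto simp: eventually_at_left_field flat_def intro!: exI[of _ "-1"])
  ultimately show ?thesis by (simp add: filterlim_split_at)
qed

text \<open>Away from 0 this is the product rule or trivial; at 0 the difference quotient of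
  \<open>flat m\<close> is \<open>flat (Suc m)\<close>, which tends to 0.\<close>

lemma flat_DERIV:
  "(flat m has_real_derivative - real m * flat (Suc m) x + flat (Suc (Suc m)) x) (at x)"
proof -
  consider "x > 0" | "x < 0" | "x = 0" by linarith
  then show ?thesis
  proof cases
    case 1
    have "((\<lambda>x. (1 / x) ^ m * exp (- (1 / x))) has_real_derivative
      - real m * flat (Suc m) x + flat (Suc (Suc m)) x) (at x)"
    proof (cases m)
      case (Suc j)
      have "((\<lambda>x. (1 / x) ^ Suc j) has_real_derivative
        real (Suc j) * ((- 1 / x\<^sup>2) * (1 / x) ^ j)) (at x)"
        using 1 by (intro DERIV_power_Suc[THEN DERIV_cong] derivative_eq_intros refl)
          (auto simp: power2_eq_square)
      moreover have "((\<lambda>x. exp (- (1 / x))) has_real_derivative exp (- (1 / x)) / x\<^sup>2) (at x)"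
        using 1 by (auto intro!: derivative_eq_intros simp: power2_eq_square)
      ultimately show ?thesis unfolding Suc
        by (rule DERIV_cong[OF DERIV_mult])
          (use 1 in \<open>simp add: flat_def power2_eq_square field_simps\<close>)
    qed (use 1 in \<open>auto intro!: derivative_eq_intros simp: flat_def power2_eq_square\<close>)
    then show ?thesis
      by (rule has_field_derivative_transform_within[where d = x])
        (use 1 in \<open>auto simp: flat_def dist_real_def\<close>)
  next
    case 2
    show ?thesis
      by (rule has_field_derivative_transform_within[where d = "-x" and f = "\<lambda>_. 0"])
        (use 2 in \<open>auto simp: flat_def dist_real_def\<close>)
  next
    case 3
    have "(\<lambda>h. flat m h / h) = flat (Suc m)" by (auto simp: flat_def)
    then show ?thesis
      using flat_tendsto_0[of "Suc m"] by (simp add: 3 DERIV_def) (simp add: flat_def)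
  qed
qed

lemma smooth_flat: "smooth (flat m)"
proof -
  have "times_differentiable k (flat m)" for k m
  proof (induction k arbitrary: m)
    case (Suc k)
    show ?case
      by (rule times_differentiable_SucI[OF flat_DERIV])
        (intro times_differentiable_add times_differentiable_mult times_differentiable_const Suc.IH)
  qed auto
  then show ?thesis by (simp add: smooth_def)
qed

text \<open>An unnormalized smooth cutoff. It increases with the interval
  (\<open>bump_mono\<close>), which the truncation in \<open>approx_by_bump_bounded\<close> relies
  on.\<close>

definition bump :: "real \<Rightarrow> real \<Rightarrow> real \<Rightarrow> real" where
  "bump a b x = flat 0 (x - a) * flat 0 (b - x)"

lemma bump_pos: "a < x \<Longrightarrow> x < b \<Longrightarrow> bump a b x > 0"
  by (simp add: bump_def flat_def)

lemma bump_eq_0: "x \<le> a \<or> b \<le> x \<Longrightarrow> bump a b x = 0"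
  by (auto simp: bump_def flat_def)

lemma bump_bounds: "0 \<le> bump a b x" "bump a b x \<le> 1"
proof -
  have "0 \<le> flat 0 y" "flat 0 y \<le> 1" for y by (auto simp: flat_def)
  then show "0 \<le> bump a b x" "bump a b x \<le> 1"
    unfolding bump_def by (auto intro: mult_le_one)
qed

lemma smooth_bump: "smooth (bump a b)"
proof -
  have "smooth (\<lambda>x. flat 0 (1 * x + (- a)) * flat 0 ((-1) * x + b))"
    by (intro smooth_mult smooth_compose_affine smooth_flat)
  then show ?thesis by (simp add: bump_def[abs_def])
qed

text \<open>Support bounded away from 0 makes division by powers of \<open>x\<close> harmless, and
  vanishing for \<open>x \<le> 0\<close> lets half-line integrals be written over the whole
  line.\<close>

definition test_pos :: "(real \<Rightarrow> real) \<Rightarrow> bool" where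
  "test_pos w \<longleftrightarrow> smooth w \<and> (\<exists>a b. 0 < a \<and> a < b \<and> (\<forall>x. x \<notin> {a<..<b} \<longrightarrow> w x = 0))"

lemma test_posE:
  assumes "test_pos w"
  obtains a b where "0 < a" "a < b" "\<forall>x. x \<notin> {a<..<b} \<longrightarrow> w x = 0" "smooth w"
  using assms by (auto simp: test_pos_def)

lemma test_pos_deriv:
  assumes "test_pos w"
  shows "test_pos (deriv w)"
proof -
  obtain a b where ab: "0 < a" "a < b" "\<forall>x. x \<notin> {a<..<b} \<longrightarrow> w x = 0" "smooth w"
    by (rule test_posE[OF assms])
  \<comment> \<open>The support interval is widened so that only points of the open complement of
    [a, b] matter and the end points need no separate treatment.\<close>
  have "deriv w x = 0" if "x \<notin> {a / 2<..<b + 1}" for x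
  proof (rule DERIV_imp_deriv, rule has_field_derivative_transform_within_open[where f = "\<lambda>_. 0"])
    show "open (- {a..b})" by auto
  qed (use that ab in \<open>auto\<close>)
  moreover have "0 < a / 2" "a / 2 < b + 1" using ab(1,2) by auto
  ultimately show ?thesis unfolding test_pos_def using smooth_deriv[OF ab(4)] by blast
qed

lemma test_pos_deriv_funpow: "test_pos w \<Longrightarrow> test_pos ((deriv ^^ k) w)"
  by (induction k) (auto intro: test_pos_deriv)

lemma test_pos_smooth: "test_pos w \<Longrightarrow> smooth w"
  by (simp add: test_pos_def)

lemma test_pos_mult: "smooth p \<Longrightarrow> test_pos w \<Longrightarrow> test_pos (\<lambda>x. p x * w x)"
  by (force simp: test_pos_def intro: smooth_mult)

lemma test_pos_add:
  assumes "test_pos u" "test_pos w"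
  shows "test_pos (\<lambda>x. u x + w x)"
proof -
  obtain a b where ab: "0 < a" "a < b" "\<forall>x. x \<notin> {a<..<b} \<longrightarrow> u x = 0" "smooth u"
    by (rule test_posE[OF assms(1)])
  obtain c d where cd: "0 < c" "c < d" "\<forall>x. x \<notin> {c<..<d} \<longrightarrow> w x = 0" "smooth w"
    by (rule test_posE[OF assms(2)])
  have "u x + w x = 0" if "x \<notin> {min a c<..<max b d}" for x
    using ab(3)[rule_format, of x] cd(3)[rule_format, of x] that by (auto simp: min_less_iff_disj less_max_iff_disj)
  moreover have "0 < min a c" "min a c < max b d" using ab(1,2) cd(1,2) by auto
  ultimately show ?thesis unfolding test_pos_def
    using smooth_add[OF ab(4) cd(4)] by blast
qed

lemma test_pos_bump: "0 < a \<Longrightarrow> a < b \<Longrightarrow> test_pos (bump a b)"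
  unfolding test_pos_def
  by (intro conjI exI[of _ a] exI[of _ b] smooth_bump) (auto intro: bump_eq_0)

lemma test_pos_scale:
  assumes "test_pos w" "R > 0"
  shows "test_pos (\<lambda>x. w (x / R))"
proof -
  obtain a b where ab: "0 < a" "a < b" "\<forall>x. x \<notin> {a<..<b} \<longrightarrow> w x = 0" "smooth w"
    by (rule test_posE[OF assms(1)])
  have "smooth (\<lambda>x. w (x / R))" using smooth_compose_affine[OF ab(4), of "1 / R" 0] by simp
  moreover have "w (x / R) = 0" if "x \<notin> {a * R<..<b * R}" for x
    by (rule ab(3)[rule_format]) (use that \<open>R > 0\<close> in \<open>auto simp: field_simps\<close>)
  moreover have "0 < a * R" "a * R < b * R" using ab(1,2) \<open>R > 0\<close> by auto
  ultimately show ?thesis unfolding test_pos_def by blast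
qed

text \<open>Differentiation produces both \<open>deriv w x / x ^ m\<close> and
  \<open>w x / x ^ Suc m\<close>, so the induction on the order has to range over all
  \<open>w\<close> and \<open>m\<close>.\<close>

lemma test_pos_divide_power:
  assumes "test_pos w"
  shows "test_pos (\<lambda>x. w x / x ^ m)"
proof -
  have "times_differentiable k (\<lambda>x. w x / x ^ m)" if "test_pos w" for k m w
    using that
  proof (induction k arbitrary: m w)
    case (Suc k)
    obtain a b where ab: "0 < a" "a < b" "\<forall>x. x \<notin> {a<..<b} \<longrightarrow> w x = 0" "smooth w"
      by (rule test_posE[OF Suc.prems])
    show ?case
    proof (rule times_differentiable_SucI[where
          f' = "\<lambda>x. deriv w x / x ^ m + (- real m) * (w x / x ^ Suc m)"])
      show "((\<lambda>x. w x / x ^ m) has_real_derivative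
        deriv w x / x ^ m + (- real m) * (w x / x ^ Suc m)) (at x)" for x
      proof (cases "x > 0")
        case True
        have "(deriv w x * x ^ m - w x * (real m * x ^ (m - Suc 0))) / (x ^ m * x ^ m)
          = deriv w x / x ^ m + (- real m) * (w x / x ^ Suc m)"
        proof (cases m)
          case (Suc j)
          have "w x * (real m * x ^ (m - Suc 0)) / (x ^ m * x ^ m) = real m * (w x / x ^ Suc m)"
            using True unfolding Suc by (simp add: divide_simps)
          moreover have "deriv w x * x ^ m / (x ^ m * x ^ m) = deriv w x / x ^ m"
            using True by simp
          ultimately show ?thesis by (simp only: diff_divide_distrib)
        qed auto
        moreover have "((\<lambda>x. w x / x ^ m) has_real_derivative
          (deriv w x * x ^ m - w x * (real m * x ^ (m - Suc 0))) / (x ^ m * x ^ m)) (at x)"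
          using DERIV_divide[OF smooth_DERIV[OF ab(4)] DERIV_pow[of m x]] True by simp
        ultimately show ?thesis by simp
      next
        case False
        \<comment> \<open>For \<open>x \<le> 0\<close> both \<open>w\<close> and the quotient vanish
          on the neighbourhood \<open>{..<a}\<close> of \<open>x\<close>; at 0 this uses the
          convention 0 / 0 = 0.\<close>
        have "(f has_real_derivative 0) (at x)" if "\<And>y. y < a \<Longrightarrow> f y = 0" for f
          by (rule has_field_derivative_transform_within_open[where f = "\<lambda>_. 0" and S = "{..<a}"])
            (use that False ab in auto)
        from this[of w] this[of "\<lambda>x. w x / x ^ m"] show ?thesis
          using ab False by (simp add: DERIV_imp_deriv)
      qed
      show "times_differentiable k (\<lambda>x. deriv w x / x ^ m + (- real m) * (w x / x ^ Suc m))"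
        by (intro times_differentiable_add times_differentiable_mult times_differentiable_const Suc.IH
            test_pos_deriv Suc.prems)
    qed
  qed auto
  then have "smooth (\<lambda>x. w x / x ^ m)" using assms by (simp add: smooth_def)
  then show ?thesis using assms by (force simp: test_pos_def)
qed

lemma deriv_funpow_linear:
  assumes "smooth f" "smooth g"
  shows "(deriv ^^ k) (\<lambda>s. a * f s + g s) = (\<lambda>s. a * (deriv ^^ k) f s + (deriv ^^ k) g s)"
  using assms
proof (induction k arbitrary: f g)
  case (Suc k)
  have "deriv (\<lambda>s. a * f s + g s) = (\<lambda>s. a * deriv f s + deriv g s)"
    using Suc.prems by (intro ext DERIV_imp_deriv DERIV_add DERIV_cmult smooth_DERIV)
  then show ?case
    using Suc.IH[OF Suc.prems[THEN smooth_deriv]] by (simp only: funpow_Suc_right o_apply)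
qed simp

section \<open>Iterated Hardy inequality\<close>

lemma test_pos_integrable:
  assumes "test_pos w"
  shows "integrable lborel w"
proof -
  obtain a b where ab: "0 < a" "a < b" "\<forall>x. x \<notin> {a<..<b} \<longrightarrow> w x = 0" "smooth w"
    by (rule test_posE[OF assms])
  have "set_integrable lborel {a..b} w"
    using smooth_continuous[OF ab(4)] by (intro borel_integrable_atLeastAtMost') auto
  moreover have "(\<lambda>x. indicator {a..b} x *\<^sub>R w x) = w"
  proof
    show "indicator {a..b} x *\<^sub>R w x = w x" for x
      using ab(3)[rule_format, of x] by (cases "x \<in> {a<..<b}") auto
  qed
  ultimately show ?thesis by (simp add: set_integrable_def)
qed

lemma test_pos_integral_deriv:
  assumes "test_pos w"
  shows "(LINT x|lborel. deriv w x) = 0"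
proof -
  obtain a b where ab: "0 < a" "a < b" "\<forall>x. x \<notin> {a<..<b} \<longrightarrow> w x = 0" "smooth w"
    by (rule test_posE[OF assms])
  have z: "deriv w x = 0" if "x \<notin> {a..b}" for x
    by (rule DERIV_imp_deriv, rule has_field_derivative_transform_within_open[where
          f = "\<lambda>_. 0" and S = "- {a..b}"]) (use that ab(3) in auto)
  have "(LBINT x. deriv w x * indicator {a..b} x) = w b - w a"
    by (rule integral_FTC_Icc_real)
      (use ab(2) smooth_DERIV[OF ab(4)] smooth_continuous[OF smooth_deriv[OF ab(4)], of UNIV] in
        \<open>auto simp: continuous_on_eq_continuous_at\<close>)
  moreover have "(\<lambda>x. deriv w x * indicator {a..b} x) = deriv w"
    using z by (auto simp: indicator_def fun_eq_iff)
  ultimately show ?thesis using ab by simp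
qed

lemma test_pos_mult_integrable:
  assumes "test_pos u" "test_pos w"
  shows "integrable lborel (\<lambda>x. u x * w x / x ^ m)"
  by (rule test_pos_integrable[OF test_pos_divide_power[OF test_pos_mult[OF test_pos_smooth[OF assms(1)] assms(2)]]])

lemma test_pos_eq_0:
  assumes "test_pos w" "x \<le> 0"
  shows "w x = 0"
proof -
  obtain a b where ab: "0 < a" "a < b" "\<forall>x. x \<notin> {a<..<b} \<longrightarrow> w x = 0" "smooth w"
    by (rule test_posE[OF assms(1)])
  show ?thesis using ab(1) assms(2) by (intro ab(3)[rule_format]) auto
qed

text \<open>The nonnegative square \<open>(\<alpha> * w x - x * deriv w x)^2 / x ^ (m + 2)\<close>
  is integrated; integration by parts turns its mixed term into a multiple of the left-hand
  integral.\<close>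

lemma hardy_step:
  assumes w: "test_pos w"
  shows "(LINT x|lborel. (w x)\<^sup>2 / x ^ (m + 2)) \<le>
    (2 / (real m + 1))\<^sup>2 * (LINT x|lborel. (deriv w x)\<^sup>2 / x ^ m)"
proof -
  \<comment> \<open>The square vanishes for \<open>x powr \<alpha>\<close>, the formal extremal, for
    which both integrals diverge only logarithmically.\<close>
  define \<alpha> where "\<alpha> = (real m + 1) / 2"
  have \<alpha>: "\<alpha> > 0" by (simp add: \<alpha>_def)
  note dw = test_pos_deriv[OF w]
  define I where "I = (LINT x|lborel. w x * w x / x ^ (m + 2))"
  define C where "C = (LINT x|lborel. w x * deriv w x / x ^ (m + 1))"
  define J where "J = (LINT x|lborel. deriv w x * deriv w x / x ^ m)"
  note int = test_pos_mult_integrable[OF w w, of "m + 2"] test_pos_mult_integrable[OF w dw, of "m + 1"]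
    test_pos_mult_integrable[OF dw dw, of m]
  define u where "u = (\<lambda>x. w x * w x / x ^ (m + 1))"
  have u: "test_pos u" unfolding u_def
    by (rule test_pos_divide_power[OF test_pos_mult[OF test_pos_smooth[OF w] w]])
  have du: "deriv u x = 2 * (w x * deriv w x / x ^ (m + 1)) - 2 * \<alpha> * (w x * w x / x ^ (m + 2))" for x
  proof (cases "x > 0")
    case True
    have "((\<lambda>x. w x * w x) has_real_derivative 2 * (w x * deriv w x)) (at x)"
      by (auto intro!: derivative_eq_intros smooth_DERIV[OF test_pos_smooth[OF w]])
    then have "(u has_real_derivative (2 * (w x * deriv w x) * x ^ (m + 1)
        - w x * w x * (real (m + 1) * x ^ m)) / (x ^ (m + 1) * x ^ (m + 1))) (at x)"
      unfolding u_def using DERIV_divide[OF _ DERIV_pow[of "m + 1" x]] True by simp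
    then have "deriv u x = (2 * (w x * deriv w x) * x ^ (m + 1)
        - w x * w x * (real (m + 1) * x ^ m)) / (x ^ (m + 1) * x ^ (m + 1))"
      by (rule DERIV_imp_deriv)
    also have "\<dots> = 2 * (w x * deriv w x / x ^ (m + 1)) - 2 * \<alpha> * (w x * w x / x ^ (m + 2))"
      unfolding diff_divide_distrib
      by (rule arg_cong2[where f = minus]) (use True in \<open>simp_all add: \<alpha>_def divide_simps\<close>)
    finally show ?thesis .
  next
    case False
    then show ?thesis using test_pos_eq_0[OF w] test_pos_eq_0[OF test_pos_deriv[OF u]] by simp
  qed
  \<comment> \<open>The derivative of \<open>u\<close> integrates to 0, that is,
    \<open>C = \<alpha> * I\<close>.\<close>
  have "0 = 2 * C - 2 * \<alpha> * I"
    using test_pos_integral_deriv[OF u] unfolding du C_def I_def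
    by (simp only: Bochner_Integration.integral_diff integrable_mult_right integral_mult_right_zero int)
  moreover have "0 \<le> \<alpha>\<^sup>2 * I - 2 * \<alpha> * C + J"
  proof -
    have "0 \<le> (LINT x|lborel. \<alpha>\<^sup>2 * (w x * w x / x ^ (m + 2)) - 2 * \<alpha> * (w x * deriv w x / x ^ (m + 1))
      + deriv w x * deriv w x / x ^ m)"
    proof (rule Bochner_Integration.integral_nonneg)
      fix x :: real
      show "0 \<le> \<alpha>\<^sup>2 * (w x * w x / x ^ (m + 2)) - 2 * \<alpha> * (w x * deriv w x / x ^ (m + 1))
        + deriv w x * deriv w x / x ^ m"
      proof (cases "x > 0")
        case True
        then have "\<alpha>\<^sup>2 * (w x * w x / x ^ (m + 2)) - 2 * \<alpha> * (w x * deriv w x / x ^ (m + 1))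
          + deriv w x * deriv w x / x ^ m = (\<alpha> * w x - x * deriv w x)\<^sup>2 / x ^ (m + 2)"
          by (simp add: field_simps power2_eq_square)
        then show ?thesis using True by simp
      next
        case False
        then show ?thesis using test_pos_eq_0[OF w] test_pos_eq_0[OF dw] by simp
      qed
    qed
    also have "\<dots> = \<alpha>\<^sup>2 * I - 2 * \<alpha> * C + J"
      unfolding I_def C_def J_def
      by (simp only: Bochner_Integration.integral_diff Bochner_Integration.integral_add
          Bochner_Integration.integrable_diff integrable_mult_right integral_mult_right_zero int)
    finally show ?thesis .
  qed
  ultimately have "\<alpha>\<^sup>2 * I \<le> J" by (simp add: power2_eq_square mult_ac)
  then have "I \<le> (1 / \<alpha>)\<^sup>2 * J" using \<alpha> by (simp add: field_simps power2_eq_square)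
  then show ?thesis by (simp add: I_def J_def \<alpha>_def power2_eq_square add.commute)
qed

text \<open>The step with the largest exponent is applied to \<open>w\<close>, the induction
  hypothesis to \<open>deriv w\<close>. The lower bound uses m = n - 1 and k = n, where the factors
  are 2 / (n + 2j).\<close>

lemma hardy_iterated:
  assumes "test_pos w"
  shows "(LINT x|lborel. (w x)\<^sup>2 / x ^ (m + 2 * k)) \<le>
    (\<Prod>j<k. 2 / (real (m + 2 * j) + 1))\<^sup>2 * (LINT x|lborel. ((deriv ^^ k) w x)\<^sup>2 / x ^ m)"
  using assms
proof (induction k arbitrary: w)
  case (Suc k)
  have "(LINT x|lborel. (w x)\<^sup>2 / x ^ (m + 2 * k + 2)) \<le>
    (2 / (real (m + 2 * k) + 1))\<^sup>2 * (LINT x|lborel. (deriv w x)\<^sup>2 / x ^ (m + 2 * k))"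
    by (rule hardy_step[OF Suc.prems])
  also have "\<dots> \<le> (2 / (real (m + 2 * k) + 1))\<^sup>2 * ((\<Prod>j<k. 2 / (real (m + 2 * j) + 1))\<^sup>2 *
      (LINT x|lborel. ((deriv ^^ k) (deriv w) x)\<^sup>2 / x ^ m))"
    by (intro mult_left_mono Suc.IH test_pos_deriv Suc.prems) auto
  finally show ?case
    by (simp add: power_mult_distrib[symmetric] funpow_swap1[symmetric] mult_ac add.assoc)
qed simp

section \<open>Density of iterated derivatives of test functions\<close>

text \<open>The mean is the only obstruction: an antiderivative is constant on each side of the
  support of \<open>u\<close>, and zero mean makes the two constants equal, so subtracting
  \<open>F a\<close> gives compact support.\<close>

lemma test_pos_antideriv:
  assumes u: "test_pos u" and int: "(LINT x|lborel. u x) = 0"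
  obtains W where "test_pos W" "deriv W = u"
proof -
  obtain a b where ab: "0 < a" "a < b" "\<forall>x. x \<notin> {a<..<b} \<longrightarrow> u x = 0" "smooth u"
    by (rule test_posE[OF u])
  have cont: "isCont u x" for x
    using smooth_continuous[OF ab(4), of UNIV] by (simp add: continuous_on_eq_continuous_at)
  obtain F where F: "(F has_real_derivative u x) (at x)" for x
    using einterval_antiderivative[of "-\<infinity>" "\<infinity>" u] cont
    by (auto simp: has_real_derivative_iff_has_vector_derivative)
  have const: "F x = F y" if "\<And>z. z \<in> S \<Longrightarrow> u z = 0" "convex S" "x \<in> S" "y \<in> S" for x y S
  proof -
    have "(F has_real_derivative 0) (at z within S)" if "z \<in> S" for z
      using F[of z] \<open>\<And>z. z \<in> S \<Longrightarrow> u z = 0\<close>[OF that] by (simp add: has_field_derivative_at_within)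
    from has_field_derivative_zero_constant[OF that(2) this] obtain c where "\<forall>x\<in>S. F x = c" by blast
    then show ?thesis using that(3,4) by simp
  qed
  have "(LINT x|lborel. u x * indicator {a..b} x) = F b - F a"
    by (rule integral_FTC_Icc_real) (use ab F cont in auto)
  moreover have "u x * indicator {a..b} x = u x" for x
    using ab(3)[rule_format, of x] by (cases "x \<in> {a<..<b}") auto
  ultimately have Fab: "F b = F a" using int by simp
  define W where "W x = F x + (- F a)" for x
  have W: "(W has_real_derivative u x) (at x)" for x
    unfolding W_def by (auto intro!: derivative_eq_intros F)
  have "W x = 0" if "x \<notin> {a<..<b}" for x
  proof (cases "x \<le> a")
    case True
    then show ?thesis using const[of "{..a}" x a] ab(3) by (simp add: W_def)
  next
    case False
    then show ?thesis using const[of "{b..}" x b] ab(3) Fab that by (simp add: W_def)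
  qed
  then have "test_pos W" unfolding test_pos_def using smooth_antideriv[OF W ab(4)] ab(1,2) by blast
  moreover have "deriv W = u" using W by (auto intro: DERIV_imp_deriv)
  ultimately show thesis using that by blast
qed

lemma deriv_funpow_scale:
  assumes "smooth f" "R \<noteq> 0"
  shows "(deriv ^^ k) (\<lambda>s. f (s / R)) = (\<lambda>s. (deriv ^^ k) f (s / R) / R ^ k)"
proof (induction k)
  case (Suc k)
  have "deriv (\<lambda>s. (deriv ^^ k) f (s / R) / R ^ k) s = (deriv ^^ Suc k) f (s / R) / R ^ Suc k" for s
  proof (rule DERIV_imp_deriv)
    have "((\<lambda>s. (deriv ^^ k) f (s / R)) has_real_derivative (deriv ^^ Suc k) f (s / R) * (1 / R)) (at s)"
      by (rule DERIV_chain2[OF smooth_DERIV[OF smooth_deriv_funpow[OF assms(1)], simplified], THEN DERIV_cong])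
        (use assms(2) in \<open>auto intro!: derivative_eq_intros\<close>)
    then show "((\<lambda>s. (deriv ^^ k) f (s / R) / R ^ k) has_real_derivative
      (deriv ^^ Suc k) f (s / R) / R ^ Suc k) (at s)"
      by (rule DERIV_cong[OF DERIV_cdivide]) simp
  qed
  then show ?case using Suc by simp
qed simp

lemma square_add_le: "(a + b)\<^sup>2 \<le> 2 * a\<^sup>2 + 2 * (b :: real)\<^sup>2"
  using zero_le_power2[of "a - b"] unfolding power2_sum power2_diff by linarith

text \<open>The rescaling keeps the integral fixed, while the square is of size 1 / R^2 on a support
  of length proportional to R, where the weight is at most 1 once the support lies beyond 1. The
  total is O(1 / R).\<close>

lemma test_pos_scale_small:
  assumes "test_pos w" "\<epsilon> > 0"
  shows "\<exists>R\<ge>1. (LINT s|lborel. (c / R * w (s / R))\<^sup>2 / s ^ p) < \<epsilon>"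
proof -
  obtain a b where ab: "0 < a" "a < b" "\<forall>x. x \<notin> {a<..<b} \<longrightarrow> w x = 0" "smooth w"
    by (rule test_posE[OF assms(1)])
  have "compact (w ` {a..b})"
    using smooth_continuous[OF ab(4)] by (intro compact_continuous_image) auto
  from compact_imp_bounded[OF this] obtain M where "\<forall>y\<in>w ` {a..b}. norm y \<le> M"
    unfolding bounded_iff by blast
  then have M: "\<bar>w x\<bar> \<le> M" if "x \<in> {a..b}" for x using that by simp
  have wM: "\<bar>w x\<bar> \<le> \<bar>M\<bar> * indicator {a..b} x" for x
    using M[of x] ab(3)[rule_format, of x] by (cases "x \<in> {a<..<b}") auto
  have wM': "\<bar>w x\<bar> \<le> \<bar>M\<bar>" for x
    using wM[of x] by (auto split: split_indicator_asm)
  define K where "K = c\<^sup>2 * M\<^sup>2 * (b - a)"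
  \<comment> \<open>The bound \<open>1 / a\<close> moves the support beyond 1;
    \<open>(K + 1) / \<epsilon>\<close> makes \<open>K / R\<close> strictly less than
    \<open>\<epsilon>\<close>.\<close>
  define R where "R = max 1 (max (1 / a) ((K + 1) / \<epsilon>))"
  have K: "K \<ge> 0" using ab by (simp add: K_def)
  have R: "R \<ge> 1" "R \<ge> 1 / a" "R \<ge> (K + 1) / \<epsilon>" by (auto simp: R_def)
  have "(c / R * w (s / R))\<^sup>2 / s ^ p \<le> (c / R)\<^sup>2 * M\<^sup>2 * indicator {a * R..b * R} s" for s
  proof (cases "s \<in> {a * R..b * R}")
    case True
    have "1 \<le> a * R" using R(2) ab(1) by (simp add: divide_le_eq mult.commute)
    then have "1 \<le> s ^ p" using True by (intro one_le_power) auto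
    then have "(c / R * w (s / R))\<^sup>2 / s ^ p \<le> (c / R * w (s / R))\<^sup>2"
      by (simp add: divide_le_eq mult_left_le_one_le mult_le_cancel_left1)
    also have "\<dots> \<le> (c / R)\<^sup>2 * M\<^sup>2"
      unfolding power_mult_distrib using wM'[of "s / R"]
      by (intro mult_left_mono) (auto simp: abs_le_square_iff[symmetric])
    finally show ?thesis using True by simp
  next
    case False
    then have "w (s / R) = 0" using wM[of "s / R"] R(1) by (auto simp: indicator_def field_simps split: if_splits)
    then show ?thesis using False by simp
  qed
  moreover have "test_pos (\<lambda>s. c / R * w (s / R))"
    using R(1) assms(1) by (intro test_pos_mult smooth_const test_pos_scale) auto
  from test_pos_mult_integrable[OF this this, of p]
  have "integrable lborel (\<lambda>s. (c / R * w (s / R))\<^sup>2 / s ^ p)" by (simp add: power2_eq_square)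
  moreover have "integrable lborel (\<lambda>s. (c / R)\<^sup>2 * M\<^sup>2 * indicator {a * R..b * R} s)"
    by (intro integrable_mult_right) (simp add: integrable_indicator_iff emeasure_lborel_Icc_eq)
  ultimately have "(LINT s|lborel. (c / R * w (s / R))\<^sup>2 / s ^ p) \<le>
      (LINT s|lborel. (c / R)\<^sup>2 * M\<^sup>2 * indicator {a * R..b * R} s)"
    by (intro integral_mono)
  also have "\<dots> = (c / R)\<^sup>2 * M\<^sup>2 * (b * R - a * R)"
    using R(1) ab by (subst integral_mult_right_zero) simp
  also have "\<dots> = K / R"
    using R(1) by (simp add: K_def field_simps power2_eq_square)
  also have "\<dots> < \<epsilon>"
    using R(1,3) K assms(2) by (simp add: divide_less_eq divide_le_eq mult.commute)
  finally show ?thesis using R(1) by blast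
qed

text \<open>To integrate an approximant \<open>w\<close> once more its mean must vanish. Subtracting
  a very wide bump with the same integral achieves this, and by \<open>test_pos_scale_small\<close>
  the k-th derivative of that bump is negligible in the weighted norm.\<close>

lemma test_pos_approx_deriv:
  assumes "test_pos q" "\<epsilon> > 0"
  shows "\<exists>w. test_pos w \<and> (LINT s|lborel. (q s - (deriv ^^ k) w s)\<^sup>2 / s ^ p) < \<epsilon>"
  using assms(2)
proof (induction k arbitrary: \<epsilon>)
  case 0
  then show ?case using assms(1) by (intro exI[of _ q]) auto
next
  case (Suc k)
  \<comment> \<open>\<open>square_add_le\<close> doubles both error terms, hence a quarter for
    each.\<close>
  have "\<epsilon> / 4 > 0" using Suc.prems by simp
  from Suc.IH[OF this] obtain w where w: "test_pos w"
    "(LINT s|lborel. (q s - (deriv ^^ k) w s)\<^sup>2 / s ^ p) < \<epsilon> / 4" by blast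
  define b where "b = bump 1 2"
  have b: "test_pos b" unfolding b_def by (intro test_pos_bump) auto
  have Ib: "(LINT s|lborel. b s) > 0"
  proof -
    have "(LINT s|lborel. b s) \<noteq> 0"
    proof
      assume "(LINT s|lborel. b s) = 0"
      then have "AE s in lborel. b s = 0"
        using integral_nonneg_eq_0_iff_AE[of lborel b] test_pos_integrable[OF b] bump_bounds(1)[of 1 2]
        by (auto simp: b_def)
      then have "AE s in lborel. s \<notin> {1<..<2::real}"
        by eventually_elim (use bump_pos[of 1 _ 2] in \<open>force simp: b_def\<close>)
      then have "{1<..<2::real} \<in> null_sets lborel"
        by (rule AE_iff_null_sets[THEN iffD2, rotated]) simp
      then show False by (auto simp: null_sets_def)
    qed
    moreover have "(LINT s|lborel. b s) \<ge> 0"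
      by (rule Bochner_Integration.integral_nonneg) (simp add: b_def bump_bounds)
    ultimately show ?thesis by simp
  qed
  \<comment> \<open>The integral of \<open>c / R * b (s / R)\<close> is \<open>c\<close> times that
    of \<open>b\<close> for every R, so this \<open>c\<close> reproduces the mean of
    \<open>w\<close> before R is chosen.\<close>
  define c where "c = (LINT s|lborel. w s) / (LINT s|lborel. b s)"
  from test_pos_scale_small[OF test_pos_deriv_funpow[OF b, of k] \<open>\<epsilon> / 4 > 0\<close>, of c p]
  obtain R where R: "R \<ge> 1" "(LINT s|lborel. (c / R * (deriv ^^ k) b (s / R))\<^sup>2 / s ^ p) < \<epsilon> / 4"
    by blast
  define e where "e s = c / R * b (s / R)" for s
  have e: "test_pos e" unfolding e_def using R(1) b
    by (intro test_pos_mult smooth_const test_pos_scale) auto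
  have Ie: "(LINT s|lborel. e s) = (LINT s|lborel. w s)"
  proof -
    have "(LINT s|lborel. b (s / R)) = R * (LINT s|lborel. b s)"
      using lborel_integral_real_affine[of "1 / R" b 0] R(1) by simp
    then show ?thesis using Ib R(1) by (simp add: e_def c_def)
  qed
  define u where "u s = - 1 * e s + w s" for s
  have u: "test_pos u" unfolding u_def by (intro test_pos_add test_pos_mult smooth_const e w)
  have "(LINT s|lborel. u s) = 0"
    using Ie test_pos_integrable[OF e] test_pos_integrable[OF w(1)] by (simp add: u_def)
  from test_pos_antideriv[OF u this] obtain W where W: "test_pos W" "deriv W = u" .
  have DW: "(deriv ^^ Suc k) W = (\<lambda>s. - 1 * (deriv ^^ k) e s + (deriv ^^ k) w s)"
  proof -
    have "u = (\<lambda>s. - 1 * e s + w s)" by (simp add: u_def fun_eq_iff)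
    then have "(deriv ^^ Suc k) W = (deriv ^^ k) (\<lambda>s. - 1 * e s + w s)"
      using W(2) by (simp only: funpow_Suc_right o_apply)
    also have "\<dots> = (\<lambda>s. - 1 * (deriv ^^ k) e s + (deriv ^^ k) w s)"
      by (rule deriv_funpow_linear[OF test_pos_smooth[OF e] test_pos_smooth[OF w(1)]])
    finally show ?thesis .
  qed
  have De: "(deriv ^^ k) e s = c / R ^ Suc k * (deriv ^^ k) b (s / R)" for s
  proof -
    have "(deriv ^^ k) (\<lambda>s. c / R * b (s / R) + 0) = (\<lambda>s. c / R * (deriv ^^ k) (\<lambda>s. b (s / R)) s + (deriv ^^ k) (\<lambda>_. 0) s)"
      by (rule deriv_funpow_linear) (use test_pos_smooth[OF test_pos_scale[OF b]] R(1) smooth_const in auto)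
    moreover have "(deriv ^^ k) (\<lambda>_::real. 0::real) = (\<lambda>_. 0)" by (induction k) auto
    ultimately show ?thesis
      unfolding e_def using R(1) by (simp add: deriv_funpow_scale[OF test_pos_smooth[OF b], of R])
  qed
  have le: "((deriv ^^ k) e s)\<^sup>2 / s ^ p \<le> (c / R * (deriv ^^ k) b (s / R))\<^sup>2 / s ^ p" if "s > 0" for s
  proof -
    have "\<bar>(deriv ^^ k) e s\<bar> \<le> \<bar>c / R * (deriv ^^ k) b (s / R)\<bar>"
    proof -
      have "\<bar>(deriv ^^ k) e s\<bar> = \<bar>c / R * (deriv ^^ k) b (s / R)\<bar> / R ^ k"
        using R(1) by (simp add: De abs_mult)
      also have "\<dots> \<le> \<bar>c / R * (deriv ^^ k) b (s / R)\<bar>"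
        using R(1) one_le_power[OF R(1), of k]
        by (simp add: divide_le_eq mult_le_cancel_left1)
      finally show ?thesis .
    qed
    then show ?thesis using that by (intro divide_right_mono) (simp_all only: abs_le_square_iff zero_le_power less_imp_le)
  qed
  note t = assms(1) w(1)[THEN test_pos_deriv_funpow, of k] e[THEN test_pos_deriv_funpow, of k]
    W(1)[THEN test_pos_deriv_funpow, of "Suc k"]
  have sq: "integrable lborel (\<lambda>s. (f s)\<^sup>2 / s ^ p)" if "test_pos f" for f
    using test_pos_mult_integrable[OF that that, of p] by (simp add: power2_eq_square)
  have d: "test_pos (\<lambda>s. f s - g s)" if "test_pos f" "test_pos g" for f g
    using test_pos_add[OF that(1) test_pos_mult[OF smooth_const[of "- 1"] that(2)]] by simp
  have "(LINT s|lborel. (q s - (deriv ^^ Suc k) W s)\<^sup>2 / s ^ p) \<le>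
    (LINT s|lborel. 2 * ((q s - (deriv ^^ k) w s)\<^sup>2 / s ^ p) + 2 * ((c / R * (deriv ^^ k) b (s / R))\<^sup>2 / s ^ p))"
  proof (rule integral_mono)
    show "integrable lborel (\<lambda>s. (q s - (deriv ^^ Suc k) W s)\<^sup>2 / s ^ p)"
      by (rule sq[OF d[OF t(1,4)]])
    have "test_pos (\<lambda>s. c / R * (deriv ^^ k) b (s / R))"
      using R(1) by (intro test_pos_mult smooth_const test_pos_scale test_pos_deriv_funpow b) auto
    from sq[OF d[OF t(1,2)]] sq[OF this]
    show "integrable lborel (\<lambda>s. 2 * ((q s - (deriv ^^ k) w s)\<^sup>2 / s ^ p)
      + 2 * ((c / R * (deriv ^^ k) b (s / R))\<^sup>2 / s ^ p))"
      by (intro Bochner_Integration.integrable_add integrable_mult_right)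
    show "(q s - (deriv ^^ Suc k) W s)\<^sup>2 / s ^ p \<le> 2 * ((q s - (deriv ^^ k) w s)\<^sup>2 / s ^ p)
      + 2 * ((c / R * (deriv ^^ k) b (s / R))\<^sup>2 / s ^ p)" for s
    proof (cases "s > 0")
      case True
      have "(q s - (deriv ^^ Suc k) W s)\<^sup>2 / s ^ p = ((q s - (deriv ^^ k) w s) + (deriv ^^ k) e s)\<^sup>2 / s ^ p"
        unfolding DW by (simp add: algebra_simps)
      also have "\<dots> \<le> (2 * (q s - (deriv ^^ k) w s)\<^sup>2 + 2 * ((deriv ^^ k) e s)\<^sup>2) / s ^ p"
        using True by (intro divide_right_mono square_add_le) auto
      also have "\<dots> = 2 * ((q s - (deriv ^^ k) w s)\<^sup>2 / s ^ p) + 2 * (((deriv ^^ k) e s)\<^sup>2 / s ^ p)"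
        by (simp add: add_divide_distrib)
      finally show ?thesis using le[OF True] by linarith
    next
      case False
      then have "s / R \<le> 0" using R(1) by (simp add: divide_le_0_iff)
      then show ?thesis
        using False t[THEN test_pos_eq_0] test_pos_eq_0[OF test_pos_deriv_funpow[OF b]] by simp
    qed
  qed
  also have "\<dots> = 2 * (LINT s|lborel. (q s - (deriv ^^ k) w s)\<^sup>2 / s ^ p)
      + 2 * (LINT s|lborel. (c / R * (deriv ^^ k) b (s / R))\<^sup>2 / s ^ p)"
  proof -
    have "test_pos (\<lambda>s. c / R * (deriv ^^ k) b (s / R))"
      using R(1) by (intro test_pos_mult smooth_const test_pos_scale test_pos_deriv_funpow b) auto
    from sq[OF d[OF t(1,2)]] sq[OF this] show ?thesis
      by (simp only: Bochner_Integration.integral_add integrable_mult_right integral_mult_right_zero)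
  qed
  also have "\<dots> < \<epsilon>" using w(2) R(2) by linarith
  finally show ?case using W(1) by blast
qed

text \<open>Replaces the triangle inequality of the weighted L2 norm at the price of a factor 2.
  Vanishing for \<open>s \<le> 0\<close> keeps the integrands nonnegative, since
  \<open>s ^ p\<close> can be negative there.\<close>

lemma weighted_sq_diff_le:
  fixes u v w :: "real \<Rightarrow> real"
  assumes "\<And>s. s \<le> 0 \<Longrightarrow> u s = 0 \<and> v s = 0 \<and> w s = 0"
    and "integrable lborel (\<lambda>s. (u s - v s)\<^sup>2 / s ^ p)" "integrable lborel (\<lambda>s. (v s - w s)\<^sup>2 / s ^ p)"
    and [measurable]: "u \<in> borel_measurable borel" "w \<in> borel_measurable borel"
  shows "integrable lborel (\<lambda>s. (u s - w s)\<^sup>2 / s ^ p)"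
    and "(LINT s|lborel. (u s - w s)\<^sup>2 / s ^ p) \<le>
      2 * (LINT s|lborel. (u s - v s)\<^sup>2 / s ^ p) + 2 * (LINT s|lborel. (v s - w s)\<^sup>2 / s ^ p)"
proof -
  have le: "(u s - w s)\<^sup>2 / s ^ p \<le> 2 * ((u s - v s)\<^sup>2 / s ^ p) + 2 * ((v s - w s)\<^sup>2 / s ^ p)"
    and nn: "(u s - w s)\<^sup>2 / s ^ p \<ge> 0" for s
  proof -
    have "(u s - w s)\<^sup>2 / s ^ p \<le> (2 * (u s - v s)\<^sup>2 + 2 * (v s - w s)\<^sup>2) / s ^ p" if "s > 0"
      using that square_add_le[of "u s - v s" "v s - w s"] by (intro divide_right_mono) auto
    then show "(u s - w s)\<^sup>2 / s ^ p \<le> 2 * ((u s - v s)\<^sup>2 / s ^ p) + 2 * ((v s - w s)\<^sup>2 / s ^ p)"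
      using assms(1)[of s] by (cases "s > 0") (auto simp: add_divide_distrib)
    show "(u s - w s)\<^sup>2 / s ^ p \<ge> 0"
      using assms(1)[of s] by (cases "s > 0") auto
  qed
  have int: "integrable lborel (\<lambda>s. 2 * ((u s - v s)\<^sup>2 / s ^ p) + 2 * ((v s - w s)\<^sup>2 / s ^ p))"
    using assms(2,3) by (intro Bochner_Integration.integrable_add integrable_mult_right)
  show "integrable lborel (\<lambda>s. (u s - w s)\<^sup>2 / s ^ p)"
  proof (rule Bochner_Integration.integrable_bound[OF int], measurable, rule AE_I2)
    show "norm ((u s - w s)\<^sup>2 / s ^ p)
      \<le> norm (2 * ((u s - v s)\<^sup>2 / s ^ p) + 2 * ((v s - w s)\<^sup>2 / s ^ p))" for s
      using le[of s] nn[of s] unfolding real_norm_def by linarith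
  qed
  then have "(LINT s|lborel. (u s - w s)\<^sup>2 / s ^ p) \<le>
    (LINT s|lborel. 2 * ((u s - v s)\<^sup>2 / s ^ p) + 2 * ((v s - w s)\<^sup>2 / s ^ p))"
    by (rule integral_mono[OF _ int le])
  also have "\<dots> = 2 * (LINT s|lborel. (u s - v s)\<^sup>2 / s ^ p) + 2 * (LINT s|lborel. (v s - w s)\<^sup>2 / s ^ p)"
    using assms(2,3)
    by (simp only: Bochner_Integration.integral_add integrable_mult_right integral_mult_right_zero)
  finally show "(LINT s|lborel. (u s - w s)\<^sup>2 / s ^ p) \<le>
      2 * (LINT s|lborel. (u s - v s)\<^sup>2 / s ^ p) + 2 * (LINT s|lborel. (v s - w s)\<^sup>2 / s ^ p)" .
qed

lemma flat_mono: "x \<le> y \<Longrightarrow> flat 0 x \<le> flat 0 y"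
  by (auto simp: flat_def frac_le)

lemma bump_mono:
  assumes "a' \<le> a" "b \<le> b'"
  shows "bump a b x \<le> bump a' b' x"
  unfolding bump_def using assms by (intro mult_mono flat_mono) (auto simp: flat_def)

text \<open>Domination by a multiple of a bump is stronger than boundedness with compact support: it
  keeps the quotient by the bump bounded, so that smoothing this quotient and multiplying back
  yields a test function.\<close>

lemma approx_by_bump_bounded:
  fixes v :: "real \<Rightarrow> real"
  assumes [measurable]: "v \<in> borel_measurable borel" and v0: "\<And>s. s \<le> 0 \<Longrightarrow> v s = 0"
    and int: "integrable lborel (\<lambda>s. (v s)\<^sup>2 / s ^ p)" and "\<epsilon> > 0"
  obtains u a b M where "u \<in> borel_measurable borel" "0 < a" "a < b"
    "\<forall>s. \<bar>u s\<bar> \<le> M * bump a b s" "integrable lborel (\<lambda>s. (v s - u s)\<^sup>2 / s ^ p)"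
    "(LINT s|lborel. (v s - u s)\<^sup>2 / s ^ p) < \<epsilon>"
proof -
  define \<theta> where "\<theta> m = bump (1 / real (m + 2)) (real (m + 2))" for m :: nat
  have [measurable]: "\<theta> m \<in> borel_measurable borel" for m
    unfolding \<theta>_def by (rule smooth_measurable[OF smooth_bump])
  have \<theta>0: "\<theta> m s \<ge> 0" for m s by (simp add: \<theta>_def bump_bounds)
  \<comment> \<open>At every \<open>s > 0\<close> the truncation is eventually inactive, because
    \<open>m\<close> times the increasing bumps becomes arbitrarily large; dominated convergence
    then applies.\<close>
  define u where "u m s = (if \<bar>v s\<bar> \<le> real m * \<theta> m s then v s else 0)" for m s
  have [measurable]: "u m \<in> borel_measurable borel" for m
    unfolding u_def by measurable
  have nn: "(v s)\<^sup>2 / s ^ p \<ge> 0" for s using v0[of s] by (cases "s > 0") auto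
  have le: "norm ((v s - u m s)\<^sup>2 / s ^ p) \<le> (v s)\<^sup>2 / s ^ p" for m s
    using nn[of s] by (auto simp: u_def)
  have lim: "(\<lambda>m. (v s - u m s)\<^sup>2 / s ^ p) \<longlonglongrightarrow> 0" for s
  proof (cases "s > 0")
    case True
    obtain m0 :: nat where m0: "1 / s < real m0" "s < real m0"
      using reals_Archimedean2[of "max (1 / s) s"] by auto
    have pos: "\<theta> m0 s > 0" unfolding \<theta>_def
    proof (rule bump_pos)
      have "1 < real m0 * s" using m0(1) True by (simp add: divide_less_eq)
      then show "1 / real (m0 + 2) < s" using True by (simp add: divide_less_eq algebra_simps)
    qed (use m0 in auto)
    obtain m1 :: nat where m1: "\<bar>v s\<bar> / \<theta> m0 s < real m1"
      using reals_Archimedean2 by blast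
    have "\<forall>\<^sub>F m in sequentially. 0 = (v s - u m s)\<^sup>2 / s ^ p"
      using eventually_ge_at_top[of "max m0 m1"]
    proof eventually_elim
      case (elim m)
      have "\<bar>v s\<bar> \<le> real m1 * \<theta> m0 s" using m1 pos by (simp add: divide_less_eq)
      also have "\<dots> \<le> real m * \<theta> m s"
        unfolding \<theta>_def using elim
        by (intro mult_mono bump_mono bump_bounds) (auto simp: frac_le)
      finally show ?case by (simp add: u_def)
    qed
    then show ?thesis by (rule Lim_transform_eventually[OF tendsto_const])
  next
    case False
    then have "v s = 0" "u m s = 0" for m using v0[of s] by (auto simp: u_def)
    then show ?thesis by simp
  qed
  have "(\<lambda>m. LINT s|lborel. (v s - u m s)\<^sup>2 / s ^ p) \<longlonglongrightarrow> (LINT s|(lborel :: real measure). (0::real))"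
    by (rule integral_dominated_convergence[where w = "\<lambda>s. (v s)\<^sup>2 / s ^ p"])
      (use lim le int in auto)
  then have "\<forall>\<^sub>F m in sequentially. (LINT s|lborel. (v s - u m s)\<^sup>2 / s ^ p) < \<epsilon>"
    using \<open>\<epsilon> > 0\<close> by (intro order_tendstoD) auto
  then obtain m where m: "(LINT s|lborel. (v s - u m s)\<^sup>2 / s ^ p) < \<epsilon>"
    by (auto simp: eventually_sequentially)
  have "integrable lborel (\<lambda>s. (v s - u m s)\<^sup>2 / s ^ p)"
    by (rule Bochner_Integration.integrable_bound[OF int], measurable)
      (intro AE_I2 order_trans[OF le], simp only: real_norm_def abs_ge_self)
  moreover have "\<bar>u m s\<bar> \<le> real m * bump (1 / real (m + 2)) (real (m + 2)) s" for s
    using \<theta>0[of m s] by (auto simp: u_def \<theta>_def)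
  moreover have "1 / real (m + 2) < real (m + 2)"
    by (rule le_less_trans[of _ 1]) auto
  ultimately show thesis using m by (intro that[of "u m" "1 / real (m + 2)" "real (m + 2)" "real m"]) simp_all
qed

text \<open>The quotient of \<open>u\<close> by the bump is bounded and measurable, hence an almost
  everywhere limit of continuous functions, which are replaced by polynomials on [a, b]. Multiplying
  by the bump restores smooth compact support.\<close>

lemma approx_bump_bounded_by_test_pos:
  fixes u :: "real \<Rightarrow> real"
  assumes [measurable]: "u \<in> borel_measurable borel" and ab: "0 < a" "a < b"
    and uM: "\<forall>s. \<bar>u s\<bar> \<le> M * bump a b s" and "\<epsilon> > 0"
  obtains q where "test_pos q" "integrable lborel (\<lambda>s. (u s - q s)\<^sup>2 / s ^ p)"
    "(LINT s|lborel. (u s - q s)\<^sup>2 / s ^ p) < \<epsilon>"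
proof -
  define \<theta> where "\<theta> = bump a b"
  have [measurable]: "\<theta> \<in> borel_measurable borel"
    unfolding \<theta>_def by (rule smooth_measurable[OF smooth_bump])
  have \<theta>: "0 \<le> \<theta> s" "\<theta> s \<le> 1" for s by (simp_all add: \<theta>_def bump_bounds)
  define r where "r s = u s / \<theta> s" for s
  have [measurable]: "r \<in> borel_measurable borel" unfolding r_def by measurable
  \<comment> \<open>Where the bump vanishes, \<open>u\<close> vanishes as well by its bound, so the
    convention for division by 0 is consistent.\<close>
  have r: "u s = r s * \<theta> s" for s using uM[rule_format, of s] by (auto simp: r_def \<theta>_def)
  have M: "M \<ge> 0"
    using uM[rule_format, of "(a + b) / 2"] bump_pos[of a "(a + b) / 2" b] ab
    by (smt (verit) field_sum_of_halves mult_neg_pos)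
  have rM: "\<bar>r s\<bar> \<le> M" for s
    using uM[rule_format, of s] \<theta>(1)[of s] M by (cases "\<theta> s = 0") (auto simp: r_def \<theta>_def abs_mult divide_le_eq)
  have "r measurable_on UNIV"
    by (rule lebesgue_measurable_imp_measurable_on_real) (auto intro: measurable_completion)
  then obtain N g where N: "negligible N" and g: "\<And>k. continuous_on UNIV (g k :: real \<Rightarrow> real)"
    and lim: "\<And>s. s \<notin> N \<Longrightarrow> (\<lambda>k. g k s) \<longlonglongrightarrow> r s"
    unfolding measurable_on_def by auto
  \<comment> \<open>Clamping to [-M, M] leaves the limit \<open>r\<close> unchanged and supplies the
    uniform bound needed for dominated convergence.\<close>
  have "\<exists>P. real_polynomial_function P \<and>
    (\<forall>s\<in>{a..b}. \<bar>max (- M) (min M (g k s)) - P s\<bar> < 1 / real (Suc k))" for k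
  proof -
    have "continuous_on {a..b} (\<lambda>s. max (- M) (min M (g k s)))"
      by (intro continuous_on_max continuous_on_min continuous_on_const continuous_on_subset[OF g subset_UNIV])
    moreover have "0 < 1 / real (Suc k)" by simp
    ultimately obtain P where "real_polynomial_function P"
      "\<And>s. s \<in> {a..b} \<Longrightarrow> \<bar>max (- M) (min M (g k s)) - P s\<bar> < 1 / real (Suc k)"
      using Stone_Weierstrass_real_polynomial_function[OF compact_Icc] by metis
    then show ?thesis by blast
  qed
  then obtain P where P: "\<And>k. real_polynomial_function (P k)"
    and PM: "\<And>k s. s \<in> {a..b} \<Longrightarrow> \<bar>max (- M) (min M (g k s)) - P k s\<bar> < 1 / real (Suc k)"
    by metis
  define q where "q k s = P k s * \<theta> s" for k s
  have q: "test_pos (q k)" for k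
    unfolding q_def \<theta>_def
    by (intro test_pos_mult test_pos_bump ab smooth_real_polynomial_function P)
  have [measurable]: "q k \<in> borel_measurable borel" for k
    by (rule smooth_measurable[OF test_pos_smooth[OF q]])
  have qz: "u s - q k s = 0" if "s \<notin> {a..b}" for s k
    using that bump_eq_0[of s a b] by (auto simp: r q_def \<theta>_def)
  define B where "B = (2 * M + 1)\<^sup>2 / a ^ p"
  have le: "norm ((u s - q k s)\<^sup>2 / s ^ p) \<le> B * indicator {a..b} s" for k s
  proof (cases "s \<in> {a..b}")
    case True
    have "1 / real (Suc k) \<le> 1" by simp
    then have "\<bar>P k s\<bar> \<le> M + 1" using PM[OF True, of k] M by linarith
    then have "\<bar>r s - P k s\<bar> \<le> 2 * M + 1" using rM[of s] by linarith
    then have "\<bar>(r s - P k s) * \<theta> s\<bar> \<le> (2 * M + 1) * 1"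
      unfolding abs_mult using \<theta>[of s] M by (intro mult_mono) auto
    then have "(u s - q k s)\<^sup>2 \<le> (2 * M + 1)\<^sup>2"
      using M abs_le_square_iff[of "(r s - P k s) * \<theta> s" "2 * M + 1"] by (simp add: r q_def algebra_simps)
    moreover have "a ^ p \<le> s ^ p" using True ab by (intro power_mono) auto
    ultimately have "(u s - q k s)\<^sup>2 / s ^ p \<le> B"
      unfolding B_def using ab by (intro frac_le) auto
    then show ?thesis using True ab by simp
  qed (use qz in auto)
  have B: "integrable lborel (\<lambda>s. B * indicator {a..b} s)"
    by (intro integrable_mult_right) (simp add: integrable_indicator_iff emeasure_lborel_Icc_eq)
  have "AE s in completion lborel. s \<notin> N"
    using N AE_not_in negligible_iff_null_sets by blast
  then have "AE s in lborel. s \<notin> N" by (simp only: AE_completion_iff)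
  then have lim0: "AE s in lborel. (\<lambda>k. (u s - q k s)\<^sup>2 / s ^ p) \<longlonglongrightarrow> 0"
  proof eventually_elim
    case (elim s)
    show ?case
    proof (cases "s \<in> {a..b}")
      case True
      have "(\<lambda>k. max (- M) (min M (g k s))) \<longlonglongrightarrow> max (- M) (min M (r s))"
        by (intro tendsto_intros lim elim)
      moreover have "max (- M) (min M (r s)) = r s" using rM[of s] by auto
      moreover have "(\<lambda>k. max (- M) (min M (g k s)) - P k s) \<longlonglongrightarrow> 0"
        by (rule Lim_null_comparison[OF _ lim_1_over_n[THEN LIMSEQ_Suc]])
          (use PM[OF True] in \<open>auto intro!: always_eventually less_imp_le\<close>)
      ultimately have "(\<lambda>k. max (- M) (min M (g k s)) - (max (- M) (min M (g k s)) - P k s)) \<longlonglongrightarrow> r s - 0"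
        by (intro tendsto_diff) auto
      then have "(\<lambda>k. P k s) \<longlonglongrightarrow> r s" by simp
      then have "(\<lambda>k. (u s - q k s)\<^sup>2 / s ^ p) \<longlonglongrightarrow> (u s - r s * \<theta> s)\<^sup>2 / s ^ p"
        unfolding q_def using True ab by (intro tendsto_intros) auto
      then show ?thesis by (simp add: r)
    qed (use qz in simp)
  qed
  have "(\<lambda>k. LINT s|lborel. (u s - q k s)\<^sup>2 / s ^ p) \<longlonglongrightarrow> (LINT s|(lborel :: real measure). (0::real))"
    by (rule integral_dominated_convergence[where w = "\<lambda>s. B * indicator {a..b} s"])
      (use lim0 le B in auto)
  then have "\<forall>\<^sub>F k in sequentially. (LINT s|lborel. (u s - q k s)\<^sup>2 / s ^ p) < \<epsilon>"
    using \<open>\<epsilon> > 0\<close> by (intro order_tendstoD) auto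
  then obtain k where "(LINT s|lborel. (u s - q k s)\<^sup>2 / s ^ p) < \<epsilon>"
    by (auto simp: eventually_sequentially)
  moreover have "integrable lborel (\<lambda>s. (u s - q k s)\<^sup>2 / s ^ p)"
    by (rule Bochner_Integration.integrable_bound[OF B], measurable)
      (intro AE_I2 order_trans[OF le], simp only: real_norm_def abs_ge_self)
  ultimately show thesis using q that by blast
qed

lemma derivs_test_pos_dense:
  fixes v :: "real \<Rightarrow> real"
  assumes v: "v \<in> borel_measurable borel" and v0: "\<And>s. s \<le> 0 \<Longrightarrow> v s = 0"
    and int: "integrable lborel (\<lambda>s. (v s)\<^sup>2 / s ^ p)" and \<epsilon>: "\<epsilon> > 0"
  obtains w where "test_pos w" "integrable lborel (\<lambda>s. (v s - (deriv ^^ k) w s)\<^sup>2 / s ^ p)"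
    "(LINT s|lborel. (v s - (deriv ^^ k) w s)\<^sup>2 / s ^ p) < \<epsilon>"
proof -
  \<comment> \<open>Two nested uses of \<open>weighted_sq_diff_le\<close> turn three errors of a
    sixteenth into at most 5/8 of \<open>\<epsilon>\<close>.\<close>
  have "\<epsilon> / 16 > 0" using \<epsilon> by simp
  obtain u a b M where u: "u \<in> borel_measurable borel" "0 < a" "a < b"
    "\<forall>s. \<bar>u s\<bar> \<le> M * bump a b s" "integrable lborel (\<lambda>s. (v s - u s)\<^sup>2 / s ^ p)"
    "(LINT s|lborel. (v s - u s)\<^sup>2 / s ^ p) < \<epsilon> / 16"
    by (rule approx_by_bump_bounded[OF v v0 int \<open>\<epsilon> / 16 > 0\<close>])
  have u0: "u s = 0" if "s \<le> 0" for s
    using u(4)[rule_format, of s] bump_eq_0[of s a b] that u(2) by simp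
  obtain q where q: "test_pos q" "integrable lborel (\<lambda>s. (u s - q s)\<^sup>2 / s ^ p)"
    "(LINT s|lborel. (u s - q s)\<^sup>2 / s ^ p) < \<epsilon> / 16"
    by (rule approx_bump_bounded_by_test_pos[OF u(1-4) \<open>\<epsilon> / 16 > 0\<close>])
  obtain w where w: "test_pos w" "(LINT s|lborel. (q s - (deriv ^^ k) w s)\<^sup>2 / s ^ p) < \<epsilon> / 16"
    using test_pos_approx_deriv[OF q(1) \<open>\<epsilon> / 16 > 0\<close>] by blast
  note dw = test_pos_deriv_funpow[OF w(1), of k]
  have d: "test_pos (\<lambda>s. q s - (deriv ^^ k) w s)"
    using test_pos_add[OF q(1) test_pos_mult[OF smooth_const[of "- 1"] dw]] by simp
  have qw: "integrable lborel (\<lambda>s. (q s - (deriv ^^ k) w s)\<^sup>2 / s ^ p)"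
    using test_pos_mult_integrable[OF d d, of p] by (simp add: power2_eq_square)
  note meas = smooth_measurable[OF test_pos_smooth[OF q(1)]] smooth_measurable[OF test_pos_smooth[OF dw]]
  have vq: "integrable lborel (\<lambda>s. (v s - q s)\<^sup>2 / s ^ p)"
    "(LINT s|lborel. (v s - q s)\<^sup>2 / s ^ p) \<le>
      2 * (LINT s|lborel. (v s - u s)\<^sup>2 / s ^ p) + 2 * (LINT s|lborel. (u s - q s)\<^sup>2 / s ^ p)"
    by (rule weighted_sq_diff_le[of v u q]; use v0 u0 test_pos_eq_0[OF q(1)] u(5) q(2) v meas in simp)+
  have vw: "integrable lborel (\<lambda>s. (v s - (deriv ^^ k) w s)\<^sup>2 / s ^ p)"
    "(LINT s|lborel. (v s - (deriv ^^ k) w s)\<^sup>2 / s ^ p) \<le>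
      2 * (LINT s|lborel. (v s - q s)\<^sup>2 / s ^ p) + 2 * (LINT s|lborel. (q s - (deriv ^^ k) w s)\<^sup>2 / s ^ p)"
    by (rule weighted_sq_diff_le[of v q "(deriv ^^ k) w"];
        use v0 test_pos_eq_0[OF q(1)] test_pos_eq_0[OF dw] vq(1) qw v meas in simp)+
  show thesis
    by (rule that[OF w(1) vw(1)]) (use vw(2) vq(2) u(6) q(3) w(2) \<epsilon> in linarith)
qed

section \<open>Radial integration\<close>

text \<open>The factor 1/2 makes the gradient equal to \<open>x\<close>: a derivative in coordinate
  j of a radial function multiplies by \<open>x $ j\<close> and differentiates the profile.\<close>

definition half_sq :: "real^'n::finite \<Rightarrow> real" where
  "half_sq x = (norm x)\<^sup>2 / 2"

text \<open>The case \<open>T = {}\<close> belongs to the norm of the state, \<open>set as\<close>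
  to the pairing with derivatives of test functions, and \<open>UNIV\<close> to the energy.\<close>

definition sq_mono :: "'n::finite set \<Rightarrow> real^'n \<Rightarrow> real" where
  "sq_mono T x = (\<Prod>i\<in>T. (x $ i)\<^sup>2)"

lemma half_sq_nonneg [simp]: "half_sq x \<ge> 0"
  by (simp add: half_sq_def)

lemma sq_mono_nonneg [simp]: "sq_mono T x \<ge> 0"
  by (simp add: sq_mono_def prod_nonneg)

lemma half_sq_eq_sum: "half_sq x = (\<Sum>i\<in>UNIV. (x $ i)\<^sup>2 / 2)"
  by (simp add: half_sq_def norm_vec_def L2_set_def sum_nonneg sum_divide_distrib)

lemma continuous_half_sq [continuous_intros]: "continuous_on A half_sq"
  unfolding half_sq_def[abs_def] by (intro continuous_intros) auto

lemma continuous_sq_mono [continuous_intros]: "continuous_on A (sq_mono T)"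
  unfolding sq_mono_def[abs_def] by (intro continuous_intros)

lemma half_sq_measurable [measurable]: "half_sq \<in> borel_measurable borel"
  by (intro borel_measurable_continuous_onI continuous_half_sq)

lemma sq_mono_measurable [measurable]: "sq_mono T \<in> borel_measurable borel"
  by (intro borel_measurable_continuous_onI continuous_sq_mono)

lemma half_sq_scaleR: "half_sq (c *\<^sub>R x) = c\<^sup>2 * half_sq x"
  by (simp add: half_sq_def power_mult_distrib)

lemma sq_mono_scaleR: "sq_mono T (c *\<^sub>R x) = c ^ (2 * card T) * sq_mono T x"
  by (simp add: sq_mono_def power_mult_distrib prod.distrib prod_constant power_mult)

text \<open>The two values agree because the standard normal law has variance 1; therefore the
  Gaussian integral of \<open>sq_mono T\<close> does not depend on \<open>T\<close>.\<close>

lemma nn_integral_gauss: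
  "(\<integral>\<^sup>+x. ennreal (exp (- (x\<^sup>2 / 2))) \<partial>lborel) = ennreal (sqrt (2 * pi))"
  "(\<integral>\<^sup>+x. ennreal (x\<^sup>2 * exp (- (x\<^sup>2 / 2))) \<partial>lborel) = ennreal (sqrt (2 * pi))"
proof -
  have "has_bochner_integral lborel (\<lambda>x. exp (- (x\<^sup>2 / 2))) (sqrt (2 * pi))"
    using has_bochner_integral_mult_right[OF std_normal_moment_even[of 0], of "sqrt (2 * pi)"]
    by (simp add: std_normal_density_def)
  then show "(\<integral>\<^sup>+x. ennreal (exp (- (x\<^sup>2 / 2))) \<partial>lborel) = ennreal (sqrt (2 * pi))"
    by (auto simp: has_bochner_integral_iff nn_integral_eq_integral)
  have "has_bochner_integral lborel (\<lambda>x. x\<^sup>2 * exp (- (x\<^sup>2 / 2))) (sqrt (2 * pi))"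
    using has_bochner_integral_mult_right[OF std_normal_moment_even[of 1], of "sqrt (2 * pi)"]
    by (simp add: std_normal_density_def mult_ac)
  then show "(\<integral>\<^sup>+x. ennreal (x\<^sup>2 * exp (- (x\<^sup>2 / 2))) \<partial>lborel) = ennreal (sqrt (2 * pi))"
    by (auto simp: has_bochner_integral_iff nn_integral_eq_integral)
qed

lemma nn_integral_sq_mono_gauss:
  fixes T :: "'n::finite set"
  shows "(\<integral>\<^sup>+x. ennreal (sq_mono T x * exp (- half_sq x)) \<partial>lborel)
    = ennreal (sqrt (2 * pi) ^ CARD('n))"
proof -
  define f :: "real^'n \<Rightarrow> real \<Rightarrow> real" where
    "f b y = (if \<exists>i\<in>T. b = axis i 1 then y\<^sup>2 else 1) * exp (- (y\<^sup>2 / 2))" for b y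
  have ax: "(\<exists>i\<in>T. axis k (1::real) = axis i 1) \<longleftrightarrow> k \<in> T" for k
    by (auto simp: axis_eq_axis)
  have Basis: "(Basis :: (real^'n) set) = range (\<lambda>i. axis i 1)" and inj: "inj (\<lambda>i. axis i (1::real) :: real^'n)"
    by (auto simp: Basis_vec_def inj_on_def axis_eq_axis)
  have "sq_mono T x * exp (- half_sq x) = (\<Prod>b\<in>Basis. f b (x \<bullet> b))" for x
  proof -
    have "(\<Prod>b\<in>Basis. f b (x \<bullet> b)) = (\<Prod>i\<in>UNIV. (if i \<in> T then (x $ i)\<^sup>2 else 1) * exp (- ((x $ i)\<^sup>2 / 2)))"
      unfolding Basis by (subst prod.reindex[OF inj]) (auto simp: f_def ax inner_axis intro!: prod.cong)
    also have "\<dots> = sq_mono T x * exp (- half_sq x)"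
      by (simp add: prod.distrib sq_mono_def half_sq_eq_sum prod.If_cases exp_sum[symmetric] sum_negf)
    finally show ?thesis by simp
  qed
  then have "(\<integral>\<^sup>+x. ennreal (sq_mono T x * exp (- half_sq x)) \<partial>lborel)
    = (\<integral>\<^sup>+x. (\<Prod>b\<in>Basis. ennreal (f b (x \<bullet> b))) \<partial>lborel)"
    by (intro nn_integral_cong) (simp add: prod_ennreal f_def)
  also have "\<dots> = (\<Prod>b\<in>Basis. (\<integral>\<^sup>+x. f b x \<partial>lborel))"
    by (rule nn_integral_lborel_prod) (auto simp: f_def[abs_def])
  also have "\<dots> = (\<Prod>b\<in>(Basis :: (real^'n) set). ennreal (sqrt (2 * pi)))"
  proof (intro prod.cong refl)
    show "(\<integral>\<^sup>+y. f b y \<partial>lborel) = ennreal (sqrt (2 * pi))" for b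
      by (cases "\<exists>i\<in>T. b = axis i 1") (simp_all add: f_def nn_integral_gauss)
  qed
  also have "\<dots> = ennreal (sqrt (2 * pi) ^ CARD('n))"
    by (simp add: ennreal_power)
  finally show ?thesis .
qed

lemma nn_integral_lborel_scaleR:
  fixes f :: "'a::euclidean_space \<Rightarrow> ennreal"
  assumes [measurable]: "f \<in> borel_measurable borel" and "c > 0"
  shows "(\<integral>\<^sup>+x. f x \<partial>lborel) = ennreal (c ^ DIM('a)) * (\<integral>\<^sup>+x. f (c *\<^sub>R x) \<partial>lborel)"
proof -
  have "lborel = density (distr lborel borel (\<lambda>x::'a. 0 + c *\<^sub>R x)) (\<lambda>_. \<bar>c\<bar>^DIM('a))"
    by (rule lborel_affine) (use \<open>c > 0\<close> in auto)
  then have "(\<integral>\<^sup>+x. f x \<partial>lborel) =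
    (\<integral>\<^sup>+x. f x \<partial>density (distr lborel borel (\<lambda>x::'a. 0 + c *\<^sub>R x)) (\<lambda>_. \<bar>c\<bar>^DIM('a)))"
    by simp
  also have "\<dots> = ennreal (c ^ DIM('a)) * (\<integral>\<^sup>+x. f (c *\<^sub>R x) \<partial>lborel)"
    using \<open>c > 0\<close> by (simp add: nn_integral_density nn_integral_distr nn_integral_cmult)
  finally show ?thesis .
qed

text \<open>The radial law of \<open>\<Prod>\<^sub>i\<^sub>\<in>\<^sub>T x\<^sub>i\<^sup>2 dx\<close> is a multiple of a power by homogeneity; integrating a
  Gaussian identifies the factor.\<close>

lemma distr_half_sq:
  fixes T :: "'n::finite set"
  assumes card: "CARD('n) = 2 * n" and n: "n > 0"
  defines "k \<equiv> n + card T - 1"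
  shows "distr (density lborel (\<lambda>x. ennreal (sq_mono T x))) borel half_sq =
    density lborel (\<lambda>s. ennreal ((2 * pi) ^ n / fact k * s ^ k) * indicator {0..} s)" (is "?M = _")
proof -
  have k: "n + card T = Suc k" using n by (simp add: k_def)
  define \<mu> where "\<mu> t = emeasure ?M {..t}" for t
  have \<mu>: "\<mu> t = (\<integral>\<^sup>+x. ennreal (sq_mono T x) * indicator {..t} (half_sq x) \<partial>lborel)" for t
  proof -
    have "half_sq -` {..t} \<in> sets (borel :: (real^'n) measure)"
      using measurable_sets[OF half_sq_measurable, of "{..t}"] by simp
    then show ?thesis unfolding \<mu>_def
      by (subst emeasure_distr) (auto simp: emeasure_density indicator_def intro!: nn_integral_cong)
  qed
  \<comment> \<open>Substituting \<open>sqrt t *\<^sub>R x\<close> yields t^n from the volume, as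
    the dimension is 2n, and t^(card T) from the weight.\<close>
  have scal: "\<mu> t = ennreal (t ^ Suc k) * \<mu> 1" if "t > 0" for t
  proof -
    have "\<mu> t = ennreal (sqrt t ^ DIM(real^'n)) *
      (\<integral>\<^sup>+x. ennreal (sq_mono T (sqrt t *\<^sub>R x)) * indicator {..t} (half_sq (sqrt t *\<^sub>R x :: real^'n)) \<partial>lborel)"
      unfolding \<mu> using that by (intro nn_integral_lborel_scaleR) auto
    also have "(\<integral>\<^sup>+x. ennreal (sq_mono T (sqrt t *\<^sub>R x)) * indicator {..t} (half_sq (sqrt t *\<^sub>R x :: real^'n)) \<partial>lborel)
      = (\<integral>\<^sup>+x. ennreal (t ^ card T) * (ennreal (sq_mono T x) * indicator {..1} (half_sq (x :: real^'n))) \<partial>lborel)"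
      using that by (intro nn_integral_cong)
        (auto simp: half_sq_scaleR sq_mono_scaleR power_mult ennreal_mult' indicator_def)
    also have "\<dots> = ennreal (t ^ card T) * \<mu> 1"
      unfolding \<mu> by (rule nn_integral_cmult) simp
    finally have "\<mu> t = ennreal (t ^ n) * (ennreal (t ^ card T) * \<mu> 1)"
      using that by (simp add: card power_mult)
    then show ?thesis using that by (simp add: k[symmetric] power_add ennreal_mult' mult.assoc)
  qed
  \<comment> \<open>For \<open>half_sq x \<le> 1\<close> the factor
    \<open>exp (1 - half_sq x)\<close> is at least 1, so the Gaussian integral bounds the
    mass.\<close>
  have fin: "\<mu> 1 < \<infinity>"
  proof -
    have "\<mu> 1 \<le> (\<integral>\<^sup>+x. ennreal (exp 1) * ennreal (sq_mono T x * exp (- half_sq x)) \<partial>lborel)"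
      unfolding \<mu>
    proof (intro nn_integral_mono)
      fix x :: "real^'n"
      have "sq_mono T x \<le> exp 1 * (sq_mono T x * exp (- half_sq x))" if "half_sq x \<le> 1"
        using that mult_left_mono[of 1 "exp (1 - half_sq x)" "sq_mono T x"]
        by (simp add: exp_diff exp_minus field_simps)
      then show "ennreal (sq_mono T x) * indicator {..1} (half_sq x)
        \<le> ennreal (exp 1) * ennreal (sq_mono T x * exp (- half_sq x))"
        by (auto simp: indicator_def ennreal_mult'[symmetric])
    qed
    also have "\<dots> < \<infinity>"
      by (subst nn_integral_cmult) (simp_all add: nn_integral_sq_mono_gauss ennreal_mult_less_top)
    finally show ?thesis .
  qed
  \<comment> \<open>Chosen so that the integral of \<open>c * s ^ k\<close> over [0, t] equals the
    value of \<open>\<mu> t\<close> given by \<open>scal\<close>.\<close>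
  define c where "c = real (Suc k) * enn2real (\<mu> 1)"
  have c: "c \<ge> 0" by (simp add: c_def)
  have \<mu>1: "\<mu> 1 = ennreal (c / real (Suc k))"
    using fin by (simp add: c_def)
  \<comment> \<open>Scaling covers only positive \<open>t\<close>. Otherwise \<open>\<mu> t\<close>
    is at most \<open>\<mu> u\<close> for every small \<open>u > 0\<close>, and the explicit
    \<open>u\<close> makes that at most \<open>e\<close>.\<close>
  have \<mu>0: "\<mu> t = 0" if "t \<le> 0" for t
  proof -
    have le: "\<mu> t \<le> ennreal e" if "e > 0" for e
    proof -
      define u where "u = min 1 (e * real (Suc k) / (c + 1))"
      have u: "u > 0" "u \<le> 1" "u \<le> e * real (Suc k) / (c + 1)"
        using that c by (auto simp: u_def)
      have "\<mu> t \<le> \<mu> u" unfolding \<mu>_def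
        using \<open>t \<le> 0\<close> u by (intro emeasure_mono) auto
      also have "\<dots> = ennreal (u ^ Suc k * (c / real (Suc k)))"
        using scal[OF u(1)] u c by (simp only: \<mu>1) (simp add: ennreal_mult'[symmetric])
      also have "u ^ Suc k * (c / real (Suc k)) \<le> e"
      proof -
        have "u ^ Suc k \<le> u" using u power_le_one[of u k] by (simp add: mult_left_le)
        then have "u ^ Suc k * c \<le> u * (c + 1)" using c u by (intro mult_mono) auto
        also have "\<dots> \<le> e * real (Suc k)" using u(3) c by (simp add: pos_le_divide_eq)
        finally show ?thesis by (simp add: divide_le_eq)
      qed
      finally show ?thesis by (simp add: ennreal_leI)
    qed
    have "\<mu> t \<le> 0" by (rule ennreal_le_epsilon) (simp add: le)
    then show ?thesis by simp
  qed
  define N where "N = density lborel (\<lambda>s. ennreal (c * s ^ k) * indicator {0..} s)"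
  have N: "emeasure N {..t} = \<mu> t" for t
  proof (cases "t > 0")
    case True
    have "emeasure N {..t} = (\<integral>\<^sup>+s. ennreal (c * s ^ k) * indicator {0..t} s \<partial>lborel)"
      by (auto simp: N_def emeasure_density indicator_def intro!: nn_integral_cong)
    also have "\<dots> = ennreal (c / real (Suc k) * t ^ Suc k - c / real (Suc k) * 0 ^ Suc k)"
      using True c by (intro nn_integral_FTC_Icc) (auto intro!: derivative_eq_intros simp del: power_Suc)
    also have "\<dots> = \<mu> t"
      using scal[OF True] True c by (simp add: \<mu>1 ennreal_mult'[symmetric] mult_ac)
    finally show ?thesis .
  next
    case False
    have "emeasure N {..t} = (\<integral>\<^sup>+s. ennreal (c * s ^ k) * indicator ({0..} \<inter> {..t}) s \<partial>lborel)"
      by (auto simp: N_def emeasure_density indicator_def intro!: nn_integral_cong)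
    also have "\<dots> = (\<integral>\<^sup>+(s::real). 0 \<partial>lborel)"
      by (rule nn_integral_cong_AE, rule AE_mp[OF AE_lborel_singleton[of 0]])
        (use False in \<open>auto simp: indicator_def\<close>)
    finally show ?thesis using \<mu>0 False by simp
  qed
  have MN: "?M = N"
  proof (rule measure_eqI_generator_eq[where \<Omega> = UNIV and E = "range atMost" and A = "\<lambda>i. {..real i}"])
    show "Int_stable (range (atMost :: real \<Rightarrow> _))" by (auto simp: Int_stable_def)
    show "emeasure ?M X = emeasure N X" if "X \<in> range atMost" for X
      using that N by (auto simp: \<mu>_def)
    show "sets ?M = sigma_sets UNIV (range atMost)"
      by (simp add: borel_eq_atMost)
    show "sets N = sigma_sets UNIV (range atMost)"
      by (simp add: N_def) (simp add: borel_eq_atMost)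
    show "(\<Union>i. {..real i}) = UNIV" using real_arch_simple by auto
    show "emeasure ?M {..real i} \<noteq> \<infinity>" for i
      using scal[of "real i"] \<mu>0[of "real i"] \<mu>1
      by (cases "i = 0") (auto simp: \<mu>_def[symmetric] ennreal_mult'[symmetric])
  qed auto
  have "ennreal ((2 * pi) ^ n) = (\<integral>\<^sup>+x. ennreal (sq_mono T x * exp (- half_sq x)) \<partial>lborel)"
    using real_sqrt_pow2[of "2 * pi"] by (simp add: nn_integral_sq_mono_gauss card power_mult)
  also have "\<dots> = (\<integral>\<^sup>+s. ennreal (exp (- s)) \<partial>?M)"
    by (simp add: nn_integral_distr nn_integral_density ennreal_mult')
  also have "\<dots> = (\<integral>\<^sup>+s. ennreal c * (ennreal (s ^ k * exp (- s)) * indicator {0..} s) \<partial>lborel)"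
    unfolding MN N_def using c
    by (auto simp: nn_integral_density ennreal_mult' indicator_def mult_ac intro!: nn_integral_cong)
  also have "\<dots> = ennreal (c * fact k)"
    using nn_intergal_power_times_exp_Ici[of k] c
    by (subst nn_integral_cmult) (auto simp: ennreal_mult' simp flip: ennreal_of_nat_eq_real_of_nat)
  finally have "(2 * pi) ^ n = c * fact k"
    using c by (simp add: ennreal_inj)
  then have "c = (2 * pi) ^ n / fact k" by simp
  then show ?thesis using MN by (simp add: N_def)
qed

section \<open>Partial derivatives of radial functions times monomials\<close>

lemma half_sq_add_axis: "half_sq (x + t *\<^sub>R axis j 1) = half_sq x + t * x $ j + t\<^sup>2 / 2"
  unfolding half_sq_def power2_norm_eq_inner
  by (simp add: inner_add_left inner_add_right inner_axis inner_axis' inner_commute power2_eq_square field_simps)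

lemma half_sq_DERIV_axis:
  "((\<lambda>t. half_sq (x + t *\<^sub>R axis j 1)) has_real_derivative x $ j) (at 0)"
  unfolding half_sq_add_axis by (auto intro!: derivative_eq_intros)

lemma compose_half_sq_DERIV_axis:
  assumes "(h has_real_derivative h') (at (half_sq x))"
  shows "((\<lambda>t. h (half_sq (x + t *\<^sub>R axis j 1))) has_real_derivative h' * x $ j) (at 0)"
  by (rule DERIV_chain2[where g = "\<lambda>t. half_sq (x + t *\<^sub>R axis j 1)", OF _ half_sq_DERIV_axis])
    (use assms in simp)

lemma partial_derivI:
  "((\<lambda>t. f (x + t *\<^sub>R axis j 1)) has_real_derivative D) (at 0) \<Longrightarrow> partial_deriv j f x = D"
  unfolding partial_deriv_def by (rule DERIV_imp_deriv)

lemma has_derivative_DERIV_axis: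
  fixes f :: "real^'n::finite \<Rightarrow> real"
  assumes "(f has_derivative f') (at x)"
  shows "((\<lambda>t. f (x + t *\<^sub>R axis j 1)) has_real_derivative f' (axis j 1)) (at 0)"
proof -
  have "((\<lambda>t. f (x + t *\<^sub>R axis j 1)) has_derivative (\<lambda>t. f' (t *\<^sub>R axis j 1))) (at 0)"
  proof -
    have "((\<lambda>t. x + t *\<^sub>R axis j 1) has_derivative (\<lambda>t. t *\<^sub>R axis j 1)) (at 0)"
      by (auto intro!: derivative_eq_intros)
    then show ?thesis
      using has_derivative_compose[of "\<lambda>t. x + t *\<^sub>R axis j 1" _ 0 UNIV f f'] assms by simp
  qed
  moreover have "f' (t *\<^sub>R axis j 1) = f' (axis j 1) * t" for t
    using linear_scale[OF has_derivative_linear[OF assms]] by simp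
  ultimately show ?thesis by (simp add: has_field_derivative_def)
qed

lemma partial_deriv_has_derivative:
  "(f has_derivative f') (at x) \<Longrightarrow> partial_deriv j f x = f' (axis j 1)"
  by (intro partial_derivI has_derivative_DERIV_axis)

text \<open>A class closed under partial derivatives. It serves to verify
  \<open>test_function\<close>, which demands differentiability of every iterated partial
  derivative.\<close>

inductive poly_radial :: "(real^'n::finite \<Rightarrow> real) \<Rightarrow> bool" where
  radial: "smooth h \<Longrightarrow> poly_radial (\<lambda>x. h (half_sq x))"
| coord: "poly_radial f \<Longrightarrow> poly_radial (\<lambda>x. x $ i * f x)"
| add: "poly_radial f \<Longrightarrow> poly_radial g \<Longrightarrow> poly_radial (\<lambda>x. f x + g x)"

lemma half_sq_has_derivative: "(half_sq has_derivative (\<lambda>v. x \<bullet> v)) (at x)"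
  unfolding half_sq_def power2_norm_eq_inner
  by (auto intro!: derivative_eq_intros simp: inner_commute)

lemma poly_radial_partial_deriv:
  fixes f :: "real^'n::finite \<Rightarrow> real"
  assumes "poly_radial f"
  shows "f differentiable (at x)" "poly_radial (partial_deriv j f)"
proof -
  have "(\<forall>x. f differentiable (at x)) \<and> (\<forall>j. poly_radial (partial_deriv j f))"
    using assms
  proof induction
    case (radial h)
    have d: "((\<lambda>x. h (half_sq x)) has_derivative (\<lambda>v. deriv h (half_sq x) * (x \<bullet> v))) (at x)" for x :: "real^'n"
      using has_derivative_compose[OF half_sq_has_derivative
          smooth_DERIV[OF radial, THEN has_field_derivative_imp_has_derivative]] .
    have "partial_deriv j (\<lambda>x. h (half_sq x)) = (\<lambda>x. x $ j * deriv h (half_sq x))" for j :: 'n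
      using partial_deriv_has_derivative[OF d] by (auto simp: inner_axis)
    then show ?case
      using d by (auto simp: differentiable_def intro!: poly_radial.coord poly_radial.radial smooth_deriv radial)
  next
    case (coord f i)
    have fd: "(f has_derivative frechet_derivative f (at x)) (at x)" for x
      using coord by (simp add: frechet_derivative_works)
    have c: "((\<lambda>x. x $ i) has_derivative (\<lambda>v. v $ i)) (at x)" for x :: "real^'n"
      by (intro bounded_linear_imp_has_derivative bounded_linear_vec_nth)
    have d: "((\<lambda>x. x $ i * f x) has_derivative
      (\<lambda>v. x $ i * frechet_derivative f (at x) v + v $ i * f x)) (at x)" for x
      by (rule has_derivative_mult[OF c fd])
    have "partial_deriv j (\<lambda>x. x $ i * f x) = (\<lambda>x. x $ i * partial_deriv j f x + (if i = j then f x else 0))"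
      for j
      using partial_deriv_has_derivative[OF d] partial_deriv_has_derivative[OF fd]
      by (auto simp: fun_eq_iff axis_def)
    then have "poly_radial (partial_deriv j (\<lambda>x. x $ i * f x))" for j
      using coord by (cases "i = j") (auto intro!: poly_radial.intros)
    then show ?case using d by (auto simp: differentiable_def)
  next
    case (add f g)
    have fd: "(f has_derivative frechet_derivative f (at x)) (at x)"
      "(g has_derivative frechet_derivative g (at x)) (at x)" for x
      using add by (simp_all add: frechet_derivative_works)
    have "partial_deriv j (\<lambda>x. f x + g x) = (\<lambda>x. partial_deriv j f x + partial_deriv j g x)" for j
      using partial_deriv_has_derivative[OF has_derivative_add[OF fd]]
        partial_deriv_has_derivative[OF fd(1)] partial_deriv_has_derivative[OF fd(2)] by auto
    then show ?case using add by (auto intro!: poly_radial.add)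
  qed
  then show "f differentiable (at x)" "poly_radial (partial_deriv j f)" by auto
qed

lemma partial_derivs_Nil [simp]: "partial_derivs [] f = f"
  and partial_derivs_Cons: "partial_derivs (j # js) f = partial_deriv j (partial_derivs js f)"
  by (simp_all add: partial_derivs_def)

lemma poly_radial_partial_derivs: "poly_radial f \<Longrightarrow> poly_radial (partial_derivs js f)"
  by (induction js) (auto simp: partial_derivs_Cons intro: poly_radial_partial_deriv)

lemma poly_radial_prod_list: "poly_radial f \<Longrightarrow> poly_radial (\<lambda>x. (\<Prod>j\<leftarrow>js. x $ j) * f x)"
  by (induction js) (auto simp: mult.assoc intro: poly_radial.coord)

lemma test_function_poly_radial:
  assumes "poly_radial f" "\<And>x. half_sq x > r \<Longrightarrow> f x = 0"
  shows "test_function f"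
  unfolding test_function_def
proof (intro conjI allI)
  show "partial_derivs js f differentiable_on UNIV" for js
    using poly_radial_partial_deriv(1)[OF poly_radial_partial_derivs[OF assms(1)]]
    by (auto simp: differentiable_on_def)
  have "bounded {x. f x \<noteq> 0}"
    unfolding bounded_iff
  proof (intro exI ballI)
    fix x assume "x \<in> {x. f x \<noteq> 0}"
    then have "half_sq x \<le> r" using assms(2) by force
    then have "(norm x)\<^sup>2 \<le> 2 * r" by (simp add: half_sq_def)
    then show "norm x \<le> sqrt (2 * r)" by (rule real_le_rsqrt)
  qed
  then show "compact (closure {x. f x \<noteq> 0})" by (simp add: compact_closure)
qed

text \<open>The product of the operators 1 + x_j^2 d/ds over the list, applied to \<open>h\<close>.
  This is what remains of (prod x_j) h(s) after one derivative in each listed coordinate, since d_j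
  (x_j k(s)) = k(s) + x_j^2 k'(s).\<close>

primrec expand :: "'n::finite list \<Rightarrow> (real \<Rightarrow> real) \<Rightarrow> real^'n \<Rightarrow> real" where
  "expand [] h x = h (half_sq x)"
| "expand (j # js) h x = expand js h x + (x $ j)\<^sup>2 * expand js (deriv h) x"

lemma expand_DERIV_axis:
  assumes "smooth h" "j \<notin> set js"
  shows "((\<lambda>t. expand js h (x + t *\<^sub>R axis j 1)) has_real_derivative x $ j * expand js (deriv h) x) (at 0)"
  using assms
proof (induction js arbitrary: h)
  case Nil
  show ?case
    using compose_half_sq_DERIV_axis[OF smooth_DERIV[OF Nil(1)]] by (simp add: mult.commute)
next
  case (Cons i js)
  have "j \<noteq> i" using Cons.prems by auto
  then have "axis j (1::real) $ i = 0" by (simp add: axis_def)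
  moreover have "((\<lambda>t. expand js h (x + t *\<^sub>R axis j 1)
      + (x $ i)\<^sup>2 * expand js (deriv h) (x + t *\<^sub>R axis j 1)) has_real_derivative
    x $ j * expand js (deriv h) x + (x $ i)\<^sup>2 * (x $ j * expand js (deriv (deriv h)) x)) (at 0)"
    by (intro DERIV_add DERIV_cmult Cons.IH smooth_deriv) (use Cons.prems in auto)
  ultimately show ?case by (simp add: algebra_simps)
qed

text \<open>The factor \<open>R\<close> makes the induction work: while the inner derivatives act,
  \<open>R\<close> also absorbs the coordinate of the outermost one, along which they do not
  differentiate.\<close>

lemma partial_derivs_expand:
  assumes "smooth h" "distinct js" "\<And>j x t. j \<in> set js \<Longrightarrow> R (x + t *\<^sub>R axis j 1) = R x"
  shows "partial_derivs js (\<lambda>x. R x * (\<Prod>j\<leftarrow>js. x $ j) * h (half_sq x)) = (\<lambda>x. R x * expand js h x)"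
  using assms
proof (induction js arbitrary: R)
  case (Cons j js)
  have IH: "partial_derivs js (\<lambda>x. (R x * x $ j) * (\<Prod>j\<leftarrow>js. x $ j) * h (half_sq x))
    = (\<lambda>x. (R x * x $ j) * expand js h x)"
    by (rule Cons.IH) (use Cons.prems in \<open>auto simp: axis_def\<close>)
  have "partial_deriv j (\<lambda>x. (R x * x $ j) * expand js h x) x
    = R x * (expand js h x + (x $ j)\<^sup>2 * expand js (deriv h) x)" for x
  proof (rule partial_derivI)
    have "((\<lambda>t. R x * ((x $ j + t) * expand js h (x + t *\<^sub>R axis j 1))) has_real_derivative
      R x * ((0 + 1) * expand js h (x + 0 *\<^sub>R axis j 1) + x $ j * expand js (deriv h) x * (x $ j + 0))) (at 0)"
      by (intro DERIV_cmult DERIV_mult DERIV_add DERIV_const DERIV_ident expand_DERIV_axis)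
        (use Cons.prems in auto)
    then show "((\<lambda>t. R (x + t *\<^sub>R axis j 1) * (x + t *\<^sub>R axis j 1) $ j * expand js h (x + t *\<^sub>R axis j 1))
      has_real_derivative R x * (expand js h x + (x $ j)\<^sup>2 * expand js (deriv h) x)) (at 0)"
      using Cons.prems by (simp add: mult_ac power2_eq_square)
  qed
  then show ?case using IH by (simp add: partial_derivs_Cons mult_ac)
qed simp

section \<open>Averaging partial derivatives over spheres\<close>

lemma radial_integral:
  fixes T :: "'n::finite set" and G :: "real \<Rightarrow> real"
  assumes card: "CARD('n) = 2 * n" and n: "n > 0" and [measurable]: "G \<in> borel_measurable borel"
    and k: "n + card T = Suc k"
  shows "integrable lborel (\<lambda>x. sq_mono T x * G (half_sq x)) \<longleftrightarrow>
      integrable lborel (\<lambda>s. indicator {0..} s * ((2 * pi) ^ n / fact k * s ^ k) * G s)" (is "?A \<longleftrightarrow> ?B")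
    and "(LINT x|lborel. sq_mono T x * G (half_sq x)) =
      (LINT s|lborel. indicator {0..} s * ((2 * pi) ^ n / fact k * s ^ k) * G s)" (is "?C = ?D")
proof -
  have "(\<lambda>s::real. ennreal ((2 * pi) ^ n / fact k * s ^ k) * indicator {0..} s)
    = (\<lambda>s. ennreal (indicator {0..} s * ((2 * pi) ^ n / fact k * s ^ k)))"
    by (auto simp: indicator_def)
  then have distr: "distr (density lborel (\<lambda>x. ennreal (sq_mono T x))) borel half_sq =
    density lborel (\<lambda>s. ennreal (indicator {0..} s * ((2 * pi) ^ n / fact k * s ^ k)))"
    using distr_half_sq[OF card n, of T] k by simp
  have "?A \<longleftrightarrow> integrable (density lborel (\<lambda>x. ennreal (sq_mono T x))) (\<lambda>x. G (half_sq x))"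
    by (subst integrable_density) auto
  also have "\<dots> \<longleftrightarrow> integrable (distr (density lborel (\<lambda>x. ennreal (sq_mono T x))) borel half_sq) G"
    by (subst integrable_distr_eq) auto
  also have "\<dots> \<longleftrightarrow> ?B"
    unfolding distr by (subst integrable_density) (auto simp: indicator_def)
  finally show "?A \<longleftrightarrow> ?B" .
  have "?C = integral\<^sup>L (density lborel (\<lambda>x. ennreal (sq_mono T x))) (\<lambda>x. G (half_sq x))"
    by (subst integral_density) auto
  also have "\<dots> = integral\<^sup>L (distr (density lborel (\<lambda>x. ennreal (sq_mono T x))) borel half_sq) G"
    by (subst integral_distr) auto
  also have "\<dots> = ?D"
    unfolding distr by (subst integral_density) (auto simp: indicator_def)
  finally show "?C = ?D" .
qed

text \<open>The one-dimensional counterpart of the recursion of \<open>expand\<close>: one term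
  loses a power of s, the other keeps it and differentiates \<open>h\<close>.\<close>

lemma deriv_funpow_power_mult:
  assumes h: "smooth h"
  shows "(deriv ^^ Suc k) (\<lambda>s. s ^ Suc m * h s) s =
    real (Suc m) * (deriv ^^ k) (\<lambda>s. s ^ m * h s) s + (deriv ^^ k) (\<lambda>s. s ^ Suc m * deriv h s) s"
proof -
  have "deriv (\<lambda>s. s ^ Suc m * h s) = (\<lambda>s. real (Suc m) * (s ^ m * h s) + s ^ Suc m * deriv h s)"
    by (rule ext, rule DERIV_imp_deriv, rule DERIV_cong[OF DERIV_mult[OF DERIV_pow smooth_DERIV[OF h]]])
      (simp add: algebra_simps)
  then have "(deriv ^^ Suc k) (\<lambda>s. s ^ Suc m * h s)
    = (deriv ^^ k) (\<lambda>s. real (Suc m) * (s ^ m * h s) + s ^ Suc m * deriv h s)"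
    by (simp only: funpow_Suc_right o_apply)
  also have "\<dots> = (\<lambda>s. real (Suc m) * (deriv ^^ k) (\<lambda>s. s ^ m * h s) s + (deriv ^^ k) (\<lambda>s. s ^ Suc m * deriv h s) s)"
    by (rule deriv_funpow_linear) (intro smooth_mult smooth_power smooth_deriv h)+
  finally show ?thesis by simp
qed

text \<open>Averaged against a radial function, \<open>expand\<close> becomes an ordinary derivative of order
  \<open>length js\<close>.\<close>

lemma integral_expand:
  fixes T :: "'n::finite set" and F :: "real \<Rightarrow> real"
  assumes card: "CARD('n) = 2 * n" and n: "n > 0" and [measurable]: "F \<in> borel_measurable borel"
    and F: "\<And>u. test_pos u \<Longrightarrow> integrable lborel (\<lambda>s. F s * u s)"
  assumes "test_pos h" "distinct js" "T \<inter> set js = {}" "n + card T + length js = Suc m"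
  shows "integrable lborel (\<lambda>x. F (half_sq x) * (sq_mono T x * expand js h x)) \<and>
    (LINT x|lborel. F (half_sq x) * (sq_mono T x * expand js h x)) =
    (2 * pi) ^ n / fact m * (LINT s|lborel. F s * (deriv ^^ length js) (\<lambda>s. s ^ m * h s) s)"
  using assms(5-)
proof (induction js arbitrary: T h m)
  case Nil
  have [measurable]: "h \<in> borel_measurable borel"
    using Nil by (intro smooth_measurable test_pos_smooth)
  have eq: "(\<lambda>s. indicator {0..} s * ((2 * pi) ^ n / fact m * s ^ m) * (F s * h s))
    = (\<lambda>s. (2 * pi) ^ n / fact m * (F s * (s ^ m * h s)))"
    using test_pos_eq_0[OF Nil(1)] by (force simp: indicator_def fun_eq_iff)
  have "test_pos (\<lambda>s. s ^ m * h s)"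
    by (rule test_pos_mult[OF smooth_power Nil(1)])
  then have "integrable lborel (\<lambda>s. (2 * pi) ^ n / fact m * (F s * (s ^ m * h s)))"
    by (intro integrable_mult_right F)
  moreover have "F (half_sq x) * (sq_mono T x * expand [] h x)
    = sq_mono T x * (F (half_sq x) * h (half_sq x))" for x
    by simp
  ultimately show ?case
    using radial_integral[OF card n, of "\<lambda>s. F s * h s" T m] Nil(4)
    by (simp only: eq integral_mult_right_zero) simp
next
  case (Cons j js)
  obtain m' where m: "m = Suc m'" using n Cons.prems by (cases m) auto
  have j: "j \<notin> T" "j \<notin> set js" using Cons.prems by auto
  have sq: "sq_mono (insert j T) x = (x $ j)\<^sup>2 * sq_mono T x" for x
    using j by (simp add: sq_mono_def)
  have h: "smooth h" "smooth (deriv h)" using Cons.prems by (auto intro: test_pos_smooth test_pos_deriv)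
  \<comment> \<open>The first summand of \<open>expand\<close> keeps the weight and lowers the
    exponent to m'; in the second, \<open>(x $ j)^2\<close> joins the weight, which keeps the
    exponent m.\<close>
  have IH1: "integrable lborel (\<lambda>x. F (half_sq x) * (sq_mono T x * expand js h x))"
    "(LINT x|lborel. F (half_sq x) * (sq_mono T x * expand js h x)) =
      (2 * pi) ^ n / fact m' * (LINT s|lborel. F s * (deriv ^^ length js) (\<lambda>s. s ^ m' * h s) s)"
    using Cons.IH[of h T m'] Cons.prems m by auto
  have IH2: "integrable lborel (\<lambda>x. F (half_sq x) * (sq_mono (insert j T) x * expand js (deriv h) x))"
    "(LINT x|lborel. F (half_sq x) * (sq_mono (insert j T) x * expand js (deriv h) x)) =
      (2 * pi) ^ n / fact m * (LINT s|lborel. F s * (deriv ^^ length js) (\<lambda>s. s ^ m * deriv h s) s)"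
    using Cons.IH[of "deriv h" "insert j T" m] Cons.prems j by (auto intro: test_pos_deriv)
  have split: "F (half_sq x) * (sq_mono T x * expand (j # js) h x) =
    F (half_sq x) * (sq_mono T x * expand js h x) + F (half_sq x) * (sq_mono (insert j T) x * expand js (deriv h) x)" for x
    by (simp add: sq algebra_simps)
  have int: "integrable lborel (\<lambda>s. F s * (deriv ^^ length js) (\<lambda>s. s ^ m' * h s) s)"
    "integrable lborel (\<lambda>s. F s * (deriv ^^ length js) (\<lambda>s. s ^ m * deriv h s) s)"
    by (intro F test_pos_deriv_funpow test_pos_mult smooth_power Cons.prems test_pos_deriv)+
  have "F s * (deriv ^^ length (j # js)) (\<lambda>s. s ^ m * h s) s =
    real m * (F s * (deriv ^^ length js) (\<lambda>s. s ^ m' * h s) s)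
      + F s * (deriv ^^ length js) (\<lambda>s. s ^ m * deriv h s) s" for s
    using deriv_funpow_power_mult[OF h(1), of "length js" m' s]
    by (simp add: m distrib_left mult.left_commute del: funpow.simps power_Suc)
  then have "(LINT s|lborel. F s * (deriv ^^ length (j # js)) (\<lambda>s. s ^ m * h s) s) =
    real m * (LINT s|lborel. F s * (deriv ^^ length js) (\<lambda>s. s ^ m' * h s) s)
      + (LINT s|lborel. F s * (deriv ^^ length js) (\<lambda>s. s ^ m * deriv h s) s)"
    using int by simp
  \<comment> \<open>The factor m from the product rule is exactly the ratio of the two radial
    constants.\<close>
  moreover have "(2 * pi) ^ n / fact m * real m = (2 * pi) ^ n / fact m'"
    by (simp add: m)
  ultimately have "(2 * pi) ^ n / fact m * (LINT s|lborel. F s * (deriv ^^ length (j # js)) (\<lambda>s. s ^ m * h s) s)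
    = (2 * pi) ^ n / fact m' * (LINT s|lborel. F s * (deriv ^^ length js) (\<lambda>s. s ^ m' * h s) s)
      + (2 * pi) ^ n / fact m * (LINT s|lborel. F s * (deriv ^^ length js) (\<lambda>s. s ^ m * deriv h s) s)"
    by (simp only: distrib_left mult.assoc[symmetric])
  then show ?case
    unfolding split using IH1 IH2 by (simp del: expand.simps funpow.simps)
qed

section \<open>Cauchy--Schwarz and reflection symmetry\<close>

lemma integrable_mult_of_squares:
  fixes f g :: "'a \<Rightarrow> real"
  assumes [measurable]: "f \<in> borel_measurable M" "g \<in> borel_measurable M"
    and "integrable M (\<lambda>x. (f x)\<^sup>2)" "integrable M (\<lambda>x. (g x)\<^sup>2)"
  shows "integrable M (\<lambda>x. f x * g x)"
proof (rule Bochner_Integration.integrable_bound, rule Bochner_Integration.integrable_add)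
  show "AE x in M. norm (f x * g x) \<le> norm ((f x)\<^sup>2 + (g x)\<^sup>2)"
  proof (rule AE_I2)
    fix x
    have "2 * (\<bar>f x\<bar> * \<bar>g x\<bar>) \<le> (f x)\<^sup>2 + (g x)\<^sup>2"
      using sum_squares_bound[of "\<bar>f x\<bar>" "\<bar>g x\<bar>"] by simp
    moreover have "\<bar>f x\<bar> * \<bar>g x\<bar> \<ge> 0" by simp
    ultimately show "norm (f x * g x) \<le> norm ((f x)\<^sup>2 + (g x)\<^sup>2)"
      unfolding real_norm_def abs_mult by linarith
  qed
qed (use assms in auto)

lemma Cauchy_Schwarz_lebesgue_integral:
  fixes f g :: "'a \<Rightarrow> real"
  assumes [measurable]: "f \<in> borel_measurable M" "g \<in> borel_measurable M"
    and f: "integrable M (\<lambda>x. (f x)\<^sup>2)" and g: "integrable M (\<lambda>x. (g x)\<^sup>2)"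
  shows "(LINT x|M. \<bar>f x * g x\<bar>)\<^sup>2 \<le> (LINT x|M. (f x)\<^sup>2) * (LINT x|M. (g x)\<^sup>2)"
proof -
  have fg: "integrable M (\<lambda>x. \<bar>f x * g x\<bar>)"
    by (intro integrable_abs integrable_mult_of_squares f g assms(1,2))
  have "(\<integral>\<^sup>+x. ennreal \<bar>f x\<bar> * ennreal \<bar>g x\<bar> \<partial>M)\<^sup>2
    \<le> (\<integral>\<^sup>+x. (ennreal \<bar>f x\<bar>)\<^sup>2 \<partial>M) * (\<integral>\<^sup>+x. (ennreal \<bar>g x\<bar>)\<^sup>2 \<partial>M)"
    by (rule Cauchy_Schwarz_nn_integral) auto
  also have "(\<integral>\<^sup>+x. ennreal \<bar>f x\<bar> * ennreal \<bar>g x\<bar> \<partial>M) = ennreal (LINT x|M. \<bar>f x * g x\<bar>)"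
    by (subst nn_integral_eq_integral[OF fg, symmetric]) (simp_all add: abs_mult ennreal_mult')
  also have "(\<integral>\<^sup>+x. (ennreal \<bar>f x\<bar>)\<^sup>2 \<partial>M) = ennreal (LINT x|M. (f x)\<^sup>2)"
    by (subst nn_integral_eq_integral[OF f, symmetric]) (simp_all add: ennreal_power)
  also have "(\<integral>\<^sup>+x. (ennreal \<bar>g x\<bar>)\<^sup>2 \<partial>M) = ennreal (LINT x|M. (g x)\<^sup>2)"
    by (subst nn_integral_eq_integral[OF g, symmetric]) (simp_all add: ennreal_power)
  finally show ?thesis
    by (simp add: ennreal_power ennreal_mult'[symmetric] ennreal_le_iff)
qed

lemma distr_lborel_flip:
  fixes i :: "'n::finite"
  shows "distr lborel borel (\<lambda>x::real^'n. \<chi> k. if k = i then - x $ k else x $ k) = lborel"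
proof -
  define c :: "real^'n \<Rightarrow> real" where "c b = (if b = axis i 1 then - 1 else 1)" for b
  define T :: "real^'n \<Rightarrow> real^'n" where "T x = 0 + (\<Sum>j\<in>Basis. (c j * (x \<bullet> j)) *\<^sub>R j)" for x
  have "T = (\<lambda>x. \<chi> k. if k = i then - x $ k else x $ k)"
  proof (rule ext, rule vec_eq_iff[THEN iffD2, rule_format])
    fix x k
    have "T x $ k = T x \<bullet> axis k 1" by (simp add: inner_axis)
    also have "\<dots> = c (axis k 1) * (x \<bullet> axis k 1)"
      unfolding T_def by (subst add_0, subst inner_sum_left_Basis) (auto simp: Basis_vec_def)
    finally show "T x $ k = (\<chi> k. if k = i then - x $ k else x $ k) $ k"
      by (auto simp: c_def inner_axis axis_eq_axis)
  qed
  moreover have "lborel = density (distr lborel borel T) (\<lambda>_. \<Prod>j\<in>Basis. \<bar>c j\<bar>)"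
    unfolding T_def by (rule lborel_affine_euclidean) (simp add: c_def)
  moreover have "(\<Prod>j\<in>(Basis :: (real^'n) set). \<bar>c j\<bar>) = 1"
    by (intro prod.neutral) (simp add: c_def)
  ultimately show ?thesis by (metis density_1 ennreal_1)
qed

text \<open>Reflecting a single coordinate preserves Lebesgue measure and \<open>half_sq\<close> but
  changes the sign of the full product, so the integral equals its own negative.\<close>

lemma integral_odd_radial:
  fixes G :: "real \<Rightarrow> real"
  assumes [measurable]: "G \<in> borel_measurable borel"
  shows "(LINT x|lborel. (\<Prod>k\<in>UNIV. x $ k) * G (half_sq (x :: real^'n::finite))) = 0"
proof -
  define i where "i = (undefined :: 'n)"
  define T :: "real^'n \<Rightarrow> real^'n" where "T x = (\<chi> k. if k = i then - x $ k else x $ k)" for x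
  define F :: "real^'n \<Rightarrow> real" where "F x = (\<Prod>k\<in>UNIV. x $ k) * G (half_sq x)" for x
  have "continuous_on UNIV T"
    unfolding T_def
  proof (rule continuous_on_vec_lambda)
    show "continuous_on UNIV (\<lambda>x::real^'n. if k = i then - x $ k else x $ k)" for k
      by (cases "k = i") (auto intro!: continuous_intros)
  qed
  then have [measurable]: "T \<in> borel_measurable borel" by (rule borel_measurable_continuous_onI)
  have "(\<lambda>x::real^'n. \<Prod>k\<in>UNIV. x $ k) \<in> borel_measurable borel"
    by (intro borel_measurable_continuous_onI continuous_intros)
  then have [measurable]: "F \<in> borel_measurable borel" unfolding F_def by measurable
  have "F (T x) = - F x" for x
  proof -
    have "half_sq (T x) = half_sq x"
      unfolding half_sq_eq_sum T_def by (intro sum.cong) auto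
    moreover have "(\<Prod>k\<in>UNIV. T x $ k) = - (\<Prod>k\<in>UNIV. x $ k)"
      by (subst (1 2) prod.remove[of UNIV i]) (auto simp: T_def intro!: prod.cong)
    ultimately show ?thesis by (simp add: F_def)
  qed
  moreover have "integral\<^sup>L lborel F = (LINT x|lborel. F (T x))"
  proof -
    have "distr lborel borel T = lborel" unfolding T_def by (rule distr_lborel_flip)
    then have "integral\<^sup>L lborel F = integral\<^sup>L (distr lborel borel T) F" by simp
    also have "\<dots> = (LINT x|lborel. F (T x))" by (rule integral_distr) measurable
    finally show ?thesis .
  qed
  ultimately have "integral\<^sup>L lborel F = 0" by simp
  then show ?thesis by (simp add: F_def[abs_def])
qed

text \<open>Here the listed coordinates enter only through the profile, so each derivative merely
  brings down a factor \<open>x $ j\<close>, in contrast to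
  \<open>partial_derivs_expand\<close>.\<close>

lemma partial_derivs_coord_radial:
  assumes "smooth h" "distinct js" "\<And>j x t. j \<in> set js \<Longrightarrow> R (x + t *\<^sub>R axis j 1) = R x"
  shows "partial_derivs js (\<lambda>x. R x * h (half_sq x)) =
    (\<lambda>x. R x * (\<Prod>j\<leftarrow>js. x $ j) * (deriv ^^ length js) h (half_sq x))"
  using assms
proof (induction js)
  case (Cons j js)
  have IH: "partial_derivs js (\<lambda>x. R x * h (half_sq x)) =
    (\<lambda>x. R x * (\<Prod>j\<leftarrow>js. x $ j) * (deriv ^^ length js) h (half_sq x))"
    using Cons by auto
  have inv: "(\<Prod>k\<leftarrow>js. (x + t *\<^sub>R axis j 1) $ k) = (\<Prod>k\<leftarrow>js. x $ k)" for x :: "real^'a" and t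
    using Cons.prems(2) by (intro arg_cong[where f = prod_list] map_cong) (auto simp: axis_def)
  have "partial_deriv j (\<lambda>x. R x * (\<Prod>j\<leftarrow>js. x $ j) * (deriv ^^ length js) h (half_sq x)) x
    = R x * (\<Prod>j\<leftarrow>js. x $ j) * ((deriv ^^ Suc (length js)) h (half_sq x) * x $ j)" for x
  proof (rule partial_derivI)
    have "((\<lambda>t. R x * (\<Prod>j\<leftarrow>js. x $ j) * (deriv ^^ length js) h (half_sq (x + t *\<^sub>R axis j 1)))
      has_real_derivative R x * (\<Prod>j\<leftarrow>js. x $ j) * ((deriv ^^ Suc (length js)) h (half_sq x) * x $ j)) (at 0)"
      using smooth_DERIV[OF smooth_deriv_funpow[OF Cons.prems(1)]]
      by (intro DERIV_cmult compose_half_sq_DERIV_axis) simp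
    then show "((\<lambda>t. R (x + t *\<^sub>R axis j 1) * (\<Prod>j'\<leftarrow>js. (x + t *\<^sub>R axis j 1) $ j')
      * (deriv ^^ length js) h (half_sq (x + t *\<^sub>R axis j 1))) has_real_derivative
      R x * (\<Prod>j\<leftarrow>js. x $ j) * ((deriv ^^ Suc (length js)) h (half_sq x) * x $ j)) (at 0)"
      using Cons.prems(3) by (simp only: inv) simp
  qed
  then show ?case unfolding partial_derivs_Cons IH by (simp add: mult_ac)
qed simp

section \<open>Weak derivatives tested against radial functions\<close>

lemma test_function_continuous:
  assumes "test_function \<phi>"
  shows "continuous_on A (partial_derivs js \<phi>)"
  using assms differentiable_imp_continuous_on continuous_on_subset
  unfolding test_function_def by blast

text \<open>The assumptions are symmetric in \<open>as\<close> and \<open>bs\<close>, so every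
  result transfers to the other operator by a second interpretation.\<close>

locale balanced_split =
  fixes as bs :: "'n::finite list" and n :: nat
  assumes card: "CARD('n) = 2 * n" and n_pos: "n > 0"
    and distinct: "distinct (as @ bs)" and length_as: "length as = n" and length_bs: "length bs = n"
begin

abbreviation radial_factor :: "nat \<Rightarrow> real" where
  "radial_factor k \<equiv> (2 * pi) ^ n / fact k"

lemma set_split: "set as \<union> set bs = UNIV" "set as \<inter> set bs = {}"
proof -
  have "card (set (as @ bs)) = CARD('n)"
    using distinct_card[OF distinct] card length_as length_bs by simp
  then show "set as \<union> set bs = UNIV" by (metis card_eq_UNIV_imp_eq_UNIV finite set_append)
  show "set as \<inter> set bs = {}" using distinct by auto
qed

lemma card_set_as: "card (set as) = n"
  using distinct length_as by (simp add: distinct_card)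

lemma prod_list_squared: "(\<Prod>j\<leftarrow>as. x $ j) * (\<Prod>j\<leftarrow>as. x $ j) = sq_mono (set as) x"
  using distinct by (simp add: prod.distinct_set_conv_list[symmetric] sq_mono_def power2_eq_square prod.distrib)

lemma prod_list_all: "(\<Prod>j\<leftarrow>as. x $ j) * (\<Prod>j\<leftarrow>bs. x $ j) = (\<Prod>j\<in>UNIV. x $ j)"
proof -
  have "(\<Prod>j\<in>UNIV. x $ j) = (\<Prod>j\<leftarrow>as @ bs. x $ j)"
    using prod.distinct_set_conv_list[OF distinct, of "\<lambda>j. x $ j"] set_split(1) by simp
  then show ?thesis by simp
qed

lemma sq_mono_UNIV: "((\<Prod>j\<leftarrow>as. x $ j) * (\<Prod>j\<leftarrow>bs. x $ j))\<^sup>2 = sq_mono UNIV x"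
  unfolding prod_list_all sq_mono_def by (simp add: prod_power_distrib)

lemma invariant_along_bs:
  assumes "j \<in> set bs" "k \<in> set as"
  shows "(x + t *\<^sub>R axis j 1 :: real^'n) $ k = x $ k"
  using set_split(2) assms by (auto simp: axis_def)

lemma weight_measurable [measurable]: "(\<lambda>x::real^'n. \<Prod>j\<leftarrow>js. x $ j) \<in> borel_measurable borel"
proof (induction js)
  case (Cons j js)
  have "(\<lambda>x::real^'n. x $ j) \<in> borel_measurable borel"
    by (intro borel_measurable_continuous_onI continuous_intros)
  then show ?case using Cons by simp
qed simp

text \<open>The profile is read off from the measurable \<open>\<psi>\<close> along a ray, because
  nothing is known about measurability of the given \<open>\<Psi>\<close>. Setting it to 0 for
  \<open>s \<le> 0\<close> affects only the origin.\<close>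

lemma radial_profile:
  assumes wave: "wave_function \<psi>" and sym: "real_spherically_symmetric (\<psi> :: real^'n \<Rightarrow> complex)"
  obtains f :: "real \<Rightarrow> real" where "f \<in> borel_measurable borel" "\<forall>s\<le>0. f s = 0"
    "AE x in lborel. \<psi> x = complex_of_real (f (half_sq x))"
    "integrable lborel (\<lambda>s. s ^ (n - 1) * (f s)\<^sup>2)"
    "radial_factor (n - 1) * (LINT s|lborel. s ^ (n - 1) * (f s)\<^sup>2) = 1"
proof -
  obtain \<Psi> where \<Psi>: "\<And>x. \<psi> x = complex_of_real (\<Psi> (norm x))"
    using sym by (auto simp: real_spherically_symmetric_def)
  have [measurable]: "\<psi> \<in> borel_measurable borel" and int: "integrable lborel (\<lambda>x. (cmod (\<psi> x))\<^sup>2)"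
    and one: "(LINT x|lborel. (cmod (\<psi> x))\<^sup>2) = 1"
    using wave by (auto simp: wave_function_def square_integrable_def)
  define e :: "real^'n" where "e = axis undefined 1"
  have e: "norm e = 1" by (simp add: e_def)
  define f where "f s = (if s > 0 then Re (\<psi> (sqrt (2 * s) *\<^sub>R e)) else 0)" for s
  have f[measurable]: "f \<in> borel_measurable borel"
    unfolding f_def by measurable
  have f0: "\<forall>s\<le>0. f s = 0" by (simp add: f_def)
  have "\<psi> x = complex_of_real (f (half_sq x))" if "x \<noteq> 0" for x
    using that by (simp add: f_def \<Psi> e half_sq_def)
  then have ae: "AE x in lborel. \<psi> x = complex_of_real (f (half_sq x))"
    using AE_lborel_singleton[of "0 :: real^'n"] by auto
  have ae2: "AE x in lborel. (cmod (\<psi> x))\<^sup>2 = sq_mono {} x * (f (half_sq x))\<^sup>2"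
    using ae by eventually_elim (simp add: sq_mono_def)
  have eq: "(\<lambda>s. indicator {0..} s * (radial_factor (n - 1) * s ^ (n - 1)) * (f s)\<^sup>2)
    = (\<lambda>s. radial_factor (n - 1) * (s ^ (n - 1) * (f s)\<^sup>2))"
    using f0 by (auto simp: indicator_def fun_eq_iff)
  have "n + card ({} :: 'n set) = Suc (n - 1)" using n_pos by simp
  note R = radial_integral[OF card n_pos _ this, of "\<lambda>s. (f s)\<^sup>2", unfolded eq]
  have "integrable lborel (\<lambda>x. sq_mono {} x * (f (half_sq (x :: real^'n)))\<^sup>2)"
    using integrable_cong_AE[OF _ _ ae2] int by simp
  then have "integrable lborel (\<lambda>s. radial_factor (n - 1) * (s ^ (n - 1) * (f s)\<^sup>2))"
    using R(1) by simp
  then have "integrable lborel (\<lambda>s. s ^ (n - 1) * (f s)\<^sup>2)"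
    by (simp only: integrable_mult_left_iff) simp
  moreover have "1 = (LINT x|lborel. sq_mono {} x * (f (half_sq (x :: real^'n)))\<^sup>2)"
    using integral_cong_AE[OF _ _ ae2] one by simp
  then have "radial_factor (n - 1) * (LINT s|lborel. s ^ (n - 1) * (f s)\<^sup>2) = 1"
    using R(2) by (simp only: integral_mult_right_zero borel_measurable_power f)
  ultimately show thesis using that f f0 ae by blast
qed

text \<open>Arithmetic-geometric mean inequality after distributing \<open>sqrt (s ^ p)\<close>: one
  factor is multiplied by it, the other divided by it.\<close>

lemma profile_mult_test_pos_integrable:
  fixes f :: "real \<Rightarrow> real"
  assumes [measurable]: "f \<in> borel_measurable borel" and f0: "\<forall>s\<le>0. f s = 0"
    and int: "integrable lborel (\<lambda>s. s ^ p * (f s)\<^sup>2)" and u: "test_pos u"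
  shows "integrable lborel (\<lambda>s. f s * u s)"
proof (rule Bochner_Integration.integrable_bound)
  have "integrable lborel (\<lambda>s. (u s)\<^sup>2 / s ^ p)"
    using test_pos_mult_integrable[OF u u, of p] by (simp add: power2_eq_square)
  with int show "integrable lborel (\<lambda>s. s ^ p * (f s)\<^sup>2 + (u s)\<^sup>2 / s ^ p)"
    by (rule Bochner_Integration.integrable_add)
  have [measurable]: "u \<in> borel_measurable borel"
    by (rule smooth_measurable[OF test_pos_smooth[OF u]])
  show "(\<lambda>s. f s * u s) \<in> borel_measurable lborel" by measurable
  show "AE s in lborel. norm (f s * u s) \<le> norm (s ^ p * (f s)\<^sup>2 + (u s)\<^sup>2 / s ^ p)"
  proof (rule AE_I2)
    fix s
    show "norm (f s * u s) \<le> norm (s ^ p * (f s)\<^sup>2 + (u s)\<^sup>2 / s ^ p)"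
    proof (cases "s > 0")
      case True
      define c where "c = sqrt (s ^ p)"
      have c: "c > 0" "c\<^sup>2 = s ^ p" using True by (simp_all add: c_def)
      have le: "2 * (\<bar>c * f s\<bar> * \<bar>u s / c\<bar>) \<le> (c * f s)\<^sup>2 + (u s / c)\<^sup>2"
        using sum_squares_bound[of "\<bar>c * f s\<bar>" "\<bar>u s / c\<bar>"] by (simp only: power2_abs mult.assoc)
      have l: "\<bar>c * f s\<bar> * \<bar>u s / c\<bar> = \<bar>f s * u s\<bar>"
        using c(1) by (simp add: abs_mult)
      have r: "(c * f s)\<^sup>2 + (u s / c)\<^sup>2 = s ^ p * (f s)\<^sup>2 + (u s)\<^sup>2 / s ^ p"
        by (simp add: power_mult_distrib power_divide c(2))
      have "2 * norm (f s * u s) \<le> norm (s ^ p * (f s)\<^sup>2 + (u s)\<^sup>2 / s ^ p)"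
        using le unfolding l r real_norm_def by (rule order_trans[OF _ abs_ge_self])
      then show ?thesis using norm_ge_zero[of "f s * u s"] by linarith
    qed (use f0 test_pos_eq_0[OF u] in simp)
  qed
qed

lemma test_function_weighted_radial:
  assumes h: "test_pos h"
  shows "test_function (\<lambda>x::real^'n. (\<Prod>j\<leftarrow>js. x $ j) * ((\<Prod>j\<leftarrow>ks. x $ j) * h (half_sq x)))"
proof -
  obtain a b where ab: "0 < a" "a < b" "\<forall>x. x \<notin> {a<..<b} \<longrightarrow> h x = 0" "smooth h"
    by (rule test_posE[OF h])
  show ?thesis
    by (rule test_function_poly_radial[where r = b])
      (use ab in \<open>auto intro!: poly_radial_prod_list poly_radial.radial\<close>)
qed

text \<open>One pairing is evaluated twice: moving the derivatives to the test function and
  averaging over spheres gives the integral of \<open>f\<close> against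
  \<open>(deriv ^^ n) w\<close>, while Cauchy--Schwarz bounds it by the norms of
  \<open>\<xi>\<close> and \<open>\<eta>\<close>.\<close>

lemma weak_pairing_bound:
  fixes f :: "real \<Rightarrow> real"
  assumes f[measurable]: "f \<in> borel_measurable borel" and f0: "\<forall>s\<le>0. f s = 0"
    and ae: "AE x in lborel. \<psi> x = complex_of_real (f (half_sq x))"
    and int: "integrable lborel (\<lambda>s. s ^ (n - 1) * (f s)\<^sup>2)"
    and \<psi>[measurable]: "\<psi> \<in> borel_measurable borel"
    and op: "has_op_value as bs \<psi> \<eta>" and w: "test_pos w"
  shows "radial_factor (3 * n - 1) * (LINT s|lborel. f s * (deriv ^^ n) w s)\<^sup>2
    \<le> (LINT s|lborel. (w s)\<^sup>2 / s ^ (3 * n - 1)) * (LINT x|lborel. (cmod (\<eta> x))\<^sup>2)"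
proof -
  define m where "m = 3 * n - 1"
  have m: "Suc m = 3 * n" using n_pos by (simp add: m_def)
  define C where "C = radial_factor m"
  have C: "C > 0" by (simp add: C_def)
  obtain g where weak: "has_weak_partial_derivs \<psi> g bs"
    and \<eta>: "\<eta> = (\<lambda>x. (- \<i>) ^ length bs * complex_of_real (\<Prod>j\<leftarrow>as. x $ j) * g x)"
    and sq: "square_integrable \<eta>"
    using op by (auto simp: has_op_value_def)
  have [measurable]: "\<eta> \<in> borel_measurable borel" and sq: "integrable lborel (\<lambda>x. (cmod (\<eta> x))\<^sup>2)"
    using sq by (auto simp: square_integrable_def)
  \<comment> \<open>\<open>integral_expand\<close> with \<open>T = set as\<close> differentiates
    \<open>s ^ m * h s\<close>, where m + 1 = n + n + n; this choice turns it into
    \<open>w\<close>.\<close>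
  define h where "h s = w s / s ^ m" for s
  have h: "test_pos h" unfolding h_def by (rule test_pos_divide_power[OF w])
  have [measurable]: "h \<in> borel_measurable borel" by (rule smooth_measurable[OF test_pos_smooth[OF h]])
  have hw: "s ^ m * h s = w s" for s
    using test_pos_eq_0[OF w, of s] by (cases "s = 0") (auto simp: h_def)
  \<comment> \<open>The test function \<open>\<phi>\<close> is \<open>\<xi>\<close> times the
    position factor; the latter is absorbed into \<open>\<eta>\<close>, and the square of
    \<open>\<xi>\<close> is \<open>sq_mono UNIV\<close> times a radial function.\<close>
  define \<xi> where "\<xi> x = (\<Prod>j\<leftarrow>as. x $ j) * (\<Prod>j\<leftarrow>bs. x $ j) * h (half_sq x)" for x :: "real^'n"
  define \<phi> where "\<phi> x = sq_mono (set as) x * (\<Prod>j\<leftarrow>bs. x $ j) * h (half_sq x)" for x :: "real^'n"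
  have [measurable]: "\<xi> \<in> borel_measurable borel" unfolding \<xi>_def by measurable
  have \<phi>\<xi>: "\<phi> x = (\<Prod>j\<leftarrow>as. x $ j) * \<xi> x" for x
    by (simp add: \<phi>_def \<xi>_def prod_list_squared[symmetric])
  have \<phi>: "test_function \<phi>"
    using test_function_weighted_radial[OF h, of "as @ as" bs]
    by (simp add: \<phi>_def[abs_def] prod_list_squared[symmetric] mult_ac)
  have D\<phi>: "partial_derivs bs \<phi> = (\<lambda>x. sq_mono (set as) x * expand bs h x)"
    unfolding \<phi>_def
  proof (rule partial_derivs_expand[OF test_pos_smooth[OF h]])
    show "sq_mono (set as) (x + t *\<^sub>R axis j 1) = sq_mono (set as) x" if "j \<in> set bs" for j x t
      unfolding sq_mono_def by (intro prod.cong refl) (simp only: invariant_along_bs[OF that])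
  qed (use distinct in simp)
  have [measurable]: "partial_derivs bs \<phi> \<in> borel_measurable borel"
    by (intro borel_measurable_continuous_onI test_function_continuous[OF \<phi>])
  have E: "(LINT x|lborel. f (half_sq x) * (sq_mono (set as) x * expand bs h x)) =
    C * (LINT s|lborel. f s * (deriv ^^ n) w s)"
    using integral_expand[OF card n_pos f profile_mult_test_pos_integrable[OF f f0 int] h, of bs "set as" m]
      distinct set_split(2) card_set_as length_bs m by (simp add: hw C_def)
  have "(LINT x|lborel. partial_derivs bs \<phi> x *\<^sub>R \<psi> x) =
    (LINT x|lborel. complex_of_real (f (half_sq x) * (sq_mono (set as) x * expand bs h x)))"
  proof (rule integral_cong_AE)
    show "(\<lambda>x. complex_of_real (f (half_sq x) * (sq_mono (set as) x * expand bs h x))) \<in> borel_measurable lborel"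
      unfolding fun_cong[OF D\<phi>, symmetric] by measurable
    show "AE x in lborel. partial_derivs bs \<phi> x *\<^sub>R \<psi> x =
      complex_of_real (f (half_sq x) * (sq_mono (set as) x * expand bs h x))"
      using ae by eventually_elim (simp add: D\<phi> scaleR_conv_of_real mult_ac)
  qed measurable
  also have "\<dots> = complex_of_real (C * (LINT s|lborel. f s * (deriv ^^ n) w s))"
    unfolding E[symmetric] by (rule integral_complex_of_real)
  finally have "(- 1) ^ n * (LINT x|lborel. \<phi> x *\<^sub>R g x) = complex_of_real (C * (LINT s|lborel. f s * (deriv ^^ n) w s))"
    using weak \<phi> by (simp add: has_weak_partial_derivs_def length_bs)
  from arg_cong[OF this, of cmod]
  have "\<bar>C * (LINT s|lborel. f s * (deriv ^^ n) w s)\<bar> = cmod (LINT x|lborel. \<phi> x *\<^sub>R g x)"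
    by (simp add: norm_mult norm_power abs_mult)
  also have "\<dots> \<le> (LINT x|lborel. cmod (\<phi> x *\<^sub>R g x))" by (rule integral_norm_bound)
  also have "\<dots> = (LINT x|lborel. \<bar>\<xi> x * cmod (\<eta> x)\<bar>)"
    by (simp add: \<phi>\<xi> \<eta> norm_mult norm_power abs_mult mult_ac)
  finally have le: "\<bar>C * (LINT s|lborel. f s * (deriv ^^ n) w s)\<bar> \<le> (LINT x|lborel. \<bar>\<xi> x * cmod (\<eta> x)\<bar>)" .
  have \<xi>2: "(\<xi> x)\<^sup>2 = sq_mono UNIV x * (h (half_sq x))\<^sup>2" for x
    by (simp add: \<xi>_def power_mult_distrib sq_mono_UNIV[symmetric])
  have "indicator {0..} s * (C * s ^ m) * (h s)\<^sup>2 = C * ((w s)\<^sup>2 / s ^ m)" for s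
  proof (cases "s > 0")
    case True
    then show ?thesis by (simp add: hw[symmetric] power2_eq_square)
  qed (use test_pos_eq_0[OF w, of s] test_pos_eq_0[OF h, of s] in simp)
  then have eq: "(\<lambda>s. indicator {0..} s * (C * s ^ m) * (h s)\<^sup>2) = (\<lambda>s. C * ((w s)\<^sup>2 / s ^ m))" by auto
  have h2: "(\<lambda>s. (h s)\<^sup>2) \<in> borel_measurable borel" by measurable
  have "n + card (UNIV :: 'n set) = Suc m" using m card by simp
  note R = radial_integral[where G = "\<lambda>s. (h s)\<^sup>2", OF card n_pos h2 this, folded C_def, unfolded eq]
  have "integrable lborel (\<lambda>s. C * ((w s)\<^sup>2 / s ^ m))"
    using test_pos_mult_integrable[OF w w, of m] by (intro integrable_mult_right) (simp add: power2_eq_square)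
  then have \<xi>_int: "integrable lborel (\<lambda>x. (\<xi> x)\<^sup>2)" unfolding \<xi>2 R(1) .
  have \<xi>_eq: "(LINT x|lborel. (\<xi> x)\<^sup>2) = C * (LINT s|lborel. (w s)\<^sup>2 / s ^ m)"
    unfolding \<xi>2 R(2) by (rule integral_mult_right_zero)
  \<comment> \<open>\<open>C\<close> is squared on the left but enters the norm of
    \<open>\<xi>\<close> only once, so one factor survives.\<close>
  have "(C * (LINT s|lborel. f s * (deriv ^^ n) w s))\<^sup>2 \<le> (LINT x|lborel. \<bar>\<xi> x * cmod (\<eta> x)\<bar>)\<^sup>2"
    using le by (metis abs_ge_zero power2_abs power_mono)
  also have "\<dots> \<le> (C * (LINT s|lborel. (w s)\<^sup>2 / s ^ m)) * (LINT x|lborel. (cmod (\<eta> x))\<^sup>2)"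
    unfolding \<xi>_eq[symmetric] by (rule Cauchy_Schwarz_lebesgue_integral) (use \<xi>_int sq in auto)
  finally have "C * (C * (LINT s|lborel. f s * (deriv ^^ n) w s)\<^sup>2) \<le>
    C * ((LINT s|lborel. (w s)\<^sup>2 / s ^ m) * (LINT x|lborel. (cmod (\<eta> x))\<^sup>2))"
    by (simp add: power_mult_distrib power2_eq_square mult_ac)
  then have "C * (LINT s|lborel. f s * (deriv ^^ n) w s)\<^sup>2 \<le>
    (LINT s|lborel. (w s)\<^sup>2 / s ^ m) * (LINT x|lborel. (cmod (\<eta> x))\<^sup>2)"
    using C by (simp only: mult_le_cancel_left_pos)
  then show ?thesis by (simp only: C_def m_def)
qed

end

section \<open>Lower bound\<close>

text \<open>The quotient of factorials is the ratio of the radial constants for the exponents 3n - 1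
  and n - 1; the squared product is the inverse of the constant in the n-fold Hardy
  inequality.\<close>

definition sharp_constant :: "nat \<Rightarrow> real" where
  "sharp_constant n = fact (n - 1) / fact (3 * n - 1) * (\<Prod>j<n. real (n + 2 * j) / 2)\<^sup>2"

context balanced_split
begin

text \<open>For \<open>s > 0\<close>, \<open>(s ^ p * f s - u)^2 / s ^ p\<close> equals
  \<open>s ^ p * (f s - u / s ^ p)^2\<close>, so this is also an approximation of \<open>f\<close>
  in the norm of the state.\<close>

lemma weighted_profile_approx:
  fixes f :: "real \<Rightarrow> real"
  assumes f[measurable]: "f \<in> borel_measurable borel" and f0: "\<forall>s\<le>0. f s = 0"
    and int: "integrable lborel (\<lambda>s. s ^ p * (f s)\<^sup>2)" and \<delta>: "\<delta> > 0"
  obtains w where "test_pos w"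
    "integrable lborel (\<lambda>s. (s ^ p * f s - (deriv ^^ k) w s)\<^sup>2 / s ^ p)"
    "(LINT s|lborel. (s ^ p * f s - (deriv ^^ k) w s)\<^sup>2 / s ^ p) < \<delta>"
proof (rule derivs_test_pos_dense[of "\<lambda>s. s ^ p * f s" p \<delta> k])
  have "(s ^ p * f s)\<^sup>2 / s ^ p = s ^ p * (f s)\<^sup>2" for s
    using f0 by (cases "s > 0") (auto simp: power2_eq_square)
  then show "integrable lborel (\<lambda>s. (s ^ p * f s)\<^sup>2 / s ^ p)" using int by simp
qed (use f0 \<delta> that in auto)

text \<open>If \<open>(deriv ^^ n) w\<close> were exactly \<open>s ^ (n - 1) * f\<close>, then N, I
  and J below would coincide, and \<open>weak_pairing_bound\<close> with Hardy would bound N by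
  \<open>A * E / C\<close> directly; density supplies this up to \<open>\<delta>\<close>.\<close>

lemma energy_ge_sharp_constant:
  assumes wave: "wave_function \<psi>" and sym: "real_spherically_symmetric \<psi>"
    and op: "has_op_value as bs \<psi> \<eta>"
  shows "sharp_constant n \<le> (LINT x|lborel. (cmod (\<eta> x))\<^sup>2)"
proof -
  obtain f :: "real \<Rightarrow> real" where f[measurable]: "f \<in> borel_measurable borel" and f0: "\<forall>s\<le>0. f s = 0"
    and ae: "AE x in lborel. \<psi> x = complex_of_real (f (half_sq x))"
    and int: "integrable lborel (\<lambda>s. s ^ (n - 1) * (f s)\<^sup>2)"
    and one: "radial_factor (n - 1) * (LINT s|lborel. s ^ (n - 1) * (f s)\<^sup>2) = 1"
    by (rule radial_profile[OF wave sym])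
  have \<psi>: "\<psi> \<in> borel_measurable borel"
    using wave by (auto simp: wave_function_def square_integrable_def)
  define p where "p = n - 1"
  define N where "N = (LINT s|lborel. s ^ p * (f s)\<^sup>2)"
  define E where "E = (LINT x|lborel. (cmod (\<eta> x))\<^sup>2)"
  define A where "A = (\<Prod>j<n. 2 / (real (p + 2 * j) + 1))\<^sup>2"
  define C where "C = radial_factor (3 * n - 1)"
  have C: "C > 0" by (simp add: C_def)
  have E: "E \<ge> 0" unfolding E_def by (rule Bochner_Integration.integral_nonneg) simp
  have A: "A > 0" unfolding A_def by (intro zero_less_power prod_pos) (auto intro: divide_pos_pos)
  have p: "p + 2 * n = 3 * n - 1" using n_pos by (simp add: p_def)
  have "N \<le> A * E / C + \<delta>" if \<delta>: "\<delta> > 0" for \<delta>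
  proof -
    obtain w where w: "test_pos w"
      "integrable lborel (\<lambda>s. (s ^ p * f s - (deriv ^^ n) w s)\<^sup>2 / s ^ p)"
      "(LINT s|lborel. (s ^ p * f s - (deriv ^^ n) w s)\<^sup>2 / s ^ p) < \<delta>"
      by (rule weighted_profile_approx[OF f f0 int[folded p_def] \<delta>])
    note d = test_pos_deriv_funpow[OF w(1), of n]
    define I where "I = (LINT s|lborel. f s * (deriv ^^ n) w s)"
    define J where "J = (LINT s|lborel. ((deriv ^^ n) w s)\<^sup>2 / s ^ p)"
    have J_int: "integrable lborel (\<lambda>s. ((deriv ^^ n) w s)\<^sup>2 / s ^ p)"
      using test_pos_mult_integrable[OF d d, of p] by (simp add: power2_eq_square)
    have J: "J \<ge> 0" unfolding J_def
    proof (rule Bochner_Integration.integral_nonneg)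
      show "0 \<le> ((deriv ^^ n) w s)\<^sup>2 / s ^ p" for s
        using test_pos_eq_0[OF d, of s] by (cases "s > 0") auto
    qed
    have "(LINT s|lborel. (s ^ p * f s - (deriv ^^ n) w s)\<^sup>2 / s ^ p)
      = (LINT s|lborel. s ^ p * (f s)\<^sup>2 - 2 * (f s * (deriv ^^ n) w s) + ((deriv ^^ n) w s)\<^sup>2 / s ^ p)"
    proof (rule Bochner_Integration.integral_cong)
      show "(s ^ p * f s - (deriv ^^ n) w s)\<^sup>2 / s ^ p =
        s ^ p * (f s)\<^sup>2 - 2 * (f s * (deriv ^^ n) w s) + ((deriv ^^ n) w s)\<^sup>2 / s ^ p" for s
      proof (cases "s > 0")
        case True
        then show ?thesis by (simp add: field_simps power2_eq_square)
      qed (use f0 test_pos_eq_0[OF d] in simp)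
    qed simp
    also have "\<dots> = N - 2 * I + J"
      using int[folded p_def] profile_mult_test_pos_integrable[OF f f0 int d] J_int
      unfolding N_def I_def J_def
      by (simp only: Bochner_Integration.integral_add Bochner_Integration.integral_diff
          Bochner_Integration.integrable_diff integrable_mult_right integral_mult_right_zero)
    finally have NIJ: "N - 2 * I + J < \<delta>" using w(3) by simp
    \<comment> \<open>From \<open>I^2 \<le> \<kappa> * J\<close> follows
      \<open>2 * I \<le> \<kappa> + J\<close>; inserted into
      \<open>N - 2 * I + J < \<delta>\<close>, this cancels \<open>J\<close>.\<close>
    define \<kappa> where "\<kappa> = A * E / C"
    have \<kappa>: "\<kappa> \<ge> 0" using A E C by (simp add: \<kappa>_def)
    have "C * I\<^sup>2 \<le> (LINT s|lborel. (w s)\<^sup>2 / s ^ (3 * n - 1)) * E"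
      unfolding C_def I_def E_def by (rule weak_pairing_bound[OF f f0 ae int \<psi> op w(1)])
    also have "\<dots> \<le> (A * J) * E"
      using hardy_iterated[OF w(1), of p n] E unfolding p A_def J_def by (intro mult_right_mono)
    finally have "I\<^sup>2 \<le> \<kappa> * J" using C by (simp add: \<kappa>_def field_simps)
    then have "(2 * I)\<^sup>2 \<le> 4 * \<kappa> * J" by (simp add: power_mult_distrib)
    also have "\<dots> \<le> (\<kappa> + J)\<^sup>2" using zero_le_power2[of "\<kappa> - J"] by (simp add: power2_diff power2_sum mult_ac)
    finally have "2 * I \<le> \<kappa> + J" by (rule power2_le_imp_le) (use \<kappa> J in simp)
    then show ?thesis using NIJ by (simp add: \<kappa>_def)
  qed
  then have "N \<le> A * E / C" by (rule field_le_epsilon)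
  have "C / (radial_factor (n - 1) * A) = sharp_constant n"
  proof -
    have "(\<Prod>j<n. 2 / (real (p + 2 * j) + 1)) = 1 / (\<Prod>j<n. real (n + 2 * j) / 2)"
    proof -
      have "real (p + 2 * j) + 1 = real (n + 2 * j)" for j
        using n_pos by (simp add: p_def of_nat_diff)
      then show ?thesis by (simp only: prod_dividef) simp
    qed
    then have "A = 1 / (\<Prod>j<n. real (n + 2 * j) / 2)\<^sup>2" unfolding A_def by (simp add: power_one_over)
    then show ?thesis by (simp add: sharp_constant_def C_def)
  qed
  moreover have "C \<le> E * (radial_factor (n - 1) * A)"
  proof -
    have "1 \<le> radial_factor (n - 1) * (A * E / C)"
      unfolding one[symmetric] using \<open>N \<le> A * E / C\<close> unfolding N_def p_def by (rule mult_left_mono) simp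
    then show ?thesis using C by (simp add: field_simps)
  qed
  then have "C / (radial_factor (n - 1) * A) \<le> E"
    using A by (subst pos_divide_le_eq) simp_all
  ultimately show ?thesis by (simp add: E_def)
qed

text \<open>The state is replaced by a radial test function \<open>q\<close>, with an error
  controlled by Cauchy--Schwarz. For \<open>q\<close> the weak derivative moves all derivatives onto
  \<open>q\<close>, leaving an integrand that is odd in a coordinate.\<close>

lemma expectation_eq_0:
  assumes wave: "wave_function \<psi>" and sym: "real_spherically_symmetric \<psi>"
    and op: "has_op_value as bs \<psi> \<eta>"
  shows "(LINT x|lborel. cnj (\<psi> x) * \<eta> x) = 0"
proof -
  obtain f :: "real \<Rightarrow> real" where f[measurable]: "f \<in> borel_measurable borel" and f0: "\<forall>s\<le>0. f s = 0"
    and ae: "AE x in lborel. \<psi> x = complex_of_real (f (half_sq x))"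
    and int: "integrable lborel (\<lambda>s. s ^ (n - 1) * (f s)\<^sup>2)"
    by (rule radial_profile[OF wave sym])
  have \<psi>[measurable]: "\<psi> \<in> borel_measurable borel"
    using wave by (auto simp: wave_function_def square_integrable_def)
  obtain g where weak: "has_weak_partial_derivs \<psi> g bs"
    and \<eta>: "\<eta> = (\<lambda>x. (- \<i>) ^ length bs * complex_of_real (\<Prod>j\<leftarrow>as. x $ j) * g x)"
    and sq: "square_integrable \<eta>"
    using op by (auto simp: has_op_value_def)
  have \<eta>_meas[measurable]: "\<eta> \<in> borel_measurable borel" and sq: "integrable lborel (\<lambda>x. (cmod (\<eta> x))\<^sup>2)"
    using sq by (auto simp: square_integrable_def)
  define p where "p = n - 1"
  have p: "n + card ({} :: 'n set) = Suc p" using n_pos by (simp add: p_def)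
  define C where "C = radial_factor p"
  have C: "C > 0" by (simp add: C_def)
  define E where "E = (LINT x|lborel. (cmod (\<eta> x))\<^sup>2)"
  have E: "E \<ge> 0" unfolding E_def by (rule Bochner_Integration.integral_nonneg) simp
  define F where "F = (LINT x|lborel. complex_of_real (f (half_sq x)) * \<eta> x)"
  have "(cmod F)\<^sup>2 \<le> 0 + \<delta>" if \<delta>: "\<delta> > 0" for \<delta>
  proof -
    \<comment> \<open>Passing from the half-line to space multiplies the error by \<open>C\<close>,
      Cauchy--Schwarz multiplies it by \<open>E\<close>; \<open>E + 1\<close> avoids division by
      0.\<close>
    have "\<delta> / (C * (E + 1)) > 0" using \<delta> C E by (intro divide_pos_pos mult_pos_pos) auto
    then obtain w where w: "test_pos w"
      "integrable lborel (\<lambda>s. (s ^ p * f s - (deriv ^^ 0) w s)\<^sup>2 / s ^ p)"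
      "(LINT s|lborel. (s ^ p * f s - (deriv ^^ 0) w s)\<^sup>2 / s ^ p) < \<delta> / (C * (E + 1))"
      by (rule weighted_profile_approx[OF f f0 int[folded p_def]])
    define q where "q s = w s / s ^ p" for s
    have q: "test_pos q" unfolding q_def by (rule test_pos_divide_power[OF w(1)])
    have [measurable]: "q \<in> borel_measurable borel" by (rule smooth_measurable[OF test_pos_smooth[OF q]])
    have [measurable]: "(deriv ^^ n) q \<in> borel_measurable borel"
      by (rule smooth_measurable[OF smooth_deriv_funpow[OF test_pos_smooth[OF q]]])
    have sq0: "sq_mono {} x = 1" for x :: "real^'n" by (simp add: sq_mono_def)
    have "indicator {0..} s * (C * s ^ p) * (f s - q s)\<^sup>2 = C * ((s ^ p * f s - w s)\<^sup>2 / s ^ p)" for s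
    proof (cases "s > 0")
      case True
      then have "w s = s ^ p * q s" by (simp add: q_def)
      then have "s ^ p * f s - w s = s ^ p * (f s - q s)" by (simp add: algebra_simps)
      then show ?thesis using True by (simp add: power_mult_distrib power2_eq_square)
    qed (use f0 test_pos_eq_0[OF w(1)] test_pos_eq_0[OF q] in simp)
    then have eq: "(\<lambda>s. indicator {0..} s * (C * s ^ p) * (f s - q s)\<^sup>2)
      = (\<lambda>s. C * ((s ^ p * f s - w s)\<^sup>2 / s ^ p))" by auto
    have fq2: "(\<lambda>s. (f s - q s)\<^sup>2) \<in> borel_measurable borel" by measurable
    note R = radial_integral[OF card n_pos fq2 p, folded C_def, unfolded eq sq0 mult_1]
    have fq: "integrable lborel (\<lambda>x::real^'n. (f (half_sq x) - q (half_sq x))\<^sup>2)"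
      unfolding R(1) using w(2) by (intro integrable_mult_right) simp
    have fq_le: "(LINT x|lborel. (f (half_sq x) - q (half_sq (x::real^'n)))\<^sup>2) \<le> \<delta> / (E + 1)"
    proof -
      have "(LINT x|lborel. (f (half_sq x) - q (half_sq (x::real^'n)))\<^sup>2)
        = C * (LINT s|lborel. (s ^ p * f s - w s)\<^sup>2 / s ^ p)"
        unfolding R(2) by (rule integral_mult_right_zero)
      also have "\<dots> \<le> C * (\<delta> / (C * (E + 1)))"
        using w(3) C by (intro mult_left_mono) auto
      also have "\<dots> = \<delta> / (E + 1)" using C by simp
      finally show ?thesis .
    qed
    have "integrable lborel (\<lambda>s. indicator {0..} s * (C * s ^ p) * (q s)\<^sup>2)"
    proof -
      have "(\<lambda>s. indicator {0..} s * (C * s ^ p) * (q s)\<^sup>2) = (\<lambda>s. C * (w s * w s / s ^ p))"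
      proof
        show "indicator {0..} s * (C * s ^ p) * (q s)\<^sup>2 = C * (w s * w s / s ^ p)" for s
          using test_pos_eq_0[OF w(1), of s] by (cases "s > 0") (auto simp: q_def power2_eq_square)
      qed
      then show ?thesis using test_pos_mult_integrable[OF w(1) w(1), of p]
        by (simp only: integrable_mult_right)
    qed
    then have q_int: "integrable lborel (\<lambda>x::real^'n. (q (half_sq x))\<^sup>2)"
      using radial_integral(1)[OF card n_pos _ p, of "\<lambda>s. (q s)\<^sup>2", folded C_def, unfolded sq0] by simp
    have mult_int: "integrable lborel (\<lambda>x. complex_of_real (u x) * \<eta> x)"
      if [measurable]: "u \<in> borel_measurable borel" and "integrable lborel (\<lambda>x. (u x)\<^sup>2)" for u
    proof (rule integrable_norm_cancel)
      show "integrable lborel (\<lambda>x. cmod (complex_of_real (u x) * \<eta> x))"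
        using integrable_abs[OF integrable_mult_of_squares[of u lborel "\<lambda>x. cmod (\<eta> x)"]] that sq
        by (simp add: norm_mult abs_mult)
    qed measurable
    \<comment> \<open>The position factor of \<open>\<eta>\<close> times \<open>q\<close> is a
      legitimate test function, so the weak derivative may be tested against it.\<close>
    have q0: "(LINT x|lborel. complex_of_real (q (half_sq x)) * \<eta> x) = 0"
    proof -
      define \<phi> where "\<phi> x = (\<Prod>j\<leftarrow>as. x $ j) * q (half_sq x)" for x :: "real^'n"
      have \<phi>: "test_function \<phi>"
        using test_function_weighted_radial[OF q, of as "[]"] by (simp add: \<phi>_def[abs_def])
      have D\<phi>: "partial_derivs bs \<phi> = (\<lambda>x. (\<Prod>j\<leftarrow>as. x $ j) * (\<Prod>j\<leftarrow>bs. x $ j) * (deriv ^^ length bs) q (half_sq x))"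
        unfolding \<phi>_def
      proof (rule partial_derivs_coord_radial[OF test_pos_smooth[OF q]])
        show "(\<Prod>k\<leftarrow>as. (x + t *\<^sub>R axis j 1) $ k) = (\<Prod>k\<leftarrow>as. x $ k)" if "j \<in> set bs" for j t and x :: "real^'n"
          by (intro arg_cong[where f = prod_list] map_cong refl invariant_along_bs[OF that])
      qed (use distinct in simp)
      have "(LINT x|lborel. partial_derivs bs \<phi> x *\<^sub>R \<psi> x) =
        (LINT x|lborel. complex_of_real ((\<Prod>j\<in>UNIV. x $ j) * ((deriv ^^ n) q (half_sq x) * f (half_sq (x :: real^'n)))))"
      proof (rule integral_cong_AE)
        have "(\<lambda>x::real^'n. \<Prod>j\<in>UNIV. x $ j) \<in> borel_measurable borel"
          by (intro borel_measurable_continuous_onI continuous_intros)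
        then show "(\<lambda>x. complex_of_real ((\<Prod>j\<in>UNIV. x $ j) * ((deriv ^^ n) q (half_sq x) * f (half_sq x))))
          \<in> borel_measurable (lborel :: (real^'n) measure)"
          by measurable
        have "partial_derivs bs \<phi> \<in> borel_measurable borel"
          by (intro borel_measurable_continuous_onI test_function_continuous[OF \<phi>])
        then show "(\<lambda>x. partial_derivs bs \<phi> x *\<^sub>R \<psi> x) \<in> borel_measurable lborel" by measurable
        show "AE x in lborel. partial_derivs bs \<phi> x *\<^sub>R \<psi> x =
          complex_of_real ((\<Prod>j\<in>UNIV. x $ j) * ((deriv ^^ n) q (half_sq x) * f (half_sq x)))"
          using ae by eventually_elim
            (simp add: D\<phi> prod_list_all length_bs scaleR_conv_of_real del: of_real_prod)
      qed
      also have "\<dots> = complex_of_real (LINT x|lborel. (\<Prod>j\<in>UNIV. x $ j) *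
          ((deriv ^^ n) q (half_sq x) * f (half_sq (x :: real^'n))))"
        by (rule integral_complex_of_real)
      also have "\<dots> = 0"
        by (subst integral_odd_radial) auto
      finally have "(LINT x|lborel. \<phi> x *\<^sub>R g x) = 0"
        using weak \<phi> by (simp add: has_weak_partial_derivs_def)
      moreover have "complex_of_real (q (half_sq x)) * \<eta> x = (- \<i>) ^ length bs * (\<phi> x *\<^sub>R g x)" for x
        by (simp add: \<eta> \<phi>_def scaleR_conv_of_real mult_ac)
      ultimately show ?thesis by (simp only: integral_mult_right_zero mult_zero_right)
    qed
    have "F = (LINT x|lborel. complex_of_real (f (half_sq x) - q (half_sq x)) * \<eta> x
      + complex_of_real (q (half_sq x)) * \<eta> x)"
      unfolding F_def by (rule Bochner_Integration.integral_cong) (simp_all add: algebra_simps)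
    also have "\<dots> = (LINT x|lborel. complex_of_real (f (half_sq x) - q (half_sq x)) * \<eta> x)"
    proof (subst Bochner_Integration.integral_add)
      show "integrable lborel (\<lambda>x. complex_of_real (f (half_sq x) - q (half_sq x)) * \<eta> x)"
        by (rule mult_int[OF _ fq]) measurable
      show "integrable lborel (\<lambda>x. complex_of_real (q (half_sq x)) * \<eta> x)"
        by (rule mult_int[OF _ q_int]) measurable
    qed (simp add: q0)
    finally have "cmod F \<le> (LINT x|lborel. cmod (complex_of_real (f (half_sq x) - q (half_sq x)) * \<eta> x))"
      by (simp only: integral_norm_bound)
    also have "\<dots> = (LINT x|lborel. \<bar>(f (half_sq x) - q (half_sq x)) * cmod (\<eta> x)\<bar>)"
      by (simp only: norm_mult norm_of_real abs_mult abs_norm_cancel)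
    finally have "(cmod F)\<^sup>2 \<le> (LINT x|lborel. \<bar>(f (half_sq x) - q (half_sq x)) * cmod (\<eta> x)\<bar>)\<^sup>2"
      by (intro power_mono) auto
    also have "\<dots> \<le> (LINT x|lborel. (f (half_sq x) - q (half_sq (x::real^'n)))\<^sup>2) * E"
      unfolding E_def by (rule Cauchy_Schwarz_lebesgue_integral) (use fq sq in auto)
    also have "\<dots> \<le> \<delta> / (E + 1) * E" using fq_le E by (rule mult_right_mono)
    also have "\<dots> \<le> \<delta>" using \<delta> E by (simp add: field_simps)
    finally show ?thesis by simp
  qed
  then have "(cmod F)\<^sup>2 \<le> 0" by (rule field_le_epsilon)
  moreover have "(LINT x|lborel. cnj (\<psi> x) * \<eta> x) = F"
    unfolding F_def
  proof (rule integral_cong_AE)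
    show "AE x in lborel. cnj (\<psi> x) * \<eta> x = complex_of_real (f (half_sq x)) * \<eta> x"
      using ae by eventually_elim simp
    have "(\<lambda>x. cnj (\<psi> x)) \<in> borel_measurable borel"
      by (rule borel_measurable_continuous_on[OF _ \<psi>]) (intro continuous_intros)
    then show "(\<lambda>x. cnj (\<psi> x) * \<eta> x) \<in> borel_measurable lborel"
      using \<eta>_meas by simp
    have "(\<lambda>x. complex_of_real (f (half_sq x))) \<in> borel_measurable (borel :: (real^'n) measure)"
      by measurable
    then show "(\<lambda>x. complex_of_real (f (half_sq x)) * \<eta> x) \<in> borel_measurable lborel"
      using \<eta>_meas by simp
  qed
  ultimately show ?thesis by simp
qed

end

section \<open>Weak derivatives of classically differentiable radial functions\<close>

lemma continuous_compact_support_integrable: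
  fixes F :: "'a::euclidean_space \<Rightarrow> real"
  assumes "continuous_on UNIV F" "\<And>x. x \<notin> cball 0 r \<Longrightarrow> F x = 0"
  shows "integrable lborel F"
proof -
  have "integrable lborel (\<lambda>x. indicator (cball 0 r) x *\<^sub>R F x)"
    by (intro borel_integrable_compact continuous_on_subset[OF assms(1)]) auto
  moreover have "(\<lambda>x. indicator (cball 0 r) x *\<^sub>R F x) = F"
    using assms(2) by (auto simp: indicator_def fun_eq_iff)
  ultimately show ?thesis by simp
qed

text \<open>Difference quotients integrate to 0 by translation invariance; the mean value theorem
  dominates them by a bound for \<open>D\<close>, so the limit may be taken under the
  integral.\<close>

lemma integral_partial_deriv_eq_0:
  fixes F :: "real^'n::finite \<Rightarrow> real"
  assumes d: "\<And>x. ((\<lambda>t. F (x + t *\<^sub>R axis j 1)) has_real_derivative D x) (at 0)"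
    and F: "continuous_on UNIV F" "\<And>x. x \<notin> cball 0 r \<Longrightarrow> F x = 0"
    and D: "continuous_on UNIV D" "\<And>x. x \<notin> cball 0 r \<Longrightarrow> D x = 0"
  shows "(LINT x|lborel. D x) = 0"
proof -
  define e :: "real^'n" where "e = axis j 1"
  have e: "norm e = 1" by (simp add: e_def)
  define h where "h k = 1 / real (Suc k)" for k
  have h: "0 < h k" "h k \<le> 1" for k by (auto simp: h_def)
  have [measurable]: "F \<in> borel_measurable borel" "D \<in> borel_measurable borel"
    using F(1) D(1) by (auto intro: borel_measurable_continuous_onI)
  have F_int: "integrable lborel F" by (rule continuous_compact_support_integrable[OF F])
  have shift_int: "integrable lborel (\<lambda>x. F (x + h k *\<^sub>R e))"
    and shift: "(LINT x|lborel. F (x + h k *\<^sub>R e)) = (LINT x|lborel. F x)" for k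
  proof -
    have distr: "distr lborel borel (\<lambda>x. x + h k *\<^sub>R e) = lborel"
      using lborel_distr_plus[of "h k *\<^sub>R e"] by (simp add: add.commute[of _ "h k *\<^sub>R e"])
    show "integrable lborel (\<lambda>x. F (x + h k *\<^sub>R e))"
      using F_int integrable_distr_eq[of "\<lambda>x. x + h k *\<^sub>R e" lborel borel F] by (simp add: distr)
    show "(LINT x|lborel. F (x + h k *\<^sub>R e)) = (LINT x|lborel. F x)"
      using integral_distr[of "\<lambda>x. x + h k *\<^sub>R e" lborel borel F] by (simp add: distr)
  qed
  define q where "q k x = (F (x + h k *\<^sub>R e) - F x) / h k" for k x
  have q0: "(LINT x|lborel. q k x) = 0" for k
    using shift_int[of k] F_int shift[of k] unfolding q_def by simp
  have deriv_at: "((\<lambda>t. F (x + t *\<^sub>R e)) has_real_derivative D (x + t *\<^sub>R e)) (at t)" for x t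
  proof -
    have "((\<lambda>s. F (x + (s + t) *\<^sub>R e)) has_real_derivative D (x + t *\<^sub>R e)) (at 0)"
      using d[of "x + t *\<^sub>R e"] by (simp add: e_def algebra_simps)
    then show ?thesis using DERIV_shift[of "\<lambda>s. F (x + s *\<^sub>R e)" _ 0 t] by simp
  qed
  have "compact (D ` cball 0 r)"
    by (intro compact_continuous_image continuous_on_subset[OF D(1)]) auto
  from compact_imp_bounded[OF this] obtain M where M: "\<forall>y\<in>D ` cball 0 r. norm y \<le> M"
    unfolding bounded_iff by blast
  have DM: "\<bar>D x\<bar> \<le> \<bar>M\<bar>" for x
  proof (cases "x \<in> cball 0 r")
    case True
    then have "norm (D x) \<le> M" using M by blast
    then show ?thesis by simp
  qed (use D(2) in simp)
  \<comment> \<open>The shifts \<open>h k\<close> are at most 1, so all quotients vanish outside the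
    ball of radius r + 1.\<close>
  have le: "norm (q k x) \<le> \<bar>M\<bar> * indicator (cball 0 (r + 1)) x" for k x
  proof (cases "x \<in> cball 0 (r + 1)")
    case True
    obtain t where "F (x + h k *\<^sub>R e) - F (x + 0 *\<^sub>R e) = (h k - 0) * D (x + t *\<^sub>R e)"
      using MVT2[of 0 "h k" "\<lambda>t. F (x + t *\<^sub>R e)" "\<lambda>t. D (x + t *\<^sub>R e)"] h(1)[of k] deriv_at by blast
    then have "q k x = D (x + t *\<^sub>R e)" using h(1)[of k] by (simp add: q_def)
    then show ?thesis using DM True by simp
  next
    case False
    have "norm x \<le> norm (x + h k *\<^sub>R e) + h k"
      using norm_triangle_ineq4[of "x + h k *\<^sub>R e" "h k *\<^sub>R e"] h(1)[of k] e by simp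
    then have "norm (x + h k *\<^sub>R e) > r" "norm x > r"
      using False h(1,2)[of k] by (auto simp: dist_norm)
    then have "F (x + h k *\<^sub>R e) = 0" "F x = 0" using F(2) by auto
    then show ?thesis using False by (simp add: q_def)
  qed
  have lim: "(\<lambda>k. q k x) \<longlonglongrightarrow> D x" for x
  proof -
    have "((\<lambda>t. (F (x + t *\<^sub>R e) - F x) / t) \<longlongrightarrow> D x) (at 0)"
      using d[of x] by (simp add: DERIV_def e_def)
    moreover have "filterlim h (at 0) sequentially"
      unfolding filterlim_at h_def using lim_1_over_n[THEN LIMSEQ_Suc] by auto
    ultimately show ?thesis unfolding q_def by (rule filterlim_compose)
  qed
  have "(\<lambda>k. LINT x|lborel. q k x) \<longlonglongrightarrow> (LINT x|lborel. D x)"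
  proof (rule integral_dominated_convergence[where w = "\<lambda>x. \<bar>M\<bar> * indicator (cball 0 (r + 1)) x"])
    show "integrable lborel (\<lambda>x::real^'n. \<bar>M\<bar> * indicator (cball 0 (r + 1)) x)"
      using emeasure_bounded_finite[OF bounded_cball, of "0 :: real^'n" "r + 1"]
      by (intro integrable_mult_right) (simp add: integrable_indicator_iff)
    show "q k \<in> borel_measurable lborel" for k unfolding q_def by measurable
  qed (use lim le in auto)
  then show ?thesis using q0 by (simp add: LIMSEQ_const_iff)
qed

lemma integral_by_parts_partial_deriv:
  fixes u v :: "real^'n::finite \<Rightarrow> real"
  assumes u: "u differentiable_on UNIV" "\<And>x. x \<notin> cball 0 r \<Longrightarrow> u x = 0"
    and u': "continuous_on UNIV (partial_deriv j u)" "\<And>x. x \<notin> cball 0 r \<Longrightarrow> partial_deriv j u x = 0"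
    and v: "continuous_on UNIV v" "\<And>x. ((\<lambda>t. v (x + t *\<^sub>R axis j 1)) has_real_derivative v' x) (at 0)"
      "continuous_on UNIV v'"
  shows "(LINT x|lborel. partial_deriv j u x * v x) = - (LINT x|lborel. u x * v' x)"
proof -
  have uc: "continuous_on UNIV u" by (rule differentiable_imp_continuous_on[OF u(1)])
  have du: "((\<lambda>t. u (x + t *\<^sub>R axis j 1)) has_real_derivative partial_deriv j u x) (at 0)" for x
  proof -
    have "(u has_derivative frechet_derivative u (at x)) (at x)"
      using u(1) by (auto simp: differentiable_on_def frechet_derivative_works)
    from has_derivative_DERIV_axis[OF this, of j] partial_deriv_has_derivative[OF this, of j]
    show ?thesis by simp
  qed
  have "(LINT x|lborel. partial_deriv j u x * v x + v' x * u x) = 0"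
  proof (rule integral_partial_deriv_eq_0[where F = "\<lambda>x. u x * v x"])
    show "((\<lambda>t. u (x + t *\<^sub>R axis j 1) * v (x + t *\<^sub>R axis j 1)) has_real_derivative
      partial_deriv j u x * v x + v' x * u x) (at 0)" for x
      using DERIV_mult[OF du v(2)] by simp
  qed (use u u' v uc in \<open>auto intro!: continuous_intros\<close>)
  moreover have "integrable lborel (\<lambda>x. partial_deriv j u x * v x)" "integrable lborel (\<lambda>x. v' x * u x)"
    by (rule continuous_compact_support_integrable[where r = r];
        use u u' v uc in \<open>auto intro!: continuous_intros\<close>)+
  ultimately show ?thesis by (simp add: mult.commute)
qed

lemma partial_deriv_eq_0_outside:
  fixes u :: "real^'n::finite \<Rightarrow> real"
  assumes "\<And>x. x \<notin> cball 0 r \<Longrightarrow> u x = 0" "x \<notin> cball 0 r"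
  shows "partial_deriv j u x = 0"
proof (rule partial_derivI)
  define S where "S = (\<lambda>t. x + t *\<^sub>R axis j 1) -` (- cball 0 r)"
  have "open S" unfolding S_def
    by (rule continuous_open_vimage) (auto intro!: continuous_intros)
  then show "((\<lambda>t. u (x + t *\<^sub>R axis j 1)) has_real_derivative 0) (at 0)"
    by (rule has_field_derivative_transform_within_open[where f = "\<lambda>_. 0", rotated])
      (use assms in \<open>auto simp: S_def\<close>)
qed

text \<open>One radius serves all iterated derivatives, since a function that vanishes on the open
  complement of a ball has vanishing derivatives there.\<close>

lemma test_function_support:
  assumes "test_function \<phi>"
  obtains r where "\<And>js x. x \<notin> cball 0 r \<Longrightarrow> partial_derivs js \<phi> x = 0"
proof -
  have "bounded (closure {x. \<phi> x \<noteq> 0})"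
    using assms compact_imp_bounded by (auto simp: test_function_def)
  then obtain r where r: "\<forall>x\<in>closure {x. \<phi> x \<noteq> 0}. norm x \<le> r"
    unfolding bounded_iff by blast
  have base: "\<phi> x = 0" if "x \<notin> cball 0 r" for x
    using r that closure_subset[of "{x. \<phi> x \<noteq> 0}"] by force
  have "\<forall>x. x \<notin> cball 0 r \<longrightarrow> partial_derivs js \<phi> x = 0" for js
  proof (induction js)
    case (Cons j js)
    then show ?case unfolding partial_derivs_Cons
      using partial_deriv_eq_0_outside[of r "partial_derivs js \<phi>"] by blast
  qed (use base in simp)
  then show thesis using that by blast
qed

text \<open>Only nonnegative arguments of the profiles matter, so that singular profiles like
  \<open>(1 + s) powr a\<close> are admissible.\<close>

lemma weak_derivs_of_radial:
  fixes H :: "nat \<Rightarrow> real \<Rightarrow> real" and \<phi> :: "real^'n::finite \<Rightarrow> real"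
  assumes H: "\<And>k s. s \<ge> 0 \<Longrightarrow> (H k has_real_derivative H (Suc k) s) (at s)"
    and \<phi>: "test_function \<phi>" and "distinct (js @ l)"
  shows "(LINT x|lborel. partial_derivs js \<phi> x * ((\<Prod>j\<leftarrow>l. x $ j) * H (length l) (half_sq x))) =
    (- 1) ^ length js * (LINT x|lborel. \<phi> x * ((\<Prod>j\<leftarrow>l. x $ j) * (\<Prod>j\<leftarrow>js. x $ j) *
      H (length l + length js) (half_sq x)))"
  using assms(3)
\<comment> \<open>The list \<open>l\<close> collects the coordinates whose derivatives already act
  on the profile; distinctness makes their monomial constant along the next coordinate.\<close>
proof (induction js arbitrary: l)
  case (Cons j js)
  obtain r where r: "\<And>js x. x \<notin> cball 0 r \<Longrightarrow> partial_derivs js \<phi> x = 0"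
    using test_function_support[OF \<phi>] by blast
  have j: "j \<notin> set l" using Cons.prems by auto
  have cont: "continuous_on UNIV (\<lambda>x::real^'n. (\<Prod>j\<leftarrow>l. x $ j) * H k (half_sq x))" for k l
  proof (intro continuous_on_mult)
    show "continuous_on UNIV (\<lambda>x::real^'n. \<Prod>j\<leftarrow>l. x $ j)"
      by (induction l) (auto intro!: continuous_intros)
    have "continuous_on {0..} (H k)"
      using H by (intro DERIV_continuous_on) (auto intro: has_field_derivative_at_within)
    then show "continuous_on UNIV (\<lambda>x::real^'n. H k (half_sq x))"
      by (rule continuous_on_compose2[OF _ continuous_half_sq]) auto
  qed
  have "(LINT x|lborel. partial_deriv j (partial_derivs js \<phi>) x * ((\<Prod>j\<leftarrow>l. x $ j) * H (length l) (half_sq x)))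
    = - (LINT x|lborel. partial_derivs js \<phi> x * ((\<Prod>j\<leftarrow>j # l. x $ j) * H (length (j # l)) (half_sq x)))"
  proof (rule integral_by_parts_partial_deriv[where r = r])
    show "partial_derivs js \<phi> differentiable_on UNIV" using \<phi> by (auto simp: test_function_def)
    show "continuous_on UNIV (partial_deriv j (partial_derivs js \<phi>))"
      using test_function_continuous[OF \<phi>, of UNIV "j # js"] by (simp add: partial_derivs_Cons)
    show "((\<lambda>t. (\<Prod>j'\<leftarrow>l. (x + t *\<^sub>R axis j 1) $ j') * H (length l) (half_sq (x + t *\<^sub>R axis j 1)))
      has_real_derivative (\<Prod>j\<leftarrow>j # l. x $ j) * H (length (j # l)) (half_sq x)) (at 0)" for x :: "real^'n"
    proof -
      have inv: "(\<Prod>k\<leftarrow>l. (x + t *\<^sub>R axis j 1) $ k) = (\<Prod>k\<leftarrow>l. x $ k)" for t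
        using j by (intro arg_cong[where f = prod_list] map_cong) (auto simp: axis_def)
      have "((\<lambda>t. (\<Prod>j'\<leftarrow>l. x $ j') * H (length l) (half_sq (x + t *\<^sub>R axis j 1))) has_real_derivative
        (\<Prod>j'\<leftarrow>l. x $ j') * (H (Suc (length l)) (half_sq x) * x $ j)) (at 0)"
        by (intro DERIV_cmult compose_half_sq_DERIV_axis H) simp
      then show ?thesis unfolding inv by (simp add: mult_ac)
    qed
  qed (use r[of _ js] r[of _ "j # js"] cont[where l = l] cont[where l = "j # l"] in \<open>auto simp: partial_derivs_Cons\<close>)
  also have "\<dots> = - ((- 1) ^ length js * (LINT x|lborel. \<phi> x * ((\<Prod>j\<leftarrow>j # l. x $ j) * (\<Prod>j\<leftarrow>js. x $ j) *
      H (length (j # l) + length js) (half_sq x))))"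
    using Cons.IH[of "j # l"] Cons.prems by simp
  finally show ?case by (simp add: partial_derivs_Cons mult_ac)
qed simp

section \<open>Upper bound\<close>

text \<open>The k-th derivative of \<open>(1 + s) powr (- a)\<close> for \<open>s \<ge> 0\<close> in
  closed form; the shift by 1 removes the singularity of the formal extremal at the origin.\<close>

definition trial_profile :: "real \<Rightarrow> nat \<Rightarrow> real \<Rightarrow> real" where
  "trial_profile a k s = (\<Prod>j<k. - (a + real j)) * (1 + s) powr (- (a + real k))"

lemma trial_profile_DERIV:
  assumes "s \<ge> 0"
  shows "(trial_profile a k has_real_derivative trial_profile a (Suc k) s) (at s)"
proof -
  have "((\<lambda>s. (1 + s) powr (- (a + real k))) has_real_derivative
    - (a + real k) * (1 + s) powr (- (a + real (Suc k)))) (at s)"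
  proof -
    have e: "- (a + real (Suc k)) = - (a + real k) - of_nat 1" by simp
    show ?thesis unfolding e
      by (rule DERIV_cong[OF DERIV_fun_powr[where g = "\<lambda>s. 1 + s" and m = 1]])
        (use assms in \<open>auto intro!: derivative_eq_intros\<close>)
  qed
  from DERIV_cmult[OF this, of "\<Prod>j<k. - (a + real j)"] show ?thesis
    unfolding trial_profile_def[abs_def] by (simp add: mult_ac)
qed

lemma trial_profile_measurable [measurable]: "trial_profile a k \<in> borel_measurable borel"
  unfolding trial_profile_def[abs_def] by measurable

lemma trial_profile_0: "trial_profile a 0 s = (1 + s) powr (- a)"
  by (simp add: trial_profile_def)

lemma integrable_powr_tail:
  fixes \<epsilon> :: real
  assumes "\<epsilon> > 0"
  shows "integrable lborel (\<lambda>s. indicator {0..} s * (1 + s) powr (- 1 - 2 * \<epsilon>))"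
proof (rule integrableI_nn_integral_finite)
  have "(\<integral>\<^sup>+s. ennreal ((1 + s) powr (- 1 - 2 * \<epsilon>)) * indicator {0..} s \<partial>lborel)
    = ennreal (0 - (- (1 / (2 * \<epsilon>)) * (1 + 0) powr (- 2 * \<epsilon>)))"
  proof (rule nn_integral_FTC_atLeast)
    show "((\<lambda>s. - (1 / (2 * \<epsilon>)) * (1 + s) powr (- 2 * \<epsilon>)) has_real_derivative
      (1 + s) powr (- 1 - 2 * \<epsilon>)) (at s)" if "s \<ge> 0" for s
    proof -
      have e: "- 1 - 2 * \<epsilon> = - 2 * \<epsilon> - of_nat 1" by simp
      show ?thesis unfolding e
        by (rule DERIV_cong[OF DERIV_cmult[OF DERIV_fun_powr[where g = "\<lambda>s. 1 + s" and m = 1]]])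
          (use assms that in \<open>auto intro!: derivative_eq_intros\<close>)
    qed
    have "((\<lambda>s::real. (1 + s) powr (- (2 * \<epsilon>))) \<longlongrightarrow> 0) at_top"
      using assms by (intro tendsto_neg_powr filterlim_tendsto_add_at_top[OF tendsto_const filterlim_ident]) auto
    from tendsto_mult_right[OF this, of "- (1 / (2 * \<epsilon>))"]
    show "((\<lambda>s. - (1 / (2 * \<epsilon>)) * (1 + s) powr (- 2 * \<epsilon>)) \<longlongrightarrow> 0) at_top" by simp
  qed auto
  also have "(\<lambda>s. ennreal ((1 + s) powr (- 1 - 2 * \<epsilon>)) * indicator {0..} s)
    = (\<lambda>s. ennreal (indicator {0..} s * (1 + s) powr (- 1 - 2 * \<epsilon>)))"
    by (auto simp: indicator_def)
  finally show "(\<integral>\<^sup>+s. ennreal (indicator {0..} s * (1 + s) powr (- 1 - 2 * \<epsilon>)) \<partial>lborel)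
    = ennreal (0 - (- (1 / (2 * \<epsilon>)) * (1 + 0) powr (- 2 * \<epsilon>)))" .
qed auto

lemma continuous_locally_integrable:
  fixes f :: "real^'n::finite \<Rightarrow> complex"
  assumes "continuous_on UNIV f"
  shows "locally_integrable f"
  unfolding locally_integrable_def set_integrable_def
  using borel_integrable_compact continuous_on_subset[OF assms] by blast

context balanced_split
begin

definition trial_weight :: "real \<Rightarrow> real \<Rightarrow> real" where
  "trial_weight \<epsilon> s = indicator {0..} s * s ^ (n - 1) * (trial_profile (real n / 2 + \<epsilon>) 0 s)\<^sup>2"

text \<open>Since s^(n-1) is at most (1 + s)^(n-1), the integrand is at most (1 + s)^(-1-2 epsilon);
  this is where \<open>\<epsilon> > 0\<close> makes the state normalizable.\<close>

lemma integrable_trial_weight: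
  assumes "\<epsilon> > 0"
  shows "integrable lborel (trial_weight \<epsilon>)"
proof (rule Bochner_Integration.integrable_bound[OF integrable_powr_tail[OF assms]])
  show "trial_weight \<epsilon> \<in> borel_measurable lborel"
    unfolding trial_weight_def[abs_def] by measurable
  show "AE s in lborel. norm (trial_weight \<epsilon> s) \<le> norm (indicator {0..} s * (1 + s) powr (- 1 - 2 * \<epsilon>))"
  proof (rule AE_I2)
    fix s
    show "norm (trial_weight \<epsilon> s) \<le> norm (indicator {0..} s * (1 + s) powr (- 1 - 2 * \<epsilon>))"
    proof (cases "s \<ge> 0")
      case True
      have "s ^ (n - 1) \<le> (1 + s) ^ (n - 1)" using True by (intro power_mono) auto
      also have "\<dots> = (1 + s) powr (real n - 1)"
        using True n_pos by (simp add: powr_realpow[symmetric] of_nat_diff)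
      finally have "s ^ (n - 1) * (trial_profile (real n / 2 + \<epsilon>) 0 s)\<^sup>2 \<le>
        (1 + s) powr (real n - 1) * (trial_profile (real n / 2 + \<epsilon>) 0 s)\<^sup>2"
        by (rule mult_right_mono) simp
      also have "\<dots> = (1 + s) powr (- 1 - 2 * \<epsilon>)"
        using True by (simp add: trial_profile_0 power2_eq_square powr_add[symmetric] algebra_simps)
      finally show ?thesis using True by (simp add: trial_weight_def)
    qed (simp add: trial_weight_def)
  qed
qed

lemma trial_norm:
  assumes "\<epsilon> > 0"
  shows "integrable lborel (\<lambda>x::real^'n. (trial_profile (real n / 2 + \<epsilon>) 0 (half_sq x))\<^sup>2)"
    and "(LINT x|lborel. (trial_profile (real n / 2 + \<epsilon>) 0 (half_sq (x :: real^'n)))\<^sup>2)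
      = radial_factor (n - 1) * integral\<^sup>L lborel (trial_weight \<epsilon>)"
    and "integral\<^sup>L lborel (trial_weight \<epsilon>) > 0"
proof -
  have meas: "(\<lambda>s. (trial_profile (real n / 2 + \<epsilon>) 0 s)\<^sup>2) \<in> borel_measurable borel" by measurable
  have k: "n + card ({} :: 'n set) = Suc (n - 1)" using n_pos by simp
  have sq0: "sq_mono {} x = 1" for x :: "real^'n" by (simp add: sq_mono_def)
  have eq: "(\<lambda>s. indicator {0..} s * (radial_factor (n - 1) * s ^ (n - 1)) * (trial_profile (real n / 2 + \<epsilon>) 0 s)\<^sup>2)
    = (\<lambda>s. radial_factor (n - 1) * trial_weight \<epsilon> s)"
    by (simp add: trial_weight_def mult_ac)
  note R = radial_integral[OF card n_pos meas k, unfolded sq0 mult_1 eq]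
  show int: "integrable lborel (\<lambda>x::real^'n. (trial_profile (real n / 2 + \<epsilon>) 0 (half_sq x))\<^sup>2)"
    unfolding R(1) by (intro integrable_mult_right integrable_trial_weight assms)
  show eq: "(LINT x|lborel. (trial_profile (real n / 2 + \<epsilon>) 0 (half_sq (x :: real^'n)))\<^sup>2)
      = radial_factor (n - 1) * integral\<^sup>L lborel (trial_weight \<epsilon>)"
    unfolding R(2) by (rule integral_mult_right_zero)
  have "(LINT x|lborel. (trial_profile (real n / 2 + \<epsilon>) 0 (half_sq (x :: real^'n)))\<^sup>2) \<noteq> 0"
  proof
    assume "(LINT x|lborel. (trial_profile (real n / 2 + \<epsilon>) 0 (half_sq (x :: real^'n)))\<^sup>2) = 0"
    then have "AE x in lborel. (trial_profile (real n / 2 + \<epsilon>) 0 (half_sq (x :: real^'n)))\<^sup>2 = 0"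
      using integral_nonneg_eq_0_iff_AE[OF int] by simp
    moreover have "trial_profile (real n / 2 + \<epsilon>) 0 (half_sq x) \<noteq> 0" for x :: "real^'n"
      using half_sq_nonneg[of x] by (simp add: trial_profile_0 add_nonneg_eq_0_iff)
    ultimately have "AE x in (lborel :: (real^'n) measure). False" by simp
    then have "ae_filter (lborel :: (real^'n) measure) = bot" by (simp add: trivial_limit_def)
    then show False by (simp add: ae_filter_eq_bot_iff emeasure_lborel_UNIV)
  qed
  moreover have "(LINT x|lborel. (trial_profile (real n / 2 + \<epsilon>) 0 (half_sq (x :: real^'n)))\<^sup>2) \<ge> 0"
    by (rule Bochner_Integration.integral_nonneg) simp
  ultimately have "radial_factor (n - 1) * integral\<^sup>L lborel (trial_weight \<epsilon>) > 0"
    unfolding eq[symmetric] by linarith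
  then show "integral\<^sup>L lborel (trial_weight \<epsilon>) > 0" by (rule zero_less_mult_pos) simp
qed

definition trial_scale :: "real \<Rightarrow> real" where
  "trial_scale \<epsilon> = 1 / sqrt (radial_factor (n - 1) * integral\<^sup>L lborel (trial_weight \<epsilon>))"

definition trial_state :: "real \<Rightarrow> real^'n \<Rightarrow> complex" where
  "trial_state \<epsilon> x = complex_of_real (trial_scale \<epsilon> * trial_profile (real n / 2 + \<epsilon>) 0 (half_sq x))"

lemma trial_scale_sq:
  "\<epsilon> > 0 \<Longrightarrow> (trial_scale \<epsilon>)\<^sup>2 * (radial_factor (n - 1) * integral\<^sup>L lborel (trial_weight \<epsilon>)) = 1"
  using trial_norm(3)[of \<epsilon>] by (simp add: trial_scale_def power_divide)

lemma continuous_trial_profile: "continuous_on UNIV (\<lambda>x::real^'n. trial_profile a k (half_sq x))"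
proof (rule continuous_on_compose2[OF _ continuous_half_sq])
  show "continuous_on {0..} (trial_profile a k)"
    using trial_profile_DERIV by (intro DERIV_continuous_on) (auto intro: has_field_derivative_at_within)
qed auto

lemma continuous_trial_state: "continuous_on UNIV (trial_state \<epsilon>)"
  unfolding trial_state_def[abs_def] by (intro continuous_intros continuous_trial_profile)

lemma trial_state_wave_function:
  assumes "\<epsilon> > 0"
  shows "wave_function (trial_state \<epsilon>)"
proof -
  have sq: "(cmod (trial_state \<epsilon> x))\<^sup>2 = (trial_scale \<epsilon>)\<^sup>2 * (trial_profile (real n / 2 + \<epsilon>) 0 (half_sq x))\<^sup>2" for x
    unfolding trial_state_def norm_of_real power2_abs power_mult_distrib ..
  have "(LINT x|lborel. (cmod (trial_state \<epsilon> x))\<^sup>2) = 1"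
    unfolding sq integral_mult_right_zero trial_norm(2)[OF assms] by (rule trial_scale_sq[OF assms])
  moreover have "integrable lborel (\<lambda>x. (cmod (trial_state \<epsilon> x))\<^sup>2)"
    unfolding sq by (intro integrable_mult_right trial_norm assms)
  moreover have "trial_state \<epsilon> \<in> borel_measurable lborel"
    using borel_measurable_continuous_onI[OF continuous_trial_state] by simp
  ultimately show ?thesis by (simp add: wave_function_def square_integrable_def)
qed

lemma trial_state_symmetric: "real_spherically_symmetric (trial_state \<epsilon>)"
  unfolding real_spherically_symmetric_def trial_state_def half_sq_def
  by (intro exI[of _ "\<lambda>r. trial_scale \<epsilon> * trial_profile (real n / 2 + \<epsilon>) 0 (r\<^sup>2 / 2)"]) simp

text \<open>The n-th derivative has the factor (1 + s)^(-n), which compensates s^n. Both sides then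
  carry the same radial density, so only the ratio of energy to norm matters and no asymptotics of
  the normalization are required.\<close>

lemma trial_profile_energy_le:
  assumes "s \<ge> 0"
  shows "s ^ (3 * n - 1) * (trial_profile a n s)\<^sup>2
    \<le> (\<Prod>j<n. a + real j)\<^sup>2 * (s ^ (n - 1) * (trial_profile a 0 s)\<^sup>2)"
proof -
  have s: "s ^ (3 * n - 1) = s ^ (n - 1) * (s ^ n)\<^sup>2"
    using n_pos by (simp add: power_mult[symmetric] power_add[symmetric])
  have p: "(trial_profile a n s)\<^sup>2 * ((1 + s) ^ n)\<^sup>2 = (\<Prod>j<n. a + real j)\<^sup>2 * (trial_profile a 0 s)\<^sup>2"
  proof -
    have "(1 + s) powr (- (a + real n)) * (1 + s) ^ n = (1 + s) powr (- a)"
      using assms by (simp add: powr_realpow[symmetric] powr_add[symmetric])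
    then have "trial_profile a n s * (1 + s) ^ n = (\<Prod>j<n. - (a + real j)) * trial_profile a 0 s"
      by (simp only: trial_profile_def mult.assoc) simp
    moreover have "(\<Prod>j<n. - (a + real j))\<^sup>2 = (\<Prod>j<n. a + real j)\<^sup>2"
      by (simp only: prod_power_distrib power2_minus)
    ultimately show ?thesis by (metis power_mult_distrib)
  qed
  have "(s ^ n)\<^sup>2 \<le> ((1 + s) ^ n)\<^sup>2" using assms by (intro power_mono) auto
  then have "s ^ (n - 1) * (trial_profile a n s)\<^sup>2 * (s ^ n)\<^sup>2
    \<le> s ^ (n - 1) * (trial_profile a n s)\<^sup>2 * ((1 + s) ^ n)\<^sup>2"
    using assms by (intro mult_left_mono) auto
  then show ?thesis unfolding s using p by (simp add: mult_ac)
qed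

lemma trial_state_op_value:
  assumes \<epsilon>: "\<epsilon> > 0"
  obtains \<eta> where "has_op_value as bs (trial_state \<epsilon>) \<eta>"
    "(LINT x|lborel. (cmod (\<eta> x))\<^sup>2) \<le>
      fact (n - 1) / fact (3 * n - 1) * (\<Prod>j<n. real n / 2 + \<epsilon> + real j)\<^sup>2"
proof -
  define a where "a = real n / 2 + \<epsilon>"
  define c where "c = trial_scale \<epsilon>"
  define G where "G x = (\<Prod>j\<leftarrow>bs. x $ j) * (c * trial_profile a n (half_sq x))" for x :: "real^'n"
  define g where "g x = complex_of_real (G x)" for x :: "real^'n"
  define \<eta> where "\<eta> x = (- \<i>) ^ length bs * complex_of_real (\<Prod>j\<leftarrow>as. x $ j) * g x" for x :: "real^'n"
  have prod_cont: "continuous_on UNIV (\<lambda>x::real^'n. \<Prod>j\<leftarrow>l. x $ j)" for l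
    by (induction l) (auto intro!: continuous_intros)
  have g_cont: "continuous_on UNIV g"
    unfolding g_def G_def by (intro continuous_intros prod_cont continuous_trial_profile)
  have \<eta>_cont: "continuous_on UNIV \<eta>"
    unfolding \<eta>_def by (intro continuous_intros prod_cont g_cont)
  have weak: "has_weak_partial_derivs (trial_state \<epsilon>) g bs"
    unfolding has_weak_partial_derivs_def
  proof (intro conjI allI impI)
    show "locally_integrable (trial_state \<epsilon>)" "locally_integrable g"
      by (intro continuous_locally_integrable continuous_trial_state g_cont)+
    fix \<phi> :: "real^'n \<Rightarrow> real" assume \<phi>: "test_function \<phi>"
    have H: "((\<lambda>s. c * trial_profile a k s) has_real_derivative c * trial_profile a (Suc k) s) (at s)"
      if "s \<ge> 0" for k s
      by (rule DERIV_cmult[OF trial_profile_DERIV[OF that]])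
    have "(LINT x|lborel. partial_derivs bs \<phi> x *\<^sub>R trial_state \<epsilon> x)
      = (LINT x|lborel. complex_of_real (partial_derivs bs \<phi> x * (c * trial_profile a 0 (half_sq x))))"
      by (simp add: trial_state_def scaleR_conv_of_real a_def c_def)
    also have "\<dots> = complex_of_real (LINT x|lborel. partial_derivs bs \<phi> x * (c * trial_profile a 0 (half_sq x)))"
      by (rule integral_complex_of_real)
    also have "(LINT x|lborel. partial_derivs bs \<phi> x * (c * trial_profile a 0 (half_sq x)))
      = (- 1) ^ length bs * (LINT x|lborel. \<phi> x * G x)"
      using weak_derivs_of_radial[of "\<lambda>k s. c * trial_profile a k s", OF H \<phi>, of bs "[]"] distinct
      by (simp add: G_def length_bs)
    also have "complex_of_real \<dots> = (- 1) ^ length bs * complex_of_real (LINT x|lborel. \<phi> x * G x)"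
      by simp
    also have "complex_of_real (LINT x|lborel. \<phi> x * G x) = (LINT x|lborel. complex_of_real (\<phi> x * G x))"
      by (rule integral_complex_of_real[symmetric])
    also have "\<dots> = (LINT x|lborel. \<phi> x *\<^sub>R g x)"
      by (simp add: g_def scaleR_conv_of_real)
    finally show "(LINT x|lborel. partial_derivs bs \<phi> x *\<^sub>R trial_state \<epsilon> x)
      = (- 1) ^ length bs * (LINT x|lborel. \<phi> x *\<^sub>R g x)" .
  qed
  have sq: "(cmod (\<eta> x))\<^sup>2 = sq_mono UNIV x * (c * trial_profile a n (half_sq x))\<^sup>2" for x
  proof -
    have "cmod (\<eta> x) = \<bar>(\<Prod>j\<leftarrow>as. x $ j) * (\<Prod>j\<leftarrow>bs. x $ j) * (c * trial_profile a n (half_sq x))\<bar>"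
      by (simp only: \<eta>_def g_def G_def norm_mult norm_power norm_minus_cancel norm_ii power_one mult_1
          norm_of_real abs_mult mult.assoc)
    then show ?thesis by (simp only: power2_abs power_mult_distrib[of _ "c * _"] sq_mono_UNIV)
  qed
  define m where "m = 3 * n - 1"
  define K where "K = radial_factor m * c\<^sup>2"
  have K: "K \<ge> 0" by (simp add: K_def)
  have k: "n + card (UNIV :: 'n set) = Suc m" using n_pos card by (simp add: m_def)
  have meas: "(\<lambda>s. (c * trial_profile a n s)\<^sup>2) \<in> borel_measurable borel" by measurable
  note R = radial_integral[OF card n_pos meas k]
  define l where "l s = indicator {0..} s * (radial_factor m * s ^ m) * (c * trial_profile a n s)\<^sup>2" for s
  define r where "r s = K * (\<Prod>j<n. a + real j)\<^sup>2 * trial_weight \<epsilon> s" for s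
  have le: "l s \<le> r s" and nn: "0 \<le> l s" for s
  proof -
    have "radial_factor m * s ^ m * (c * trial_profile a n s)\<^sup>2 \<le>
      K * ((\<Prod>j<n. a + real j)\<^sup>2 * (s ^ (n - 1) * (trial_profile a 0 s)\<^sup>2))" if "s \<ge> 0"
    proof -
      have "radial_factor m * s ^ m * (c * trial_profile a n s)\<^sup>2 = K * (s ^ m * (trial_profile a n s)\<^sup>2)"
        by (simp add: K_def power_mult_distrib)
      then show ?thesis
        using mult_left_mono[OF trial_profile_energy_le[OF that, of a] K] by (simp only: m_def)
    qed
    then show "l s \<le> r s"
      by (cases "s \<ge> 0") (simp_all add: l_def r_def trial_weight_def a_def[symmetric] mult.assoc)
    show "0 \<le> l s" by (cases "s \<ge> 0") (simp_all add: l_def)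
  qed
  have r_int: "integrable lborel r" unfolding r_def by (intro integrable_mult_right integrable_trial_weight \<epsilon>)
  have l_int: "integrable lborel l"
  proof (rule Bochner_Integration.integrable_bound[OF r_int])
    show "l \<in> borel_measurable lborel" unfolding l_def by measurable
    have "norm (l s) \<le> norm (r s)" for s using le[of s] nn[of s] unfolding real_norm_def by linarith
    then show "AE s in lborel. norm (l s) \<le> norm (r s)" by simp
  qed
  have "integrable lborel (\<lambda>x. (cmod (\<eta> x))\<^sup>2)"
    unfolding sq R(1) using l_int by (simp only: l_def[abs_def])
  moreover have "\<eta> \<in> borel_measurable lborel"
    using borel_measurable_continuous_onI[OF \<eta>_cont] by simp
  ultimately have "square_integrable \<eta>" by (simp add: square_integrable_def)
  then have "has_op_value as bs (trial_state \<epsilon>) \<eta>"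
    unfolding has_op_value_def using weak by (auto simp: \<eta>_def[abs_def])
  moreover have "(LINT x|lborel. (cmod (\<eta> x))\<^sup>2) \<le>
      fact (n - 1) / fact (3 * n - 1) * (\<Prod>j<n. real n / 2 + \<epsilon> + real j)\<^sup>2"
  proof -
    have "(LINT x|lborel. (cmod (\<eta> x))\<^sup>2) = (LINT s|lborel. l s)" unfolding sq R(2) l_def ..
    also have "\<dots> \<le> (LINT s|lborel. r s)" by (rule integral_mono[OF l_int r_int le])
    also have "\<dots> = K * (\<Prod>j<n. a + real j)\<^sup>2 * integral\<^sup>L lborel (trial_weight \<epsilon>)"
      unfolding r_def by (rule integral_mult_right_zero)
    \<comment> \<open>The bound is proportional to the squared norm of the state, so the normalizing
      integral drops out.\<close>
    also have "\<dots> = c\<^sup>2 * (radial_factor (n - 1) * integral\<^sup>L lborel (trial_weight \<epsilon>)) *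
        (fact (n - 1) / fact m * (\<Prod>j<n. a + real j)\<^sup>2)"
      by (simp add: K_def)
    also have "\<dots> = fact (n - 1) / fact m * (\<Prod>j<n. a + real j)\<^sup>2"
      using trial_scale_sq[OF \<epsilon>] by (simp only: c_def mult_1)
    finally show ?thesis by (simp only: m_def a_def)
  qed
  ultimately show thesis using that by blast
qed

end

lemma balanced_split_commute:
  assumes "balanced_split as bs n"
  shows "balanced_split bs as n"
  using assms by (auto simp: balanced_split_def)

text \<open>Both deviations of every state are at least \<open>sqrt (sharp_constant n)\<close>, and
  a single family of trial states brings both arbitrarily close to it.\<close>

lemma has_infimum_uncertainty_products:
  fixes as bs :: "'n::finite list"
  assumes "balanced_split as bs n"
  shows "has_infimum (uncertainty_products as bs) (sharp_constant n)"
proof -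
  interpret ab: balanced_split as bs n by fact
  interpret ba: balanced_split bs as n by (rule balanced_split_commute[OF assms])
  define S where "S = uncertainty_products as bs"
  have c: "sharp_constant n \<ge> 0" by (simp add: sharp_constant_def)
  have lower: "sharp_constant n \<le> y" if y_S: "y \<in> S" for y
  proof -
    obtain \<psi> \<sigma> \<tau> where y: "y = \<sigma> * \<tau>" and \<psi>: "wave_function \<psi>" "real_spherically_symmetric \<psi>"
      and \<sigma>: "has_std_dev as bs \<psi> \<sigma>" and \<tau>: "has_std_dev bs as \<psi> \<tau>"
      using y_S unfolding S_def uncertainty_products_def by blast
    obtain \<eta> where \<eta>: "has_op_value as bs \<psi> \<eta>" and "\<sigma> = sqrt ((LINT x|lborel. (cmod (\<eta> x))\<^sup>2)
        - (Re (LINT x|lborel. cnj (\<psi> x) * \<eta> x))\<^sup>2)"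
      using \<sigma> by (auto simp: has_std_dev_def)
    then have 1: "\<sigma> \<ge> sqrt (sharp_constant n)"
      using ab.energy_ge_sharp_constant[OF \<psi> \<eta>] ab.expectation_eq_0[OF \<psi> \<eta>] by simp
    obtain \<eta>' where \<eta>': "has_op_value bs as \<psi> \<eta>'" and "\<tau> = sqrt ((LINT x|lborel. (cmod (\<eta>' x))\<^sup>2)
        - (Re (LINT x|lborel. cnj (\<psi> x) * \<eta>' x))\<^sup>2)"
      using \<tau> by (auto simp: has_std_dev_def)
    then have 2: "\<tau> \<ge> sqrt (sharp_constant n)"
      using ba.energy_ge_sharp_constant[OF \<psi> \<eta>'] ba.expectation_eq_0[OF \<psi> \<eta>'] by simp
    have "sqrt (sharp_constant n) * sqrt (sharp_constant n) \<le> \<sigma> * \<tau>"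
      using 1 2 c by (intro mult_mono order_trans[OF real_sqrt_ge_zero[OF c] 1]) auto
    then show ?thesis using c y by simp
  qed
  define U where "U \<epsilon> = fact (n - 1) / fact (3 * n - 1) * (\<Prod>j<n. real n / 2 + \<epsilon> + real j)\<^sup>2" for \<epsilon>
  have U: "U \<epsilon> \<ge> 0" for \<epsilon> by (simp add: U_def)
  have upper: "\<exists>y\<in>S. y \<le> U \<epsilon>" if \<epsilon>: "\<epsilon> > 0" for \<epsilon>
  proof -
    \<comment> \<open>The trial state depends on n but not on the split, so both interpretations
      speak of the same state.\<close>
    define \<psi> where "\<psi> = ab.trial_state \<epsilon>"
    have \<psi>: "wave_function \<psi>" "real_spherically_symmetric \<psi>"
      unfolding \<psi>_def using ab.trial_state_wave_function[OF \<epsilon>] ab.trial_state_symmetric by auto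
    have std: "\<exists>\<sigma>. has_std_dev as' bs' \<psi> \<sigma> \<and> 0 \<le> \<sigma> \<and> \<sigma> \<le> sqrt (U \<epsilon>)"
      if "has_op_value as' bs' \<psi> \<eta>" "(LINT x|lborel. (cmod (\<eta> x))\<^sup>2) \<le> U \<epsilon>"
        "(LINT x|lborel. cnj (\<psi> x) * \<eta> x) = 0" for as' bs' \<eta>
      using that by (intro exI[of _ "sqrt (LINT x|lborel. (cmod (\<eta> x))\<^sup>2)"])
        (auto simp: has_std_dev_def intro!: exI[of _ \<eta>])
    obtain \<eta> where \<eta>: "has_op_value as bs \<psi> \<eta>" "(LINT x|lborel. (cmod (\<eta> x))\<^sup>2) \<le> U \<epsilon>"
      using ab.trial_state_op_value[OF \<epsilon>] unfolding U_def \<psi>_def by metis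
    obtain \<sigma> where \<sigma>: "has_std_dev as bs \<psi> \<sigma>" "0 \<le> \<sigma>" "\<sigma> \<le> sqrt (U \<epsilon>)"
      using std[OF \<eta> ab.expectation_eq_0[OF \<psi> \<eta>(1)]] by blast
    obtain \<eta>' where \<eta>': "has_op_value bs as \<psi> \<eta>'" "(LINT x|lborel. (cmod (\<eta>' x))\<^sup>2) \<le> U \<epsilon>"
      using ba.trial_state_op_value[OF \<epsilon>] unfolding U_def \<psi>_def by metis
    obtain \<tau> where \<tau>: "has_std_dev bs as \<psi> \<tau>" "0 \<le> \<tau>" "\<tau> \<le> sqrt (U \<epsilon>)"
      using std[OF \<eta>' ba.expectation_eq_0[OF \<psi> \<eta>'(1)]] by blast
    have "\<sigma> * \<tau> \<in> S" unfolding S_def uncertainty_products_def using \<psi> \<sigma>(1) \<tau>(1) by blast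
    moreover have "\<sigma> * \<tau> \<le> sqrt (U \<epsilon>) * sqrt (U \<epsilon>)"
      using \<sigma> \<tau> U[of \<epsilon>] by (intro mult_mono) auto
    ultimately show ?thesis using U[of \<epsilon>] by auto
  qed
  have bdd: "bdd_below S" using lower by (auto simp: bdd_below_def)
  have ne: "S \<noteq> {}" using upper[of 1] by auto
  have "Inf S \<le> U \<epsilon>" if "\<epsilon> > 0" for \<epsilon>
    using upper[OF that] cInf_lower[OF _ bdd] by (meson order_trans)
  then have "\<forall>\<^sub>F \<epsilon> in at_right 0. Inf S \<le> U \<epsilon>"
    by (auto simp: eventually_at_right_field intro!: exI[of _ 1])
  \<comment> \<open>\<open>U\<close> is a polynomial in \<open>\<epsilon>\<close> whose value at 0
    is the sharp constant, as n/2 + j = (n + 2j)/2.\<close>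
  moreover have "(U \<longlongrightarrow> sharp_constant n) (at_right 0)"
  proof -
    have "isCont U 0" unfolding U_def by (intro continuous_intros)
    then have "(U \<longlongrightarrow> U 0) (at_right 0)" unfolding isCont_def by (rule filterlim_at_split[THEN iffD1, THEN conjunct2])
    moreover have "real n / 2 + real j = real (n + 2 * j) / 2" for j by (simp add: field_simps)
    ultimately show ?thesis by (simp add: U_def sharp_constant_def)
  qed
  ultimately have "Inf S \<le> sharp_constant n"
    by (intro tendsto_lowerbound[where F = "at_right 0"]) auto
  moreover have "sharp_constant n \<le> Inf S" by (rule cInf_greatest[OF ne lower])
  ultimately show ?thesis using ne bdd by (simp add: has_infimum_def S_def)
qed

theorem mainTheorem3:
  "has_infimum (uncertainty_products [1, 2 :: 4] [3, 4]) (1 / 30) \<and>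
   has_infimum (uncertainty_products [1, 2, 3 :: 6] [4, 5, 6]) (35 / 4096)"
proof
  \<comment> \<open>For n = 2 the constant is 1!/5! times (1 * 2)^2, that is, 4/120.\<close>
  have "balanced_split [1, 2 :: 4] [3, 4] 2" by unfold_locales auto
  from has_infimum_uncertainty_products[OF this]
  show "has_infimum (uncertainty_products [1, 2 :: 4] [3, 4]) (1 / 30)"
    by (simp add: sharp_constant_def eval_nat_numeral fact_numeral)
  \<comment> \<open>For n = 3 the constant is 2!/8! times (3/2 * 5/2 * 7/2)^2, that is, (105/8)^2 /
    20160.\<close>
  have "balanced_split [1, 2, 3 :: 6] [4, 5, 6] 3" by unfold_locales auto
  from has_infimum_uncertainty_products[OF this]
  show "has_infimum (uncertainty_products [1, 2, 3 :: 6] [4, 5, 6]) (35 / 4096)"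
    by (simp add: sharp_constant_def eval_nat_numeral)
qed

end
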